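(* Let $\alpha>0$ and let $n(\alpha)$ be the smallest positive integer with $n(\alpha)\ge\alpha+1$. For every $u\in W_0^{1,2\alpha,6}(\mathbb{R}^3)$, $$\Big(\int_{\mathbb{R}^3}|x|^{2\alpha}|u|^6\,dx_1dx_2dy\Big)^{1/6}\le C_{2\alpha,6}^{-1}\Big(\int_{\mathbb{R}^3}|\nabla_G u|^2\,dx_1dx_2dy\Big)^{1/2},$$ where the best constant $$C_{2\alpha,6}:=\inf_{u\in W_0^{1,2\alpha,6}(\mathbb{R}^3)\setminus\{0\}}\frac{\big(\int_{\mathbb{R}^3}|\nabla_G u|^2\,dx_1dx_2dy\big)^{1/2}}{\big(\int_{\mathbb{R}^3}|x|^{2\alpha}|u|^6\,dx_1dx_2dy\big)^{1/6}}$$ satisfies $$C_{2\alpha,6}\ge\Big(\frac{2\pi}{n(\alpha)}\Big)^{-1/3}(\alpha+1)^{-1/3}D_{2,6,3},$$ with $D_{2,6,3}=3^{1/2}\left(\tfrac{1}{2}\right)^{-1/2}\left[\tfrac12 B\!\left(\tfrac32,\tfrac32\right)\right]^{1/3}$, $B$ denoting the Beta function.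
   Context: Write points of $\mathbb{R}^3$ as $(x_1,x_2,y)$ with $|x|=\sqrt{x_1^2+x_2^2}$, and $|\nabla_G u|=(u_{x_1}^2+u_{x_2}^2+|x|^{2\alpha}u_y^2)^{1/2}$. For $q>1$, $W_0^{1,2\alpha,q}(\mathbb{R}^3)$ is the completion of $C_0^\infty(\mathbb{R}^3)$ with respect to the norm $\|u\|=\big(\int_{\mathbb{R}^3}|\nabla_G u|^2\big)^{1/2}+\big(\int_{\mathbb{R}^3}|x|^{2\alpha}|u|^q\big)^{1/q}$. The constant $D_{2,6,3}$ is the case $p=2,q=6,m=3$ of Talenti's constant $D_{p,q,m}=m^{1/p}\left(\frac{p-1}{m-1}\right)^{-1/p'}\left[\frac1{p'}B\left(\frac mp,\frac m{p'}\right)\right]^{1/m}$, $p'=p/(p-1)$. *)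

theory Defs
  imports "HOL-Analysis.Analysis"
begin

text \<open>Points of R^3 are vectors p :: real^3 with p$1 = x1, p$2 = x2, p$3 = y.\<close>

definition xnorm :: "real^3 \<Rightarrow> real" where
  "xnorm p = sqrt ((p$1)^2 + (p$2)^2)"

definition pd :: "(real^3 \<Rightarrow> real) \<Rightarrow> 3 \<Rightarrow> real^3 \<Rightarrow> real" where
  "pd f i p = frechet_derivative f (at p) (axis i 1)"

fun iter_pd :: "3 list \<Rightarrow> (real^3 \<Rightarrow> real) \<Rightarrow> (real^3 \<Rightarrow> real)" where
  "iter_pd [] f = f"
| "iter_pd (i # is) f = pd (iter_pd is f) i"

definition C0_infty :: "(real^3 \<Rightarrow> real) set" where
  "C0_infty = {f. (\<forall>is p. iter_pd is f differentiable (at p)) \<and>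
                  compact (closure {p. f p \<noteq> 0})}"

definition gradG :: "real \<Rightarrow> (real^3 \<Rightarrow> real) \<Rightarrow> real^3 \<Rightarrow> real^3" where
  "gradG \<alpha> f p = vector [pd f 1 p, pd f 2 p, xnorm p powr \<alpha> * pd f 3 p]"

text \<open>The completion W_0^{1,2alpha,q}(R^3) of C_0^infty with respect to the norm
  ||u|| = (int |nabla_G u|^2)^(1/2) + (int |x|^(2alpha) |u|^q)^(1/q),
  realised concretely: an element is a pair (u, V) of measurable functions which is the
  limit of some sequence phi_k in C_0^infty, i.e. (nabla_G phi_k) -> V in L^2 and
  phi_k -> u in the weighted L^q space.  V plays the role of nabla_G u.\<close>
definition W0 :: "real \<Rightarrow> real \<Rightarrow> ((real^3 \<Rightarrow> real) \<times> (real^3 \<Rightarrow> real^3)) set" where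
  "W0 \<alpha> q = {(u, V). u \<in> borel_measurable lborel \<and> V \<in> borel_measurable lborel \<and>
     (\<exists>\<phi>::nat \<Rightarrow> real^3 \<Rightarrow> real. (\<forall>k. \<phi> k \<in> C0_infty) \<and>
        (\<lambda>k. \<integral>\<^sup>+ p. ennreal ((norm (gradG \<alpha> (\<phi> k) p - V p))^2) \<partial>lborel) \<longlonglongrightarrow> 0 \<and>
        (\<lambda>k. \<integral>\<^sup>+ p. ennreal (xnorm p powr (2*\<alpha>) * \<bar>\<phi> k p - u p\<bar> powr q) \<partial>lborel) \<longlonglongrightarrow> 0)}"

definition grad_energy :: "(real^3 \<Rightarrow> real^3) \<Rightarrow> real" where
  "grad_energy V = (\<integral>p. (norm (V p))^2 \<partial>lborel)"

definition weighted_Lq :: "real \<Rightarrow> real \<Rightarrow> (real^3 \<Rightarrow> real) \<Rightarrow> real" where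
  "weighted_Lq \<alpha> q u = (\<integral>p. xnorm p powr (2*\<alpha>) * \<bar>u p\<bar> powr q \<partial>lborel)"

definition W_nonzero :: "real \<Rightarrow> real \<Rightarrow> (real^3 \<Rightarrow> real) \<times> (real^3 \<Rightarrow> real^3) \<Rightarrow> bool" where
  "W_nonzero \<alpha> q uV \<longleftrightarrow> sqrt (grad_energy (snd uV)) + weighted_Lq \<alpha> q (fst uV) powr (1/q) > 0"

definition best_const :: "real \<Rightarrow> real" where
  "best_const \<alpha> = Inf {sqrt (grad_energy V) / weighted_Lq \<alpha> 6 u powr (1/6) |u V.
                         (u, V) \<in> W0 \<alpha> 6 \<and> W_nonzero \<alpha> 6 (u, V)}"

definition talenti_D :: "real \<Rightarrow> real \<Rightarrow> real \<Rightarrow> real" where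
  "talenti_D p q m = (let p' = p / (p - 1) in
     m powr (1/p) * ((p - 1) / (m - 1)) powr (-(1/p')) * ((1/p') * Beta (m/p) (m/p')) powr (1/m))"

definition n_alpha :: "real \<Rightarrow> nat" where
  "n_alpha \<alpha> = (LEAST n::nat. n \<ge> 1 \<and> real n \<ge> \<alpha> + 1)"

end

theory Submission
  imports Defs "HOL-Complex_Analysis.Cauchy_Integral_Theorem"
begin

text \<open>The stated constant leaves enough room for an argument of Gagliardo--Nirenberg type. Put \<open>m = \<alpha> + 1\<close>
  and \<open>N = n(\<alpha>) - 1\<close>, so that \<open>1 \<le> N \<le> m\<close>. In polar coordinates \<open>(r, \<eta>) \<mapsto> (r\<^sup>m, N \<eta>)\<close> maps the
  \<open>x\<close>-plane onto the \<open>N\<close>-sheeted branched cover of the flat plane and turns \<open>|x|\<^sup>2\<^sup>\<alpha> dx\<close> into a multiple of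
  flat area. On this cover the directions of the two axes are globally defined up to sign, so integrating
  along horizontal and vertical lines gives
  \<open>\<integral> |x|\<^sup>2\<^sup>\<alpha> f\<^sup>2 \<le> m / (8 N) (\<integral> |x|\<^sup>\<alpha> |\<nabla>f|)\<^sup>2\<close>, just as in the plane.
  For \<open>f = u\<^sup>3\<close> on the slices \<open>y = const\<close> this bounds \<open>M = \<integral> |x|\<^sup>2\<^sup>\<alpha> u\<^sup>6\<close> by
  \<open>9 m / (8 N) \<integral> |\<nabla>\<^sub>x u|\<^sup>2\<close> times the supremum over \<open>y\<close> of \<open>\<integral> |x|\<^sup>2\<^sup>\<alpha> u\<^sup>4 dx\<close>, and that supremum is at most
  \<open>2 (M \<integral> |x|\<^sup>2\<^sup>\<alpha> u\<^sub>y\<^sup>2)\<^sup>1\<^sup>/\<^sup>2\<close> by integration in \<open>y\<close>. Hence \<open>M \<le> 3/4 (m / N)\<^sup>2 (\<integral> |\<nabla>\<^sub>G u|\<^sup>2)\<^sup>3\<close>, and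
  \<open>n(\<alpha>) \<le> 2 N\<close> suffices for the constant.\<close>

section \<open>One-dimensional integration\<close>

text \<open>Two conditions fix N. The derivatives of f along the axes of the cover have coefficients
  cos(N \<eta>) and sin(N \<eta>), which are single-valued on the x-plane only for an integer N. And
  the cover map divides the radial derivative by m and the angular one by N, so N \<le> m is what
  bounds both by the factor 1/N. The map is conformal only for N = m; the ratio m/N is the price of
  rounding. This price is paid by the target constant c: with K = 3/4 (m/N)^2 one gets K c^6 =
  81/512 (n(\<alpha>)/N)^2. So \<alpha> survives only through n(\<alpha>)/N, whose worst value 2, at
  N = 1, still gives 81/128 < 1. A different obstacle is the meaning of the infimum. The integral of
  a non-integrable function is 0, division by 0 gives 0, and the infimum of an empty set says
  nothing. Hence finiteness of both integrals on the completion, vanishing of the energy whenever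
  the weighted norm vanishes, and existence of one nonzero element all have to be proved.\<close>

lemma nn_integral_substitution_Icc:
  fixes f :: "real \<Rightarrow> ennreal"
  assumes f: "f \<in> borel_measurable borel" and g: "g \<in> borel_measurable borel"
    and d: "\<And>x. x \<in> {a..b} \<Longrightarrow> (g has_real_derivative g' x) (at x)"
    and c: "continuous_on {a..b} g'" and nn: "\<And>x. x \<in> {a..b} \<Longrightarrow> g' x \<ge> 0"
    and ab: "a \<le> b"
  shows "(\<integral>\<^sup>+x. f x * indicator {g a..g b} x \<partial>lborel) =
         (\<integral>\<^sup>+x. f (g x) * ennreal (g' x) * indicator {a..b} x \<partial>lborel)"
proof -
  note [measurable] = f g
  have mg': "(\<lambda>x. ennreal (g' x) * indicator {a..b} x) \<in> borel_measurable borel"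
  proof -
    have "(\<lambda>x. indicator {a..b} x *\<^sub>R g' x) \<in> borel_measurable borel"
      using borel_measurable_continuous_on_indicator[OF _ c] by simp
    then have "(\<lambda>x. ennreal (indicator {a..b} x *\<^sub>R g' x)) \<in> borel_measurable borel" by simp
    also have "(\<lambda>x. ennreal (indicator {a..b} x *\<^sub>R g' x)) = (\<lambda>x. ennreal (g' x) * indicator {a..b} x)"
      by (auto simp: indicator_def)
    finally show ?thesis .
  qed
  note [measurable] = mg'
  let ?M = "distr (density lborel (\<lambda>x. ennreal (g' x) * indicator {a..b} x)) borel g"
  let ?N = "density lborel (indicator {g a..g b} :: real \<Rightarrow> ennreal)"
  \<comment> \<open>\<open>f\<close> may take the value infinity, so both sides are read as
    integrals of \<open>f\<close> against two measures; these agree on Borel sets because there only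
    the substitution of an indicator function is involved.\<close>
  have "?M = ?N"
  proof (rule measure_eqI)
    show "sets ?M = sets ?N" by simp
    fix A assume "A \<in> sets ?M"
    then have A[measurable]: "A \<in> sets borel" by simp
    have "g -` A \<in> sets borel" using measurable_sets[OF g A] by simp
    then have "emeasure ?M A = (\<integral>\<^sup>+x. ennreal (g' x) * indicator {a..b} x * indicator A (g x) \<partial>lborel)"
      by (subst emeasure_distr) (auto simp: emeasure_density intro!: nn_integral_cong split: split_indicator)
    also have "\<dots> = (\<integral>\<^sup>+x. ennreal (indicator A (g x) * g' x * indicator {a..b} x) \<partial>lborel)"
      by (intro nn_integral_cong) (auto split: split_indicator)
    also have "\<dots> = (\<integral>\<^sup>+x. ennreal (indicator A x * indicator {g a..g b} x) \<partial>lborel)"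
      by (subst nn_integral_substitution[OF _ d c nn ab, where f="indicator A", symmetric])
         (auto simp: set_borel_measurable_def)
    also have "\<dots> = emeasure ?N A"
      by (subst emeasure_density) (auto intro!: nn_integral_cong split: split_indicator)
    finally show "emeasure ?M A = emeasure ?N A" .
  qed
  then have "(\<integral>\<^sup>+x. f x \<partial>?N) = (\<integral>\<^sup>+x. f x \<partial>?M)" by simp
  then show ?thesis
    by (subst (asm) nn_integral_distr) (auto simp: nn_integral_density mult_ac)
qed

lemma nn_integral_indicator_incseq:
  assumes "f \<in> borel_measurable M" "\<And>n. A n \<in> sets M" "incseq A"
  shows "(\<integral>\<^sup>+x. f x * indicator (\<Union>n. A n) x \<partial>M) = (SUP n. \<integral>\<^sup>+x. f x * indicator (A n) x \<partial>M)"
proof -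
  have *: "indicator (\<Union>n. A n) x = (SUP n. indicator (A n) x :: ennreal)" for x
  proof (cases "\<exists>n. x \<in> A n")
    case True
    then obtain n where "x \<in> A n" by blast
    then have "(SUP n. indicator (A n) x :: ennreal) = 1"
      by (intro antisym SUP_least SUP_upper2[of n]) (auto simp: indicator_def)
    with True show ?thesis by auto
  qed auto
  show ?thesis
    unfolding * SUP_mult_left_ennreal
    by (rule nn_integral_monotone_convergence_SUP)
       (use assms in \<open>auto simp: incseq_def le_fun_def indicator_def intro!: mult_left_mono\<close>)
qed

text \<open>Exhaustion by compact intervals allows an unbounded domain, an open range, or a
  derivative that is singular at an endpoint, as for \<open>arctan\<close> on the whole line and for
  powers at 0.\<close>

lemma nn_integral_substitution_UN:
  fixes f :: "real \<Rightarrow> ennreal" and a b :: "nat \<Rightarrow> real"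
  assumes f[measurable]: "f \<in> borel_measurable borel" and g[measurable]: "g \<in> borel_measurable borel"
    and g'[measurable]: "g' \<in> borel_measurable borel"
    and d: "\<And>n x. x \<in> {a n..b n} \<Longrightarrow> (g has_real_derivative g' x) (at x)"
    and c: "\<And>n. continuous_on {a n..b n} g'" and nn: "\<And>n x. x \<in> {a n..b n} \<Longrightarrow> g' x \<ge> 0"
    and ab: "\<And>n. a n \<le> b n" and "decseq a" "incseq b"
  shows "(\<integral>\<^sup>+x. f x * indicator (\<Union>n. {g (a n)..g (b n)}) x \<partial>lborel) =
         (\<integral>\<^sup>+x. f (g x) * ennreal (g' x) * indicator (\<Union>n. {a n..b n}) x \<partial>lborel)"
proof -
  have sub: "{a m..b m} \<subseteq> {a n..b n}" if "m \<le> n" for m n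
    using \<open>decseq a\<close> \<open>incseq b\<close> that by (auto simp: decseq_def incseq_def intro: order_trans)
  have mono: "g x \<le> g y" if "x \<le> y" "x \<in> {a n..b n}" "y \<in> {a n..b n}" for x y n
    using that d nn by (intro DERIV_nonneg_imp_nondecreasing[OF that(1)]) (meson atLeastAtMost_iff order_trans)
  have sub': "{g (a m)..g (b m)} \<subseteq> {g (a n)..g (b n)}" if "m \<le> n" for m n
  proof -
    have "a n \<le> a m" "b m \<le> b n" using \<open>decseq a\<close> \<open>incseq b\<close> that by (auto simp: decseq_def incseq_def)
    then have "g (a n) \<le> g (a m)" "g (b m) \<le> g (b n)"
      using ab[of m] ab[of n] by (auto intro!: mono[of _ _ n])
    then show ?thesis by auto
  qed
  have "(\<integral>\<^sup>+x. f x * indicator (\<Union>n. {g (a n)..g (b n)}) x \<partial>lborel)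
      = (SUP n. \<integral>\<^sup>+x. f x * indicator {g (a n)..g (b n)} x \<partial>lborel)"
    using sub' by (intro nn_integral_indicator_incseq) (auto simp: incseq_def)
  also have "\<dots> = (SUP n. \<integral>\<^sup>+x. f (g x) * ennreal (g' x) * indicator {a n..b n} x \<partial>lborel)"
    by (intro SUP_cong refl nn_integral_substitution_Icc f g) (use d c nn ab in auto)
  also have "\<dots> = (\<integral>\<^sup>+x. f (g x) * ennreal (g' x) * indicator (\<Union>n. {a n..b n}) x \<partial>lborel)"
    using sub by (intro nn_integral_indicator_incseq[symmetric]) (auto simp: incseq_def)
  finally show ?thesis .
qed

lemma nn_integral_substitution_arctan:
  fixes f :: "real \<Rightarrow> ennreal"
  assumes [measurable]: "f \<in> borel_measurable borel"
  shows "(\<integral>\<^sup>+x. f x * indicator {-(pi/2)<..<pi/2} x \<partial>lborel) = (\<integral>\<^sup>+t. f (arctan t) * ennreal (1 / (1 + t\<^sup>2)) \<partial>lborel)"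
proof -
  have U: "(\<Union>n. {arctan (- real n)..arctan (real n)}) = {-(pi/2)<..<pi/2}"
  proof (intro equalityI subsetI)
    fix x assume "x \<in> (\<Union>n. {arctan (- real n)..arctan (real n)})"
    then obtain n where "arctan (- real n) \<le> x" "x \<le> arctan (real n)" by auto
    with arctan_lbound[of "- real n"] arctan_ubound[of "real n"] show "x \<in> {-(pi/2)<..<pi/2}" by auto
  next
    fix x assume x: "x \<in> {-(pi/2)<..<pi/2}"
    obtain n where n: "\<bar>tan x\<bar> \<le> real n" using real_arch_simple by blast
    then have "arctan (- real n) \<le> arctan (tan x)" "arctan (tan x) \<le> arctan (real n)"
      by (auto intro: arctan_monotone')
    moreover have "arctan (tan x) = x" using x by (intro arctan_tan) auto
    ultimately show "x \<in> (\<Union>n. {arctan (- real n)..arctan (real n)})" by auto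
  qed
  have V: "(\<Union>n. {- real n..real n}) = UNIV"
  proof (intro equalityI subsetI UNIV_I)
    fix x :: real
    obtain n where n: "\<bar>x\<bar> \<le> real n" using real_arch_simple by blast
    then show "x \<in> (\<Union>n. {- real n..real n})" by (intro UN_I[of n]) auto
  qed
  have "(\<integral>\<^sup>+x. f x * indicator (\<Union>n. {arctan (- real n)..arctan (real n)}) x \<partial>lborel) =
        (\<integral>\<^sup>+x. f (arctan x) * ennreal (1 / (1 + x\<^sup>2)) * indicator (\<Union>n. {- real n..real n}) x \<partial>lborel)"
  proof (rule nn_integral_substitution_UN)
    show "(arctan has_real_derivative 1 / (1 + x\<^sup>2)) (at x)" for x
      by (rule DERIV_cong[OF DERIV_arctan]) (simp add: inverse_eq_divide)
    show "continuous_on {- real n..real n} (\<lambda>x. 1 / (1 + x\<^sup>2))" for n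
      by (intro continuous_intros) (auto simp: add_nonneg_eq_0_iff)
  qed (auto simp: decseq_def incseq_def)
  then show ?thesis by (simp add: U V)
qed

lemma nn_integral_substitution_powr:
  fixes f :: "real \<Rightarrow> ennreal"
  assumes [measurable]: "f \<in> borel_measurable borel" and m: "m > 0"
  shows "(\<integral>\<^sup>+s. f s * indicator {0<..} s \<partial>lborel)
       = (\<integral>\<^sup>+r. f (r powr m) * ennreal (m * r powr (m - 1)) * indicator {0<..} r \<partial>lborel)"
proof -
  let ?a = "\<lambda>n. 1 / (real n + 1)" and ?b = "\<lambda>n. real n + 1"
  have V: "(\<Union>n. {?a n..?b n}) = {0<..}"
  proof (intro equalityI subsetI)
    fix x :: real assume x: "x \<in> {0<..}"
    obtain n where n: "max x (1/x) \<le> real n" using real_arch_simple by blast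
    then have "1 / x \<le> real n + 1" by auto
    then have "1 / (real n + 1) \<le> x" using x by (simp add: field_simps)
    with n show "x \<in> (\<Union>n. {?a n..?b n})" by auto
  qed (auto intro: less_le_trans[rotated])
  have U: "(\<Union>n. {?a n powr m..?b n powr m}) = {0<..}"
  proof (intro equalityI subsetI)
    fix x :: real assume "x \<in> {0<..}"
    then have x: "x > 0" by simp
    then have "x powr (1/m) \<in> (\<Union>n. {?a n..?b n})" unfolding V by simp
    then obtain n where "?a n \<le> x powr (1/m)" "x powr (1/m) \<le> ?b n" by auto
    then have "?a n powr m \<le> (x powr (1/m)) powr m" "(x powr (1/m)) powr m \<le> ?b n powr m"
      using m by (auto intro!: powr_mono2)
    then show "x \<in> (\<Union>n. {?a n powr m..?b n powr m})" using x m by (auto simp: powr_powr)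
  next
    fix x :: real assume "x \<in> (\<Union>n. {?a n powr m..?b n powr m})"
    then obtain n where "?a n powr m \<le> x" by auto
    moreover have "?a n powr m > 0" by simp
    ultimately have "0 < x" by (rule less_le_trans[rotated])
    then show "x \<in> {0<..}" by simp
  qed
  have pos: "x > 0" if "x \<in> {?a n..?b n}" for x n
    using that V by blast
  have "(\<integral>\<^sup>+x. f x * indicator (\<Union>n. {?a n powr m..?b n powr m}) x \<partial>lborel) =
        (\<integral>\<^sup>+x. f (x powr m) * ennreal (m * x powr (m - 1)) * indicator (\<Union>n. {?a n..?b n}) x \<partial>lborel)"
  proof (rule nn_integral_substitution_UN)
    show "((\<lambda>x. x powr m) has_real_derivative m * x powr (m - 1)) (at x)" if "x \<in> {?a n..?b n}" for x n
      using has_real_derivative_powr[OF pos[OF that]] .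
    show "continuous_on {?a n..?b n} (\<lambda>x. m * x powr (m - 1))" for n
      using pos by (intro continuous_intros) force
    show "?a n \<le> ?b n" for n by (rule order_trans[of _ 1]) auto
  qed (use m in \<open>auto simp: decseq_def incseq_def field_simps\<close>)
  then show ?thesis by (simp only: U V)
qed

text \<open>Integrating the derivative up to \<open>t\<close> from the left and down to
  \<open>t\<close> from the right both recover the absolute value of \<open>h t\<close>, and the two
  ranges overlap in a null set only. The factor 1/2 gained over a one-sided estimate enters all
  later constants.\<close>

lemma abs_le_half_nn_integral_deriv:
  fixes h h' :: "real \<Rightarrow> real"
  assumes d: "\<And>t. (h has_real_derivative h' t) (at t)" and c: "continuous_on UNIV h'"
    and z: "\<And>t. R \<le> \<bar>t\<bar> \<Longrightarrow> h t = 0"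
  shows "ennreal \<bar>h t\<bar> \<le> ennreal (1/2) * (\<integral>\<^sup>+ s. ennreal \<bar>h' s\<bar> \<partial>lborel)"
proof -
  have [measurable]: "h' \<in> borel_measurable borel" using c by (rule borel_measurable_continuous_onI)
  define S where "S = max \<bar>R\<bar> \<bar>t\<bar> + 1"
  have S: "-S < t" "t < S" "h S = 0" "h (-S) = 0" unfolding S_def by (auto intro!: z)
  have ftc: "ennreal \<bar>h b - h a\<bar> \<le> (\<integral>\<^sup>+ s. ennreal \<bar>h' s\<bar> * indicator {a..b} s \<partial>lborel)" if "a \<le> b" for a b
  proof -
    have "has_bochner_integral lborel (\<lambda>x. h' x * indicator {a .. b} x) (h b - h a)"
      using that d continuous_on_eq_continuous_at[of UNIV h'] c
      by (intro has_bochner_integral_FTC_Icc_real) auto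
    then have "ennreal (norm (h b - h a)) \<le> (\<integral>\<^sup>+ s. norm (h' s * indicator {a..b} s) \<partial>lborel)"
      using integral_norm_bound_ennreal has_bochner_integral_iff by metis
    also have "\<dots> = (\<integral>\<^sup>+ s. ennreal \<bar>h' s\<bar> * indicator {a..b} s \<partial>lborel)"
      by (intro nn_integral_cong) (auto split: split_indicator)
    finally show ?thesis by simp
  qed
  have "ennreal \<bar>h t\<bar> + ennreal \<bar>h t\<bar> \<le> (\<integral>\<^sup>+ s. ennreal \<bar>h' s\<bar> * indicator {-S..t} s \<partial>lborel)
      + (\<integral>\<^sup>+ s. ennreal \<bar>h' s\<bar> * indicator {t..S} s \<partial>lborel)"
    using ftc[of "-S" t] ftc[of t S] S by (intro add_mono) auto
  also have "\<dots> = (\<integral>\<^sup>+ s. ennreal \<bar>h' s\<bar> * indicator {-S..t} s + ennreal \<bar>h' s\<bar> * indicator {t..S} s \<partial>lborel)"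
    by (rule nn_integral_add[symmetric]) auto
  also have "\<dots> \<le> (\<integral>\<^sup>+ s. ennreal \<bar>h' s\<bar> \<partial>lborel)"
    by (intro nn_integral_mono_AE AE_mp[OF AE_lborel_singleton[of t] AE_I2]) (auto split: split_indicator)
  finally have *: "ennreal \<bar>h t\<bar> + ennreal \<bar>h t\<bar> \<le> (\<integral>\<^sup>+ s. ennreal \<bar>h' s\<bar> \<partial>lborel)" .
  have "ennreal \<bar>h t\<bar> = ennreal (1/2) * (ennreal \<bar>h t\<bar> + ennreal \<bar>h t\<bar>)"
    by (simp add: ennreal_plus[symmetric] ennreal_mult'[symmetric] del: ennreal_plus ennreal_half)
  also have "\<dots> \<le> ennreal (1/2) * (\<integral>\<^sup>+ s. ennreal \<bar>h' s\<bar> \<partial>lborel)"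
    using * by (rule mult_left_mono) simp
  finally show ?thesis .
qed

section \<open>Polar coordinates\<close>

text \<open>Tonelli and one-variable substitutions suffice: a = b t on each horizontal line,
  exchange of the integrals, then b = s cos(arctan t) on each ray. The range of \<open>s\<close>
  needs no indicator, since \<open>ennreal s\<close> is 0 for negative \<open>s\<close>.\<close>

lemma nn_integral_polar_upper:
  fixes H :: "real \<times> real \<Rightarrow> ennreal"
  assumes [measurable]: "H \<in> borel_measurable borel"
  shows "(\<integral>\<^sup>+b. (\<integral>\<^sup>+a. H (a, b) \<partial>lborel) * indicator {0<..} b \<partial>lborel) =
    (\<integral>\<^sup>+\<phi>. (\<integral>\<^sup>+s. H (s * cos \<phi>, s * sin \<phi>) * ennreal s \<partial>lborel) * indicator {0<..<pi} \<phi> \<partial>lborel)"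
proof -
  define K where "K \<psi> = (\<integral>\<^sup>+s. H (s * sin \<psi>, s * cos \<psi>) * ennreal s \<partial>lborel)" for \<psi>
  have K[measurable]: "K \<in> borel_measurable borel" unfolding K_def by measurable
  have "(\<integral>\<^sup>+b. (\<integral>\<^sup>+a. H (a, b) \<partial>lborel) * indicator {0<..} b \<partial>lborel)
      = (\<integral>\<^sup>+b. (\<integral>\<^sup>+t. H (b * t, b) * ennreal b \<partial>lborel) \<partial>lborel)"
  proof (rule nn_integral_cong)
    fix b :: real
    show "(\<integral>\<^sup>+a. H (a, b) \<partial>lborel) * indicator {0<..} b = (\<integral>\<^sup>+t. H (b * t, b) * ennreal b \<partial>lborel)"
    proof (cases "b > 0")
      case True
      then show ?thesis
        by (subst nn_integral_real_affine[of _ b 0]) (auto simp: nn_integral_cmult mult.commute[of _ "ennreal b"])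
    next
      case False
      then show ?thesis by (simp add: ennreal_neg)
    qed
  qed
  also have "\<dots> = (\<integral>\<^sup>+t. (\<integral>\<^sup>+b. H (b * t, b) * ennreal b \<partial>lborel) \<partial>lborel)"
    by (rule lborel_pair.Fubini') measurable
  also have "\<dots> = (\<integral>\<^sup>+t. K (arctan t) * ennreal (1 / (1 + t\<^sup>2)) \<partial>lborel)"
  proof (rule nn_integral_cong)
    fix t :: real
    define c where "c = cos (arctan t)"
    have c: "c > 0" "c * c = 1 / (1 + t\<^sup>2)" "c * t = sin (arctan t)"
      unfolding c_def by (auto simp: cos_arctan sin_arctan add_pos_nonneg)
    have "(\<integral>\<^sup>+b. H (b * t, b) * ennreal b \<partial>lborel) = ennreal c * (\<integral>\<^sup>+s. H (c * s * t, c * s) * ennreal (c * s) \<partial>lborel)"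
      using c(1) by (subst nn_integral_real_affine[of _ c 0]) auto
    also have "\<dots> = (\<integral>\<^sup>+s. ennreal (c * c) * (H (s * (c * t), s * c) * ennreal s) \<partial>lborel)"
    proof (subst nn_integral_cmult[symmetric])
      have e: "ennreal (c * s) = ennreal c * ennreal s" for s using c(1) by (simp add: ennreal_mult')
      show "(\<integral>\<^sup>+s. ennreal c * (H (c * s * t, c * s) * ennreal (c * s)) \<partial>lborel)
          = (\<integral>\<^sup>+s. ennreal (c * c) * (H (s * (c * t), s * c) * ennreal s) \<partial>lborel)"
        by (rule nn_integral_cong) (unfold e, simp add: mult_ac)
    qed measurable
    also have "\<dots> = K (arctan t) * ennreal (1 / (1 + t\<^sup>2))"
      unfolding c(2,3) unfolding c_def K_def by (subst nn_integral_cmult) (auto simp: mult_ac)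
    finally show "(\<integral>\<^sup>+b. H (b * t, b) * ennreal b \<partial>lborel) = K (arctan t) * ennreal (1 / (1 + t\<^sup>2))" .
  qed
  also have "\<dots> = (\<integral>\<^sup>+x. K x * indicator {-(pi/2)<..<pi/2} x \<partial>lborel)"
    by (rule nn_integral_substitution_arctan[symmetric]) measurable
  \<comment> \<open>The ratio t = a/b is the cotangent of the polar angle, so
    \<open>arctan t\<close> measures the angle from the vertical axis and has to be
    reflected.\<close>
  also have "\<dots> = (\<integral>\<^sup>+\<phi>. K (pi/2 - \<phi>) * indicator {0<..<pi} \<phi> \<partial>lborel)"
    by (subst nn_integral_real_affine[of _ "-1" "pi/2"])
       (auto intro!: nn_integral_cong split: split_indicator)
  also have "\<dots> = (\<integral>\<^sup>+\<phi>. (\<integral>\<^sup>+s. H (s * cos \<phi>, s * sin \<phi>) * ennreal s \<partial>lborel) * indicator {0<..<pi} \<phi> \<partial>lborel)"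
    unfolding K_def sin_diff cos_diff by simp
  finally show ?thesis .
qed

lemma nn_integral_polar:
  fixes H :: "real \<times> real \<Rightarrow> ennreal"
  assumes [measurable]: "H \<in> borel_measurable borel"
  shows "(\<integral>\<^sup>+p. H p \<partial>lborel) =
    (\<integral>\<^sup>+\<phi>. (\<integral>\<^sup>+s. H (s * cos \<phi>, s * sin \<phi>) * ennreal s \<partial>lborel) * indicator {-pi<..<pi} \<phi> \<partial>lborel)"
proof -
  define F where "F b = (\<integral>\<^sup>+a. H (a, b) \<partial>lborel)" for b
  define G where "G \<phi> = (\<integral>\<^sup>+s. H (s * cos \<phi>, s * sin \<phi>) * ennreal s \<partial>lborel)" for \<phi>
  have [measurable]: "F \<in> borel_measurable borel" "G \<in> borel_measurable borel"
    unfolding F_def G_def by measurable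
  have up: "(\<integral>\<^sup>+b. F b * indicator {0<..} b \<partial>lborel) = (\<integral>\<^sup>+\<phi>. G \<phi> * indicator {0<..<pi} \<phi> \<partial>lborel)"
    unfolding F_def G_def by (rule nn_integral_polar_upper) measurable
  have "(\<integral>\<^sup>+b. F b * indicator {..<0} b \<partial>lborel) = (\<integral>\<^sup>+b. F (- b) * indicator {0<..} b \<partial>lborel)"
    by (subst nn_integral_real_affine[of _ "-1" 0]) (auto intro!: nn_integral_cong split: split_indicator)
  also have "\<dots> = (\<integral>\<^sup>+\<phi>. G (- \<phi>) * indicator {0<..<pi} \<phi> \<partial>lborel)"
  proof -
    have "continuous_on UNIV (\<lambda>p :: real \<times> real. (fst p, - snd p))" by (intro continuous_intros)
    then have "(\<lambda>p :: real \<times> real. (fst p, - snd p)) \<in> borel_measurable borel"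
      by (rule borel_measurable_continuous_onI)
    then have "(\<lambda>p. H (fst p, - snd p)) \<in> borel_measurable borel"
      using assms by (rule measurable_compose)
    from nn_integral_polar_upper[OF this] show ?thesis
      unfolding F_def G_def by simp
  qed
  also have "\<dots> = (\<integral>\<^sup>+\<phi>. G \<phi> * indicator {-pi<..<0} \<phi> \<partial>lborel)"
    by (subst nn_integral_real_affine[of _ "-1" 0]) (auto intro!: nn_integral_cong split: split_indicator)
  finally have lo: "(\<integral>\<^sup>+b. F b * indicator {..<0} b \<partial>lborel) = (\<integral>\<^sup>+\<phi>. G \<phi> * indicator {-pi<..<0} \<phi> \<partial>lborel)" .
  have "(\<integral>\<^sup>+p. H p \<partial>lborel) = (\<integral>\<^sup>+b. F b \<partial>lborel)"
    unfolding F_def by (subst lborel_pair.nn_integral_snd) (simp_all add: lborel_prod)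
  also have "\<dots> = (\<integral>\<^sup>+b. F b * indicator {0<..} b + F b * indicator {..<0} b \<partial>lborel)"
    by (intro nn_integral_cong_AE AE_mp[OF AE_lborel_singleton[of 0] AE_I2]) (auto split: split_indicator)
  also have "\<dots> = (\<integral>\<^sup>+\<phi>. G \<phi> * indicator {0<..<pi} \<phi> + G \<phi> * indicator {-pi<..<0} \<phi> \<partial>lborel)"
    by (simp add: nn_integral_add up lo)
  also have "\<dots> = (\<integral>\<^sup>+\<phi>. G \<phi> * indicator {-pi<..<pi} \<phi> \<partial>lborel)"
    by (intro nn_integral_cong_AE AE_mp[OF AE_lborel_singleton[of 0] AE_I2]) (auto split: split_indicator)
  finally show ?thesis unfolding G_def .
qed

section \<open>The branched cover of the plane\<close>

locale plane_C1 =
  fixes f f1 f2 :: "real \<times> real \<Rightarrow> real" and R :: real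
  assumes der: "\<And>p. (f has_derivative (\<lambda>h. f1 p * fst h + f2 p * snd h)) (at p)"
    and cont1: "continuous_on UNIV f1" and cont2: "continuous_on UNIV f2"
    and supp: "\<And>p. norm p \<ge> R \<Longrightarrow> f p = 0"
begin

text \<open>\<open>rad\<close> is r times the radial derivative of \<open>f\<close> and
  \<open>ang\<close> is its derivative in the polar angle. In this normalisation both are continuous
  at the origin.\<close>

definition rad where "rad p = fst p * f1 p + snd p * f2 p"
definition ang where "ang p = fst p * f2 p - snd p * f1 p"

lemma continuous_f: "continuous_on UNIV f"
  using der by (auto simp: continuous_on_eq_continuous_at intro: has_derivative_continuous)

lemma continuous_rad: "continuous_on UNIV rad" and continuous_ang: "continuous_on UNIV ang"
  unfolding rad_def ang_def by (intro continuous_intros cont1 cont2)+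

lemma measurable_plane[measurable]:
  "f \<in> borel_measurable borel" "f1 \<in> borel_measurable borel" "f2 \<in> borel_measurable borel"
  "rad \<in> borel_measurable borel" "ang \<in> borel_measurable borel"
  using continuous_f cont1 cont2 continuous_rad continuous_ang
  by (auto intro: borel_measurable_continuous_onI)

text \<open>The chain rule in log-polar coordinates: with the logarithm of the radius as coordinate,
  the coefficients are exactly \<open>rad\<close> and \<open>ang\<close>, and the real and imaginary
  parts of a complex logarithm can be inserted for \<open>l\<close> and
  \<open>\<phi>\<close>.\<close>

lemma deriv_polar:
  assumes "(l has_real_derivative l') (at t)" "(\<phi> has_real_derivative \<phi>') (at t)"
  defines "p \<equiv> (exp (l t) * cos (\<phi> t), exp (l t) * sin (\<phi> t))"
  shows "((\<lambda>t. f (exp (l t) * cos (\<phi> t), exp (l t) * sin (\<phi> t))) has_real_derivative rad p * l' + ang p * \<phi>') (at t)"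
proof -
  have 1: "((\<lambda>t. exp (l t) * cos (\<phi> t)) has_real_derivative exp (l t) * cos (\<phi> t) * l' - exp (l t) * sin (\<phi> t) * \<phi>') (at t)"
    by (auto intro!: derivative_eq_intros assms)
  have 2: "((\<lambda>t. exp (l t) * sin (\<phi> t)) has_real_derivative exp (l t) * sin (\<phi> t) * l' + exp (l t) * cos (\<phi> t) * \<phi>') (at t)"
    by (auto intro!: derivative_eq_intros assms)
  have "((\<lambda>t. (exp (l t) * cos (\<phi> t), exp (l t) * sin (\<phi> t))) has_derivative
     (\<lambda>h. ((exp (l t) * cos (\<phi> t) * l' - exp (l t) * sin (\<phi> t) * \<phi>') * h, (exp (l t) * sin (\<phi> t) * l' + exp (l t) * cos (\<phi> t) * \<phi>') * h))) (at t)"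
    using 1 2 unfolding has_field_derivative_def by (rule has_derivative_Pair)
  from diff_chain_at[OF this der] show ?thesis
    unfolding has_field_derivative_def p_def rad_def ang_def comp_def
    by (rule has_derivative_eq_rhs) (auto simp: algebra_simps)
qed

end

section \<open>The complex logarithm along lines, and the charts of the cover\<close>

lemma Ln_horizontal:
  assumes "b \<noteq> 0"
  shows "((\<lambda>a. Re (Ln (Complex a b))) has_real_derivative a / (a\<^sup>2 + b\<^sup>2)) (at a)"
    and "((\<lambda>a. Im (Ln (Complex a b))) has_real_derivative - b / (a\<^sup>2 + b\<^sup>2)) (at a)"
proof -
  have "Complex a b \<notin> \<real>\<^sub>\<le>\<^sub>0" using assms by (auto simp: complex_nonpos_Reals_iff)
  then have 1: "(Ln has_field_derivative inverse (Complex a b)) (at (Complex a b))"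
    by (rule has_field_derivative_Ln)
  have 2: "((\<lambda>a. Complex a b) has_vector_derivative 1) (at a)"
    unfolding has_vector_derivative_complex_iff by (auto intro!: derivative_eq_intros)
  from field_vector_diff_chain_at[OF 2 1]
  have "((\<lambda>a. Ln (Complex a b)) has_vector_derivative inverse (Complex a b)) (at a)" by (simp add: o_def)
  then show "((\<lambda>a. Re (Ln (Complex a b))) has_real_derivative a / (a\<^sup>2 + b\<^sup>2)) (at a)"
    "((\<lambda>a. Im (Ln (Complex a b))) has_real_derivative - b / (a\<^sup>2 + b\<^sup>2)) (at a)"
    unfolding has_vector_derivative_complex_iff by auto
qed

text \<open>The derivative is \<i>/z, against 1/z horizontally. The closed negative axis is avoided
  by a vertical line only if a > 0, but by every horizontal line with b \<noteq> 0. This asymmetry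
  forces the later restriction to right half planes.\<close>

lemma Ln_vertical:
  assumes "a > 0"
  shows "((\<lambda>b. Re (Ln (Complex a b))) has_real_derivative b / (a\<^sup>2 + b\<^sup>2)) (at b)"
    and "((\<lambda>b. Im (Ln (Complex a b))) has_real_derivative a / (a\<^sup>2 + b\<^sup>2)) (at b)"
proof -
  have "Complex a b \<notin> \<real>\<^sub>\<le>\<^sub>0" using assms by (auto simp: complex_nonpos_Reals_iff)
  then have 1: "(Ln has_field_derivative inverse (Complex a b)) (at (Complex a b))"
    by (rule has_field_derivative_Ln)
  have 2: "((\<lambda>b. Complex a b) has_vector_derivative \<i>) (at b)"
    unfolding has_vector_derivative_complex_iff by (auto intro!: derivative_eq_intros)
  from field_vector_diff_chain_at[OF 2 1]
  have "((\<lambda>b. Ln (Complex a b)) has_vector_derivative \<i> * inverse (Complex a b)) (at b)" by (simp add: o_def)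
  then show "((\<lambda>b. Re (Ln (Complex a b))) has_real_derivative b / (a\<^sup>2 + b\<^sup>2)) (at b)"
    "((\<lambda>b. Im (Ln (Complex a b))) has_real_derivative a / (a\<^sup>2 + b\<^sup>2)) (at b)"
    unfolding has_vector_derivative_complex_iff by auto
qed

lemma Ln_polar:
  assumes "s > 0" "-pi < \<phi>" "\<phi> \<le> pi"
  shows "Ln (Complex (s * cos \<phi>) (s * sin \<phi>)) = Complex (ln s) \<phi>"
proof (rule Ln_unique)
  show "exp (Complex (ln s) \<phi>) = Complex (s * cos \<phi>) (s * sin \<phi>)"
    using assms by (simp add: complex_eq_iff Re_exp Im_exp)
qed (use assms in auto)

lemma measurable_fst_snd_borel[measurable]:
  "(fst :: real \<times> real \<Rightarrow> real) \<in> borel_measurable borel"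
  "(snd :: real \<times> real \<Rightarrow> real) \<in> borel_measurable borel"
  by (intro borel_measurable_continuous_onI continuous_intros)+

lemma measurable_Complex_pair[measurable]:
  "(\<lambda>X :: real \<times> real. Complex (fst X) (snd X)) \<in> borel_measurable borel"
  unfolding Complex_eq by (intro borel_measurable_continuous_onI continuous_intros)

text \<open>The angle \<open>\<beta>\<close> selects the sheet: for \<beta> = j \<pi> the right half
  plane of the chart is the j-th half plane of the cover, and 2N values of j exhaust the
  cover.\<close>

locale plane_chart = plane_C1 +
  fixes m N \<beta> :: real
  assumes m: "m > 0" and N: "N > 0"
begin

text \<open>\<open>chart\<close> is the inverse of \<open>(r, \<eta>) \<mapsto> (r\<^sup>m, N \<eta> - \<beta>)\<close> on the plane slit along the negative real axis;
  \<open>D1\<close> and \<open>D2\<close> are the partial derivatives of \<open>f\<close> composed with it.\<close>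

definition chart where
  "chart X = (exp (Re (Ln (Complex (fst X) (snd X))) / m) * cos ((Im (Ln (Complex (fst X) (snd X))) + \<beta>) / N),
              exp (Re (Ln (Complex (fst X) (snd X))) / m) * sin ((Im (Ln (Complex (fst X) (snd X))) + \<beta>) / N))"
definition D1 where
  "D1 X = (fst X * rad (chart X) / m - snd X * ang (chart X) / N) / ((fst X)\<^sup>2 + (snd X)\<^sup>2)"
definition D2 where
  "D2 X = (snd X * rad (chart X) / m + fst X * ang (chart X) / N) / ((fst X)\<^sup>2 + (snd X)\<^sup>2)"

lemma measurable_chart[measurable]: "chart \<in> borel_measurable borel"
proof -
  have [measurable]: "(\<lambda>X :: real \<times> real. Ln (Complex (fst X) (snd X))) \<in> borel_measurable borel"
    by (rule measurable_compose[OF measurable_Complex_pair Ln_measurable])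
  show ?thesis unfolding chart_def by measurable
qed

lemma measurable_D[measurable]: "D1 \<in> borel_measurable borel" "D2 \<in> borel_measurable borel"
proof -
  have [measurable]: "(\<lambda>X. rad (chart X)) \<in> borel_measurable borel" "(\<lambda>X. ang (chart X)) \<in> borel_measurable borel"
    by (rule measurable_compose[OF measurable_chart], measurable)+
  show "D1 \<in> borel_measurable borel" "D2 \<in> borel_measurable borel"
    unfolding D1_def D2_def by measurable
qed

lemma measurable_f_chart[measurable]: "(\<lambda>X. f (chart X)) \<in> borel_measurable borel"
  by (rule measurable_compose[OF measurable_chart]) measurable

lemma norm_chart: "norm (chart X) = exp (Re (Ln (Complex (fst X) (snd X))) / m)"
  unfolding chart_def norm_Pair by (simp add: power_mult_distrib flip: distrib_left)

text \<open>The chart takes the m-th root of the modulus, so a support of radius \<open>R\<close>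
  becomes one of radius R^m; the maximum with 1 keeps the logarithm of the radius defined.\<close>

lemma f_chart_eq_0:
  assumes "max R 1 powr m \<le> cmod (Complex (fst X) (snd X))"
  shows "f (chart X) = 0"
proof (rule supp)
  let ?z = "Complex (fst X) (snd X)"
  have "0 < max R 1 powr m" by simp
  with assms have z: "cmod ?z > 0" by linarith
  then have "?z \<noteq> 0" by auto
  have "ln (max R 1 powr m) \<le> ln (cmod ?z)" using assms z by (subst ln_le_cancel_iff) auto
  then have "m * ln (max R 1) \<le> ln (cmod ?z)" by (simp add: ln_powr)
  then have "ln (max R 1) \<le> Re (Ln ?z) / m" using m \<open>?z \<noteq> 0\<close> by (simp add: field_simps)
  then have "exp (ln (max R 1)) \<le> norm (chart X)" unfolding norm_chart by (simp only: exp_le_cancel_iff)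
  moreover have "exp (ln (max R 1)) = max R 1" by simp
  ultimately show "R \<le> norm (chart X)" by linarith
qed

lemma deriv_horizontal:
  assumes "b \<noteq> 0"
  shows "((\<lambda>a. f (chart (a, b))) has_real_derivative D1 (a, b)) (at a)"
proof -
  have "((\<lambda>a. Re (Ln (Complex a b)) / m) has_real_derivative (a / (a\<^sup>2 + b\<^sup>2)) / m) (at a)"
    "((\<lambda>a. (Im (Ln (Complex a b)) + \<beta>) / N) has_real_derivative (- b / (a\<^sup>2 + b\<^sup>2)) / N) (at a)"
    using DERIV_cdivide[OF Ln_horizontal(1)[OF assms]]
      DERIV_cdivide[OF DERIV_add[OF Ln_horizontal(2)[OF assms] DERIV_const]] by auto
  from deriv_polar[OF this] show ?thesis
    unfolding chart_def D1_def fst_conv snd_conv by (rule DERIV_cong) (simp add: diff_divide_distrib mult_ac)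
qed

lemma deriv_vertical:
  assumes "a > 0"
  shows "((\<lambda>b. f (chart (a, b))) has_real_derivative D2 (a, b)) (at b)"
proof -
  have "((\<lambda>b. Re (Ln (Complex a b)) / m) has_real_derivative (b / (a\<^sup>2 + b\<^sup>2)) / m) (at b)"
    "((\<lambda>b. (Im (Ln (Complex a b)) + \<beta>) / N) has_real_derivative (a / (a\<^sup>2 + b\<^sup>2)) / N) (at b)"
    using DERIV_cdivide[OF Ln_vertical(1)[OF assms]]
      DERIV_cdivide[OF DERIV_add[OF Ln_vertical(2)[OF assms] DERIV_const]] by auto
  from deriv_polar[OF this] show ?thesis
    unfolding chart_def D2_def fst_conv snd_conv by (rule DERIV_cong) (simp add: add_divide_distrib mult_ac)
qed

lemma continuous_horizontal:
  assumes "b \<noteq> 0"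
  shows "continuous_on UNIV (\<lambda>a. D1 (a, b))"
proof -
  have c: "continuous_on UNIV (\<lambda>a. Re (Ln (Complex a b)))" "continuous_on UNIV (\<lambda>a. Im (Ln (Complex a b)))"
    using Ln_horizontal[OF assms] by (auto simp: continuous_on_eq_continuous_at intro: DERIV_isCont)
  have "continuous_on UNIV (\<lambda>a. chart (a, b))"
    unfolding chart_def using m N by (auto intro!: continuous_intros c)
  then have r: "continuous_on UNIV (\<lambda>a. rad (chart (a, b)))" "continuous_on UNIV (\<lambda>a. ang (chart (a, b)))"
    by (auto intro: continuous_on_compose2[OF continuous_rad] continuous_on_compose2[OF continuous_ang])
  show ?thesis unfolding D1_def using m N assms
    by (auto intro!: continuous_intros r simp: sum_power2_eq_zero_iff)
qed

lemma continuous_vertical: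
  assumes "a > 0"
  shows "continuous_on UNIV (\<lambda>b. D2 (a, b))"
proof -
  have c: "continuous_on UNIV (\<lambda>b. Re (Ln (Complex a b)))" "continuous_on UNIV (\<lambda>b. Im (Ln (Complex a b)))"
    using Ln_vertical[OF assms] by (auto simp: continuous_on_eq_continuous_at intro: DERIV_isCont)
  have "continuous_on UNIV (\<lambda>b. chart (a, b))"
    unfolding chart_def using m N by (auto intro!: continuous_intros c)
  then have r: "continuous_on UNIV (\<lambda>b. rad (chart (a, b)))" "continuous_on UNIV (\<lambda>b. ang (chart (a, b)))"
    by (auto intro: continuous_on_compose2[OF continuous_rad] continuous_on_compose2[OF continuous_ang])
  show ?thesis unfolding D2_def using m N assms
    by (auto intro!: continuous_intros r simp: sum_power2_eq_zero_iff)
qed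

text \<open>The Gagliardo-Nirenberg argument: |f| is at most half its horizontal line integral, a
  function of \<open>b\<close> alone, and at most half its vertical one, a function of
  \<open>a\<close> alone, so the product of the two bounds integrates to a product. Horizontal lines
  leave the half plane, hence the integral of \<open>D1\<close> runs over the whole plane.\<close>

lemma half_plane_bound:
  "(\<integral>\<^sup>+X. ennreal ((f (chart X))\<^sup>2) * indicator {0<..} (fst X) \<partial>lborel) \<le>
   ennreal (1/4) * (\<integral>\<^sup>+X. ennreal \<bar>D1 X\<bar> \<partial>lborel) * (\<integral>\<^sup>+X. ennreal \<bar>D2 X\<bar> * indicator {0<..} (fst X) \<partial>lborel)"
proof -
  have fub: "(\<integral>\<^sup>+X. G X \<partial>lborel) = (\<integral>\<^sup>+b. \<integral>\<^sup>+a. G (a, b) \<partial>lborel \<partial>lborel)"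
    "(\<integral>\<^sup>+X. G X \<partial>lborel) = (\<integral>\<^sup>+a. \<integral>\<^sup>+b. G (a, b) \<partial>lborel \<partial>lborel)"
    if [measurable]: "G \<in> borel_measurable borel" for G :: "real \<times> real \<Rightarrow> ennreal"
    by (subst lborel_pair.nn_integral_snd, simp_all add: lborel_prod)
       (subst lborel.nn_integral_fst, simp_all add: lborel_prod)
  define P where "P b = (\<integral>\<^sup>+a. ennreal \<bar>D1 (a, b)\<bar> \<partial>lborel)" for b
  define Q where "Q a = (\<integral>\<^sup>+b. ennreal \<bar>D2 (a, b)\<bar> \<partial>lborel)" for a
  have [measurable]: "P \<in> borel_measurable borel" "Q \<in> borel_measurable borel"
    unfolding P_def Q_def by measurable
  have bd: "ennreal ((f (chart (a, b)))\<^sup>2) * indicator {0<..} a \<le> ennreal (1/4) * (P b * (Q a * indicator {0<..} a))"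
    if b: "b \<noteq> 0" for a b
  proof (cases "a > 0")
    case a: True
    have 1: "ennreal \<bar>f (chart (a, b))\<bar> \<le> ennreal (1/2) * P b" unfolding P_def
      by (rule abs_le_half_nn_integral_deriv[where h="\<lambda>a. f (chart (a, b))" and R="max R 1 powr m"])
         (use abs_Re_le_cmod[of "Complex _ b"] in \<open>auto intro!: deriv_horizontal continuous_horizontal b f_chart_eq_0 intro: order_trans\<close>)
    have 2: "ennreal \<bar>f (chart (a, b))\<bar> \<le> ennreal (1/2) * Q a" unfolding Q_def
      by (rule abs_le_half_nn_integral_deriv[where h="\<lambda>b. f (chart (a, b))" and R="max R 1 powr m"])
         (use abs_Im_le_cmod[of "Complex a _"] in \<open>auto intro!: deriv_vertical continuous_vertical a f_chart_eq_0 intro: order_trans\<close>)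
    have "ennreal ((f (chart (a, b)))\<^sup>2) = ennreal \<bar>f (chart (a, b))\<bar> * ennreal \<bar>f (chart (a, b))\<bar>"
      by (simp add: ennreal_mult[symmetric] power2_eq_square)
    also have "\<dots> \<le> (ennreal (1/2) * P b) * (ennreal (1/2) * Q a)"
      using 1 2 by (rule mult_mono) auto
    also have "\<dots> = (ennreal (1/2) * ennreal (1/2)) * (P b * Q a)" by (simp only: mult_ac)
    also have "ennreal (1/2) * ennreal (1/2) = ennreal (1/4)"
      by (subst ennreal_mult[symmetric]) auto
    finally show ?thesis using a by simp
  qed simp
  have "(\<integral>\<^sup>+X. ennreal ((f (chart X))\<^sup>2) * indicator {0<..} (fst X) \<partial>lborel)
     = (\<integral>\<^sup>+b. \<integral>\<^sup>+a. ennreal ((f (chart (a, b)))\<^sup>2) * indicator {0<..} a \<partial>lborel \<partial>lborel)"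
    by (subst fub(1)) auto
  also have "\<dots> \<le> (\<integral>\<^sup>+b. \<integral>\<^sup>+a. ennreal (1/4) * (P b * (Q a * indicator {0<..} a)) \<partial>lborel \<partial>lborel)"
    by (intro nn_integral_mono_AE AE_mp[OF AE_lborel_singleton[of 0] AE_I2] impI nn_integral_mono bd)
  also have "\<dots> = (\<integral>\<^sup>+b. ennreal (1/4) * (P b * (\<integral>\<^sup>+a. Q a * indicator {0<..} a \<partial>lborel)) \<partial>lborel)"
    by (simp add: nn_integral_cmult)
  also have "\<dots> = ennreal (1/4) * (\<integral>\<^sup>+b. P b \<partial>lborel) * (\<integral>\<^sup>+a. Q a * indicator {0<..} a \<partial>lborel)"
    by (simp add: nn_integral_cmult nn_integral_multc mult.assoc)
  also have "(\<integral>\<^sup>+b. P b \<partial>lborel) = (\<integral>\<^sup>+X. ennreal \<bar>D1 X\<bar> \<partial>lborel)"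
    unfolding P_def by (subst fub(1)) auto
  also have "(\<integral>\<^sup>+a. Q a * indicator {0<..} a \<partial>lborel) = (\<integral>\<^sup>+X. ennreal \<bar>D2 X\<bar> * indicator {0<..} (fst X) \<partial>lborel)"
    unfolding Q_def by (subst fub(2)) (auto simp: nn_integral_multc)
  finally show ?thesis .
qed

end

section \<open>Auxiliary inequalities and decompositions of the angular interval\<close>

lemma four_mult_le_power2_ennreal: "4 * (a * b) \<le> (a + b)\<^sup>2" for a b :: ennreal
proof (cases a; cases b)
  fix x y assume xy: "a = ennreal x" "0 \<le> x" "b = ennreal y" "0 \<le> y"
  have "4 * (x * y) \<le> (x + y)\<^sup>2"
    using sum_squares_ge_zero[of "x - y" 0] by (simp add: power2_eq_square algebra_simps)
  then have "ennreal (4 * (x * y)) \<le> ennreal ((x + y)\<^sup>2)" by (rule ennreal_leI)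
  then show ?thesis using xy by (simp add: ennreal_mult ennreal_power ennreal_plus[symmetric] del: ennreal_plus)
qed (auto simp: power2_eq_square ennreal_top_mult ennreal_mult_top)

lemma cos_pos_iff:
  assumes "-pi < x" "x < pi"
  shows "0 < cos x \<longleftrightarrow> x \<in> {-(pi/2)<..<pi/2}"
proof
  assume c: "0 < cos x"
  have "x < pi/2"
  proof (rule ccontr)
    assume "\<not> x < pi/2"
    then have "0 \<le> sin (x - pi/2)" using assms by (intro sin_ge_zero) auto
    then show False using c by (simp add: sin_diff)
  qed
  moreover have "-(pi/2) < x"
  proof (rule ccontr)
    assume "\<not> -(pi/2) < x"
    then have "0 \<le> sin (- x - pi/2)" using assms by (intro sin_ge_zero) auto
    then show False using c by (simp add: sin_diff)
  qed
  ultimately show "x \<in> {-(pi/2)<..<pi/2}" by auto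
qed (auto intro: cos_gt_zero_pi)

lemma nn_integral_periodic:
  fixes K :: "real \<Rightarrow> ennreal"
  assumes [measurable]: "K \<in> borel_measurable borel" and per: "\<And>x. K (x + 2 * pi) = K x"
    and c: "-pi \<le> c" "c \<le> pi"
  shows "(\<integral>\<^sup>+x. K x * indicator {c<..<c + 2 * pi} x \<partial>lborel) = (\<integral>\<^sup>+x. K x * indicator {-pi<..<pi} x \<partial>lborel)"
proof -
  have "(\<integral>\<^sup>+x. K x * indicator {c<..<c + 2 * pi} x \<partial>lborel) =
      (\<integral>\<^sup>+x. K x * indicator {c<..<pi} x + K x * indicator {pi<..<c + 2 * pi} x \<partial>lborel)"
    using c by (intro nn_integral_cong_AE AE_mp[OF AE_lborel_singleton[of pi] AE_I2]) (auto split: split_indicator)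
  also have "\<dots> = (\<integral>\<^sup>+x. K x * indicator {c<..<pi} x \<partial>lborel) + (\<integral>\<^sup>+x. K x * indicator {pi<..<c + 2 * pi} x \<partial>lborel)"
    by (rule nn_integral_add) auto
  also have "(\<integral>\<^sup>+x. K x * indicator {pi<..<c + 2 * pi} x \<partial>lborel) = (\<integral>\<^sup>+x. K x * indicator {-pi<..<c} x \<partial>lborel)"
    by (subst nn_integral_real_affine[of _ 1 "2 * pi"])
       (auto intro!: nn_integral_cong simp: per add.commute[of "2 * pi"] split: split_indicator)
  also have "(\<integral>\<^sup>+x. K x * indicator {c<..<pi} x \<partial>lborel) + (\<integral>\<^sup>+x. K x * indicator {-pi<..<c} x \<partial>lborel)
     = (\<integral>\<^sup>+x. K x * indicator {c<..<pi} x + K x * indicator {-pi<..<c} x \<partial>lborel)"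
    by (rule nn_integral_add[symmetric]) auto
  also have "\<dots> = (\<integral>\<^sup>+x. K x * indicator {-pi<..<pi} x \<partial>lborel)"
    using c by (intro nn_integral_cong_AE AE_mp[OF AE_lborel_singleton[of c] AE_I2]) (auto split: split_indicator)
  finally show ?thesis .
qed

lemma nn_integral_split_intervals:
  fixes K :: "real \<Rightarrow> ennreal"
  assumes [measurable]: "K \<in> borel_measurable borel" and d: "d \<ge> 0"
  shows "(\<integral>\<^sup>+x. K x * indicator {c<..<c + real k * d} x \<partial>lborel) =
    (\<Sum>j<k. \<integral>\<^sup>+x. K x * indicator {c + real j * d<..<c + real (Suc j) * d} x \<partial>lborel)"
proof (induction k)
  case (Suc k)
  let ?e = "c + real k * d"
  have "c \<le> ?e" "?e \<le> c + real (Suc k) * d" using d by (auto simp: algebra_simps)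
  then have "(\<integral>\<^sup>+x. K x * indicator {c<..<c + real (Suc k) * d} x \<partial>lborel) =
      (\<integral>\<^sup>+x. K x * indicator {c<..<?e} x + K x * indicator {?e<..<c + real (Suc k) * d} x \<partial>lborel)"
    by (intro nn_integral_cong_AE AE_mp[OF AE_lborel_singleton[of ?e] AE_I2]) (auto split: split_indicator)
  also have "\<dots> = (\<integral>\<^sup>+x. K x * indicator {c<..<?e} x \<partial>lborel) + (\<integral>\<^sup>+x. K x * indicator {?e<..<c + real (Suc k) * d} x \<partial>lborel)"
    by (rule nn_integral_add) auto
  finally show ?case by (simp add: Suc.IH)
qed simp

text \<open>A rotation preserves the Euclidean norm, and in the plane the sum of absolute values is
  at most sqrt 2 times that norm.\<close>

lemma rotated_abs_sum_le:
  fixes c s A B :: real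
  assumes "c\<^sup>2 + s\<^sup>2 = 1"
  shows "\<bar>c * A - s * B\<bar> + \<bar>s * A + c * B\<bar> \<le> sqrt 2 * sqrt (A\<^sup>2 + B\<^sup>2)"
proof -
  have "(\<bar>c * A - s * B\<bar> + \<bar>s * A + c * B\<bar>)\<^sup>2 \<le> 2 * ((c * A - s * B)\<^sup>2 + (s * A + c * B)\<^sup>2)"
    using zero_le_power2[of "\<bar>c * A - s * B\<bar> - \<bar>s * A + c * B\<bar>"] by (simp add: power2_sum power2_diff)
  also have "(c * A - s * B)\<^sup>2 + (s * A + c * B)\<^sup>2 = (c\<^sup>2 + s\<^sup>2) * (A\<^sup>2 + B\<^sup>2)"
    by (simp add: power2_eq_square algebra_simps)
  also have "2 * \<dots> = (sqrt 2 * sqrt (A\<^sup>2 + B\<^sup>2))\<^sup>2"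
    using assms by (simp add: power_mult_distrib)
  finally show ?thesis by (rule power2_le_imp_le) simp
qed

section \<open>The half-plane estimate in polar coordinates of the original plane\<close>

definition pol :: "real \<Rightarrow> real \<Rightarrow> real \<times> real" where
  "pol r \<eta> = (r * cos \<eta>, r * sin \<eta>)"

lemma norm_pol: "norm (pol r \<eta>) = \<bar>r\<bar>"
  unfolding pol_def norm_Pair by (simp add: power_mult_distrib flip: distrib_left)

lemma pol_periodic: "pol r (\<eta> + 2 * pi) = pol r \<eta>" unfolding pol_def by simp

lemma measurable_pol[measurable (raw)]:
  assumes [measurable]: "g \<in> borel_measurable M" "h \<in> borel_measurable M"
  shows "(\<lambda>x. pol (g x) (h x)) \<in> borel_measurable M"
  unfolding pol_def by measurable

context plane_chart
begin

text \<open>\<open>\<kappa>1\<close> and \<open>\<kappa>2\<close> are the absolute values of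
  \<open>D1\<close> and \<open>D2\<close> multiplied by the radius in the cover. That radius is the
  polar Jacobian, and it cancels the singularity of \<open>D1\<close> and \<open>D2\<close> at the
  branch point.\<close>

definition \<kappa>1 where "\<kappa>1 r \<eta> = \<bar>cos (N * \<eta> - \<beta>) * (rad (pol r \<eta>) / m) - sin (N * \<eta> - \<beta>) * (ang (pol r \<eta>) / N)\<bar>"
definition \<kappa>2 where "\<kappa>2 r \<eta> = \<bar>sin (N * \<eta> - \<beta>) * (rad (pol r \<eta>) / m) + cos (N * \<eta> - \<beta>) * (ang (pol r \<eta>) / N)\<bar>"

lemma chart_pol:
  assumes "s > 0" "-pi < \<phi>" "\<phi> < pi"
  shows "chart (pol s \<phi>) = pol (s powr (1/m)) ((\<phi> + \<beta>) / N)"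
  using assms Ln_polar[of s \<phi>] unfolding chart_def pol_def by (simp add: powr_def)

lemma D_pol:
  assumes "s > 0" "-pi < \<phi>" "\<phi> < pi"
  shows "\<bar>D1 (pol s \<phi>)\<bar> * s = \<kappa>1 (s powr (1/m)) ((\<phi> + \<beta>) / N)"
    and "\<bar>D2 (pol s \<phi>)\<bar> * s = \<kappa>2 (s powr (1/m)) ((\<phi> + \<beta>) / N)"
proof -
  have n: "(fst (pol s \<phi>))\<^sup>2 + (snd (pol s \<phi>))\<^sup>2 = s * s"
    unfolding pol_def by (simp add: power_mult_distrib power2_eq_square[of s] flip: distrib_left)
  have p: "fst (pol s \<phi>) = s * cos \<phi>" "snd (pol s \<phi>) = s * sin \<phi>" by (auto simp: pol_def)
  have b: "N * ((\<phi> + \<beta>) / N) - \<beta> = \<phi>" using N by simp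
  have "D1 (pol s \<phi>) * s = cos \<phi> * (rad (chart (pol s \<phi>)) / m) - sin \<phi> * (ang (chart (pol s \<phi>)) / N)"
    unfolding D1_def n unfolding p using assms(1) m N by (simp add: field_simps)
  moreover have "\<bar>D1 (pol s \<phi>)\<bar> * s = \<bar>D1 (pol s \<phi>) * s\<bar>" using assms(1) by (simp add: abs_mult)
  ultimately show "\<bar>D1 (pol s \<phi>)\<bar> * s = \<kappa>1 (s powr (1/m)) ((\<phi> + \<beta>) / N)"
    unfolding \<kappa>1_def b chart_pol[OF assms] by simp
  have "D2 (pol s \<phi>) * s = sin \<phi> * (rad (chart (pol s \<phi>)) / m) + cos \<phi> * (ang (chart (pol s \<phi>)) / N)"
    unfolding D2_def n unfolding p using assms(1) m N by (simp add: field_simps)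
  moreover have "\<bar>D2 (pol s \<phi>)\<bar> * s = \<bar>D2 (pol s \<phi>) * s\<bar>" using assms(1) by (simp add: abs_mult)
  ultimately show "\<bar>D2 (pol s \<phi>)\<bar> * s = \<kappa>2 (s powr (1/m)) ((\<phi> + \<beta>) / N)"
    unfolding \<kappa>2_def b chart_pol[OF assms] by simp
qed

text \<open>The substitutions s = r^m and \<phi> = N \<eta> - \<beta> are made separately. Their
  Jacobians m r^(m-1) and N contribute the constant in front and the weight inside.\<close>

lemma nn_integral_chart:
  fixes \<Psi> :: "real \<Rightarrow> real \<Rightarrow> ennreal"
  assumes \<Psi>[measurable]: "case_prod \<Psi> \<in> borel_measurable (borel \<Otimes>\<^sub>M borel)" and [measurable]: "A \<in> sets borel"
  shows "(\<integral>\<^sup>+\<phi>. (\<integral>\<^sup>+s. \<Psi> (s powr (1/m)) ((\<phi> + \<beta>) / N) * indicator {0<..} s \<partial>lborel) * indicator A \<phi> \<partial>lborel)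
    = ennreal (m * N) * (\<integral>\<^sup>+\<eta>. (\<integral>\<^sup>+r. \<Psi> r \<eta> * ennreal (r powr (m - 1)) * indicator {0<..} r \<partial>lborel) * indicator A (N * \<eta> - \<beta>) \<partial>lborel)"
proof -
  define \<Phi> where "\<Phi> \<eta> = (\<integral>\<^sup>+r. \<Psi> r \<eta> * ennreal (r powr (m - 1)) * indicator {0<..} r \<partial>lborel)" for \<eta>
  have \<Phi>[measurable]: "\<Phi> \<in> borel_measurable borel" unfolding \<Phi>_def by measurable
  have "(\<integral>\<^sup>+s. \<Psi> (s powr (1/m)) \<eta> * indicator {0<..} s \<partial>lborel) = ennreal m * \<Phi> \<eta>" for \<eta>
  proof -
    have "(\<integral>\<^sup>+s. \<Psi> (s powr (1/m)) \<eta> * indicator {0<..} s \<partial>lborel)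
      = (\<integral>\<^sup>+r. \<Psi> ((r powr m) powr (1/m)) \<eta> * ennreal (m * r powr (m - 1)) * indicator {0<..} r \<partial>lborel)"
      by (rule nn_integral_substitution_powr[OF _ m]) measurable
    also have "\<dots> = (\<integral>\<^sup>+r. ennreal m * (\<Psi> r \<eta> * ennreal (r powr (m - 1)) * indicator {0<..} r) \<partial>lborel)"
      using m by (intro nn_integral_cong) (auto simp: powr_powr ennreal_mult mult_ac split: split_indicator)
    also have "\<dots> = ennreal m * \<Phi> \<eta>" unfolding \<Phi>_def by (rule nn_integral_cmult) measurable
    finally show ?thesis .
  qed
  then have "(\<integral>\<^sup>+\<phi>. (\<integral>\<^sup>+s. \<Psi> (s powr (1/m)) ((\<phi> + \<beta>) / N) * indicator {0<..} s \<partial>lborel) * indicator A \<phi> \<partial>lborel)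
    = (\<integral>\<^sup>+\<phi>. ennreal m * (\<Phi> ((\<phi> + \<beta>) / N) * indicator A \<phi>) \<partial>lborel)"
    by (simp add: mult.assoc)
  also have "\<dots> = ennreal m * (\<integral>\<^sup>+\<phi>. \<Phi> ((\<phi> + \<beta>) / N) * indicator A \<phi> \<partial>lborel)"
    by (rule nn_integral_cmult) measurable
  also have "(\<integral>\<^sup>+\<phi>. \<Phi> ((\<phi> + \<beta>) / N) * indicator A \<phi> \<partial>lborel) = ennreal N * (\<integral>\<^sup>+\<eta>. \<Phi> \<eta> * indicator A (N * \<eta> - \<beta>) \<partial>lborel)"
    using N by (subst nn_integral_real_affine[of _ N "-\<beta>"]) (auto simp: add.commute[of "-\<beta>"])
  finally show ?thesis unfolding \<Phi>_def using m N by (simp add: ennreal_mult mult.assoc)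
qed

lemma measurable_kappa[measurable]:
  "case_prod \<kappa>1 \<in> borel_measurable (borel \<Otimes>\<^sub>M borel)" "case_prod \<kappa>2 \<in> borel_measurable (borel \<Otimes>\<^sub>M borel)"
  "(\<lambda>(r, \<eta>). f (pol r \<eta>)) \<in> borel_measurable (borel \<Otimes>\<^sub>M borel)"
  unfolding \<kappa>1_def \<kappa>2_def by measurable

text \<open>On the left r^m r^(m-1) = r^(2(m-1)) r is the weight times the Jacobian of the x-plane.
  On the right the factor s already sits in \<open>\<kappa>1\<close> and \<open>\<kappa>2\<close>,
  which are of size r times the gradient, so r^(m-1) alone yields the weight of the gradient
  integral.\<close>

lemma sector_bound:
  "ennreal (m * N) * (\<integral>\<^sup>+\<eta>. (\<integral>\<^sup>+r. ennreal ((f (pol r \<eta>))\<^sup>2 * r powr m) * ennreal (r powr (m - 1)) * indicator {0<..} r \<partial>lborel)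
      * indicator {-(pi/2)<..<pi/2} (N * \<eta> - \<beta>) \<partial>lborel)
   \<le> ennreal (1/4)
     * (ennreal (m * N) * (\<integral>\<^sup>+\<eta>. (\<integral>\<^sup>+r. ennreal (\<kappa>1 r \<eta>) * ennreal (r powr (m - 1)) * indicator {0<..} r \<partial>lborel)
          * indicator {-pi<..<pi} (N * \<eta> - \<beta>) \<partial>lborel))
     * (ennreal (m * N) * (\<integral>\<^sup>+\<eta>. (\<integral>\<^sup>+r. ennreal (\<kappa>2 r \<eta>) * ennreal (r powr (m - 1)) * indicator {0<..} r \<partial>lborel)
          * indicator {-(pi/2)<..<pi/2} (N * \<eta> - \<beta>) \<partial>lborel))"
proof -
  \<comment> \<open>All three integrals of \<open>half_plane_bound\<close> are converted by this one
    rule; \<open>A\<close> is the angular range outside which the integrand vanishes.\<close>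
  have P: "(\<integral>\<^sup>+X. H X \<partial>lborel) =
    (\<integral>\<^sup>+\<phi>. (\<integral>\<^sup>+s. \<Psi> (s powr (1/m)) ((\<phi> + \<beta>) / N) * indicator {0<..} s \<partial>lborel) * indicator A \<phi> \<partial>lborel)"
    if [measurable]: "H \<in> borel_measurable borel" and A: "A \<subseteq> {-pi<..<pi}"
      and in_A: "\<And>s \<phi>. s > 0 \<Longrightarrow> \<phi> \<in> A \<Longrightarrow> H (pol s \<phi>) * ennreal s = \<Psi> (s powr (1/m)) ((\<phi> + \<beta>) / N)"
      and not_A: "\<And>s \<phi>. s > 0 \<Longrightarrow> \<phi> \<in> {-pi<..<pi} - A \<Longrightarrow> H (pol s \<phi>) = 0"
    for H :: "real \<times> real \<Rightarrow> ennreal" and \<Psi> :: "real \<Rightarrow> real \<Rightarrow> ennreal" and A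
  proof -
    have "(\<integral>\<^sup>+X. H X \<partial>lborel) =
      (\<integral>\<^sup>+\<phi>. (\<integral>\<^sup>+s. H (pol s \<phi>) * ennreal s \<partial>lborel) * indicator {-pi<..<pi} \<phi> \<partial>lborel)"
      unfolding pol_def by (rule nn_integral_polar) measurable
    also have "\<dots> = (\<integral>\<^sup>+\<phi>. (\<integral>\<^sup>+s. \<Psi> (s powr (1/m)) ((\<phi> + \<beta>) / N) * indicator {0<..} s \<partial>lborel) * indicator A \<phi> \<partial>lborel)"
    proof (rule nn_integral_cong)
      fix \<phi> :: real
      consider "\<phi> \<in> A" | "\<phi> \<in> {-pi<..<pi} - A" | "\<phi> \<notin> {-pi<..<pi}" by blast
      then show "(\<integral>\<^sup>+s. H (pol s \<phi>) * ennreal s \<partial>lborel) * indicator {-pi<..<pi} \<phi> =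
        (\<integral>\<^sup>+s. \<Psi> (s powr (1/m)) ((\<phi> + \<beta>) / N) * indicator {0<..} s \<partial>lborel) * indicator A \<phi>"
      proof cases
        case 1
        have "(\<integral>\<^sup>+s. H (pol s \<phi>) * ennreal s \<partial>lborel) = (\<integral>\<^sup>+s. \<Psi> (s powr (1/m)) ((\<phi> + \<beta>) / N) * indicator {0<..} s \<partial>lborel)"
          using in_A[OF _ 1] by (intro nn_integral_cong) (auto simp: ennreal_neg split: split_indicator)
        then show ?thesis using 1 A by auto
      next
        case 2
        have "(\<integral>\<^sup>+s. H (pol s \<phi>) * ennreal s \<partial>lborel) = (\<integral>\<^sup>+s. 0 \<partial>(lborel :: real measure))"
          using not_A[OF _ 2] by (intro nn_integral_cong) (metis ennreal_neg linorder_not_less mult_zero_left mult_zero_right)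
        then show ?thesis using 2 by simp
      next
        case 3
        then have "\<phi> \<notin> A" using A by blast
        with 3 show ?thesis by simp
      qed
    qed
    finally show ?thesis .
  qed
  have fst_pol: "0 < fst (pol s \<phi>) \<longleftrightarrow> \<phi> \<in> {-(pi/2)<..<pi/2}" if "s > 0" "\<phi> \<in> {-pi<..<pi}" for s \<phi>
    using that cos_pos_iff[of \<phi>] by (auto simp: pol_def zero_less_mult_iff)
  have sub: "{-(pi/2)<..<pi/2} \<subseteq> {-pi<..<pi}" by auto
  have r: "(s powr (1/m)) powr m = s" if "s > 0" for s :: real
    using that m by (simp add: powr_powr)
  have "(\<integral>\<^sup>+X. ennreal ((f (chart X))\<^sup>2) * indicator {0<..} (fst X) \<partial>lborel) =
    (\<integral>\<^sup>+\<phi>. (\<integral>\<^sup>+s. (\<lambda>r \<eta>. ennreal ((f (pol r \<eta>))\<^sup>2 * r powr m)) (s powr (1/m)) ((\<phi> + \<beta>) / N) * indicator {0<..} s \<partial>lborel)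
       * indicator {-(pi/2)<..<pi/2} \<phi> \<partial>lborel)"
    using sub by (intro P) (auto simp: chart_pol r fst_pol ennreal_mult indicator_def)
  moreover have "(\<integral>\<^sup>+X. ennreal \<bar>D1 X\<bar> \<partial>lborel) =
    (\<integral>\<^sup>+\<phi>. (\<integral>\<^sup>+s. (\<lambda>r \<eta>. ennreal (\<kappa>1 r \<eta>)) (s powr (1/m)) ((\<phi> + \<beta>) / N) * indicator {0<..} s \<partial>lborel)
       * indicator {-pi<..<pi} \<phi> \<partial>lborel)"
    by (intro P) (auto simp: D_pol(1)[symmetric] ennreal_mult)
  moreover have "(\<integral>\<^sup>+X. ennreal \<bar>D2 X\<bar> * indicator {0<..} (fst X) \<partial>lborel) =
    (\<integral>\<^sup>+\<phi>. (\<integral>\<^sup>+s. (\<lambda>r \<eta>. ennreal (\<kappa>2 r \<eta>)) (s powr (1/m)) ((\<phi> + \<beta>) / N) * indicator {0<..} s \<partial>lborel)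
       * indicator {-(pi/2)<..<pi/2} \<phi> \<partial>lborel)"
    using sub by (intro P) (auto simp: D_pol(2)[symmetric] fst_pol ennreal_mult indicator_def)
  ultimately show ?thesis
    using half_plane_bound by (simp only: nn_integral_chart, subst (asm) (1 2 3) nn_integral_chart) auto
qed

end

context plane_C1
begin

text \<open>The cover is cut into \<open>2N\<close> half planes. The vertical lines stay inside a half plane, the horizontal ones
  only inside the slit plane around it; hence one factor of \<open>sector_bound\<close> is summed and the other one is
  bounded by the integral over all sheets.\<close>

theorem weighted_plane_sobolev:
  fixes m :: real and N :: nat
  assumes N: "N \<ge> 1" and mN: "real N \<le> m"
  shows "(\<integral>\<^sup>+p. ennreal (norm p powr (2 * (m - 1)) * (f p)\<^sup>2) \<partial>lborel)
    \<le> ennreal (m / (8 * N)) * (\<integral>\<^sup>+p. ennreal (norm p powr (m - 1) * sqrt ((f1 p)\<^sup>2 + (f2 p)\<^sup>2)) \<partial>lborel)\<^sup>2"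
proof -
  have m: "m > 0" and N0: "real N > 0" using N mN by auto
  define w where "w r = ennreal (r powr (m - 1)) * indicator {0<..} r" for r :: real
  define k1 where "k1 r \<eta> = \<bar>cos (real N * \<eta>) * (rad (pol r \<eta>) / m) - sin (real N * \<eta>) * (ang (pol r \<eta>) / N)\<bar>" for r \<eta> :: real
  define k2 where "k2 r \<eta> = \<bar>sin (real N * \<eta>) * (rad (pol r \<eta>) / m) + cos (real N * \<eta>) * (ang (pol r \<eta>) / N)\<bar>" for r \<eta> :: real
  define A0 where "A0 \<eta> = (\<integral>\<^sup>+r. ennreal ((f (pol r \<eta>))\<^sup>2 * r powr m) * w r \<partial>lborel)" for \<eta> :: real
  define A1 where "A1 \<eta> = (\<integral>\<^sup>+r. ennreal (k1 r \<eta>) * w r \<partial>lborel)" for \<eta> :: real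
  define A2 where "A2 \<eta> = (\<integral>\<^sup>+r. ennreal (k2 r \<eta>) * w r \<partial>lborel)" for \<eta> :: real
  define X0 where "X0 = (\<integral>\<^sup>+\<eta>. A0 \<eta> * indicator {-pi<..<pi} \<eta> \<partial>lborel)"
  define X1 where "X1 = (\<integral>\<^sup>+\<eta>. A1 \<eta> * indicator {-pi<..<pi} \<eta> \<partial>lborel)"
  define X2 where "X2 = (\<integral>\<^sup>+\<eta>. A2 \<eta> * indicator {-pi<..<pi} \<eta> \<partial>lborel)"
  define Y where "Y = (\<integral>\<^sup>+p. ennreal (norm p powr (m - 1) * sqrt ((f1 p)\<^sup>2 + (f2 p)\<^sup>2)) \<partial>lborel)"
  have [measurable]: "w \<in> borel_measurable borel" unfolding w_def by measurable
  have [measurable]: "case_prod k1 \<in> borel_measurable (borel \<Otimes>\<^sub>M borel)" "case_prod k2 \<in> borel_measurable (borel \<Otimes>\<^sub>M borel)"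
    unfolding k1_def k2_def by measurable
  have [measurable]: "A0 \<in> borel_measurable borel" "A1 \<in> borel_measurable borel" "A2 \<in> borel_measurable borel"
    unfolding A0_def A1_def A2_def by measurable
  \<comment> \<open>This is where \<open>N\<close> has to be an integer.\<close>
  have per: "A0 (\<eta> + 2 * pi) = A0 \<eta>" "A1 (\<eta> + 2 * pi) = A1 \<eta>" "A2 (\<eta> + 2 * pi) = A2 \<eta>" for \<eta> :: real
  proof -
    have "cos (real N * (\<eta> + 2 * pi)) = cos (real N * \<eta> + 2 * (real N * pi))" "sin (real N * (\<eta> + 2 * pi)) = sin (real N * \<eta> + 2 * (real N * pi))"
      by (auto simp: algebra_simps)
    then have "cos (real N * (\<eta> + 2 * pi)) = cos (real N * \<eta>)" "sin (real N * (\<eta> + 2 * pi)) = sin (real N * \<eta>)"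
      using cos_int_2pin[of "int N"] sin_int_2pin[of "int N"] by (simp_all add: cos_add sin_add mult_ac)
    then show "A0 (\<eta> + 2 * pi) = A0 \<eta>" "A1 (\<eta> + 2 * pi) = A1 \<eta>" "A2 (\<eta> + 2 * pi) = A2 \<eta>"
      unfolding A0_def A1_def A2_def k1_def k2_def pol_periodic by simp_all
  qed
  define d where "d = pi / N"
  have d: "d > 0" unfolding d_def using N0 by simp
  let ?S = "\<lambda>j. {- (d/2) + real j * d<..<- (d/2) + real (Suc j) * d}"
  have sector: "ennreal (m * N) * (\<integral>\<^sup>+\<eta>. A0 \<eta> * indicator (?S j) \<eta> \<partial>lborel)
    \<le> ennreal (1/4) * (ennreal (m * N) * X1) * (ennreal (m * N) * (\<integral>\<^sup>+\<eta>. A2 \<eta> * indicator (?S j) \<eta> \<partial>lborel))"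
    if j: "j < 2 * N" for j
  proof -
    interpret plane_chart f f1 f2 R m "real N" "real j * pi"
      by unfold_locales (use m N0 in auto)
    \<comment> \<open>Passing to the j-th half plane turns both axes by j half turns, a mere sign
      that the absolute values remove; hence \<open>k1\<close> and \<open>k2\<close> do not depend
      on j.\<close>
    have trig: "cos (real N * \<eta> - real j * pi) = (-1) ^ j * cos (real N * \<eta>)" "sin (real N * \<eta> - real j * pi) = (-1) ^ j * sin (real N * \<eta>)" for \<eta> :: real
      by (simp_all add: cos_diff sin_diff)
    have k: "\<kappa>1 r \<eta> = k1 r \<eta>" "\<kappa>2 r \<eta> = k2 r \<eta>" for r \<eta> :: real
    proof -
      have "\<kappa>1 r \<eta> = \<bar>(-1) ^ j * (cos (real N * \<eta>) * (rad (pol r \<eta>) / m) - sin (real N * \<eta>) * (ang (pol r \<eta>) / N))\<bar>"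
        unfolding \<kappa>1_def trig by (simp add: algebra_simps)
      then show "\<kappa>1 r \<eta> = k1 r \<eta>" unfolding k1_def by (simp add: abs_mult)
      have "\<kappa>2 r \<eta> = \<bar>(-1) ^ j * (sin (real N * \<eta>) * (rad (pol r \<eta>) / m) + cos (real N * \<eta>) * (ang (pol r \<eta>) / N))\<bar>"
        unfolding \<kappa>2_def trig by (simp add: algebra_simps)
      then show "\<kappa>2 r \<eta> = k2 r \<eta>" unfolding k2_def by (simp add: abs_mult)
    qed
    have S: "indicator {-(pi/2)<..<pi/2} (real N * \<eta> - real j * pi) = (indicator (?S j) \<eta> :: ennreal)" for \<eta> :: real
    proof -
      have e: "real N * \<eta> - real j * pi = real N * (\<eta> - real j * d)" "pi/2 = real N * (d/2)"
        unfolding d_def using N0 by (simp_all add: right_diff_distrib)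
      have "-(pi/2) < real N * \<eta> - real j * pi \<longleftrightarrow> -(d/2) < \<eta> - real j * d"
        unfolding e using mult_less_cancel_left_pos[OF N0, of "-(d/2)" "\<eta> - real j * d"] by simp
      moreover have "real N * \<eta> - real j * pi < pi/2 \<longleftrightarrow> \<eta> - real j * d < d/2"
        unfolding e using mult_less_cancel_left_pos[OF N0, of "\<eta> - real j * d" "d/2"] by simp
      moreover have "- (d/2) + real (Suc j) * d = d/2 + real j * d" by (simp add: algebra_simps)
      ultimately show ?thesis by (auto split: split_indicator)
    qed
    \<comment> \<open>The slit plane around sector j has angular width 2 \<pi> / N, so it fits into
      one period centred at j d. Recentring \<open>X1\<close> there is allowed by
      periodicity.\<close>
    have S': "(\<integral>\<^sup>+\<eta>. A1 \<eta> * indicator {-pi<..<pi} (real N * \<eta> - real j * pi) \<partial>lborel) \<le> X1"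
    proof -
      have "real j * d \<le> 2 * pi"
        using j N0 unfolding d_def by (simp add: field_simps)
      then have X1: "X1 = (\<integral>\<^sup>+\<eta>. A1 \<eta> * indicator {real j * d - pi<..<real j * d - pi + 2 * pi} \<eta> \<partial>lborel)"
        unfolding X1_def using d by (intro nn_integral_periodic[symmetric] per) auto
      have "\<bar>x\<bar> < pi" if "\<bar>real N * x\<bar> < pi" for x :: real
      proof -
        have "1 * \<bar>x\<bar> \<le> N * \<bar>x\<bar>" using N by (intro mult_right_mono) auto
        then show ?thesis using that by (simp add: abs_mult)
      qed
      from this[of "\<eta> - real j * d" for \<eta>] have "\<bar>\<eta> - real j * d\<bar> < pi" if "\<bar>N * \<eta> - j * pi\<bar> < pi" for \<eta> :: real
        using that N0 unfolding d_def by (simp add: right_diff_distrib)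
      then show ?thesis unfolding X1
        by (intro nn_integral_mono mult_left_mono) (auto simp: abs_less_iff split: split_indicator, fastforce+)
    qed
    from sector_bound have "ennreal (m * N) * (\<integral>\<^sup>+\<eta>. A0 \<eta> * indicator (?S j) \<eta> \<partial>lborel)
      \<le> ennreal (1/4) * (ennreal (m * N) * (\<integral>\<^sup>+\<eta>. A1 \<eta> * indicator {-pi<..<pi} (real N * \<eta> - real j * pi) \<partial>lborel)) *
         (ennreal (m * N) * (\<integral>\<^sup>+\<eta>. A2 \<eta> * indicator (?S j) \<eta> \<partial>lborel))"
      unfolding S k A0_def A1_def A2_def w_def by (simp only: mult.assoc)
    also have "\<dots> \<le> ennreal (1/4) * (ennreal (m * N) * X1) * (ennreal (m * N) * (\<integral>\<^sup>+\<eta>. A2 \<eta> * indicator (?S j) \<eta> \<partial>lborel))"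
      using S' by (intro mult_mono order_refl) auto
    finally show ?thesis .
  qed
  \<comment> \<open>The sectors are centred at the multiples of \<open>d\<close>, so they tile a
    period that starts at -d/2 rather than at -\<pi>.\<close>
  have split: "(\<integral>\<^sup>+\<eta>. K \<eta> * indicator {-pi<..<pi} \<eta> \<partial>lborel) = (\<Sum>j<2*N. \<integral>\<^sup>+\<eta>. K \<eta> * indicator (?S j) \<eta> \<partial>lborel)"
    if [measurable]: "K \<in> borel_measurable borel" and "\<And>\<eta>. K (\<eta> + 2 * pi) = K \<eta>" for K :: "real \<Rightarrow> ennreal"
  proof -
    have "d \<le> pi" unfolding d_def using N by (simp add: field_simps)
    then have "(\<integral>\<^sup>+\<eta>. K \<eta> * indicator {-pi<..<pi} \<eta> \<partial>lborel) = (\<integral>\<^sup>+\<eta>. K \<eta> * indicator {-(d/2)<..<-(d/2) + 2 * pi} \<eta> \<partial>lborel)"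
      using d by (intro nn_integral_periodic[symmetric] that) auto
    also have "2 * pi = real (2 * N) * d" unfolding d_def using N0 by simp
    finally show ?thesis using nn_integral_split_intervals[of K d "-(d/2)" "2 * N"] d by simp
  qed
  have "ennreal (m * N) * X0 = (\<Sum>j<2*N. ennreal (m * N) * (\<integral>\<^sup>+\<eta>. A0 \<eta> * indicator (?S j) \<eta> \<partial>lborel))"
    unfolding X0_def by (subst split) (auto simp: per sum_distrib_left)
  also have "\<dots> \<le> (\<Sum>j<2*N. ennreal (1/4) * (ennreal (m * N) * X1) * (ennreal (m * N) * (\<integral>\<^sup>+\<eta>. A2 \<eta> * indicator (?S j) \<eta> \<partial>lborel)))"
    by (intro sum_mono sector) auto
  also have "\<dots> = ennreal (1/4) * (ennreal (m * N) * X1) * (ennreal (m * N) * X2)"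
    unfolding X2_def by (subst split) (auto simp: per sum_distrib_left)
  finally have main: "ennreal (m * N) * X0 \<le> ennreal (1/4) * (ennreal (m * N) * X1) * (ennreal (m * N) * X2)" .

  \<comment> \<open>Here N \<le> m is used, to replace the radial factor 1/m by 1/N. Then
    \<open>rad\<close> and \<open>ang\<close> combine to r times the length of the gradient.\<close>
  have k12: "k1 r \<eta> + k2 r \<eta> \<le> sqrt 2 / N * (\<bar>r\<bar> * sqrt ((f1 (pol r \<eta>))\<^sup>2 + (f2 (pol r \<eta>))\<^sup>2))" for r \<eta> :: real
  proof -
    have "k1 r \<eta> + k2 r \<eta> \<le> sqrt 2 * sqrt ((rad (pol r \<eta>) / m)\<^sup>2 + (ang (pol r \<eta>) / N)\<^sup>2)"
      unfolding k1_def k2_def by (rule rotated_abs_sum_le) simp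
    also have "\<dots> \<le> sqrt 2 * sqrt ((rad (pol r \<eta>) / N)\<^sup>2 + (ang (pol r \<eta>) / N)\<^sup>2)"
      using mN m N0 unfolding power_divide
      by (intro mult_left_mono real_sqrt_le_mono add_right_mono divide_left_mono power_mono) auto
    also have "(rad (pol r \<eta>) / N)\<^sup>2 + (ang (pol r \<eta>) / N)\<^sup>2 = ((rad (pol r \<eta>))\<^sup>2 + (ang (pol r \<eta>))\<^sup>2) / N\<^sup>2"
      by (simp add: power_divide add_divide_distrib)
    also have "(rad (pol r \<eta>))\<^sup>2 + (ang (pol r \<eta>))\<^sup>2 = ((fst (pol r \<eta>))\<^sup>2 + (snd (pol r \<eta>))\<^sup>2) * ((f1 (pol r \<eta>))\<^sup>2 + (f2 (pol r \<eta>))\<^sup>2)"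
      unfolding rad_def ang_def by (simp add: power2_eq_square algebra_simps)
    also have "(fst (pol r \<eta>))\<^sup>2 + (snd (pol r \<eta>))\<^sup>2 = r\<^sup>2"
      unfolding pol_def by (simp add: power_mult_distrib flip: distrib_left)
    finally show ?thesis using N0 by (simp add: real_sqrt_divide real_sqrt_mult)
  qed
  have pos: "(\<integral>\<^sup>+p. H p \<partial>lborel) = (\<integral>\<^sup>+\<eta>. (\<integral>\<^sup>+r. H (pol r \<eta>) * ennreal r \<partial>lborel) * indicator {-pi<..<pi} \<eta> \<partial>lborel)"
    if "H \<in> borel_measurable borel" for H :: "real \<times> real \<Rightarrow> ennreal"
    unfolding pol_def by (rule nn_integral_polar[OF that])
  have "X1 + X2 = (\<integral>\<^sup>+\<eta>. A1 \<eta> * indicator {-pi<..<pi} \<eta> + A2 \<eta> * indicator {-pi<..<pi} \<eta> \<partial>lborel)"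
    unfolding X1_def X2_def by (rule nn_integral_add[symmetric]) auto
  also have "\<dots> = (\<integral>\<^sup>+\<eta>. (\<integral>\<^sup>+r. ennreal (k1 r \<eta>) * w r + ennreal (k2 r \<eta>) * w r \<partial>lborel) * indicator {-pi<..<pi} \<eta> \<partial>lborel)"
    unfolding A1_def A2_def by (intro nn_integral_cong) (subst nn_integral_add, auto simp: distrib_right)
  also have "\<dots> \<le> (\<integral>\<^sup>+\<eta>. (\<integral>\<^sup>+r. ennreal (sqrt 2 / N) * (ennreal (norm (pol r \<eta>) powr (m - 1) * sqrt ((f1 (pol r \<eta>))\<^sup>2 + (f2 (pol r \<eta>))\<^sup>2)) * ennreal r) \<partial>lborel) * indicator {-pi<..<pi} \<eta> \<partial>lborel)"
  proof (intro nn_integral_mono mult_right_mono)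
    fix r \<eta> :: real
    show "ennreal (k1 r \<eta>) * w r + ennreal (k2 r \<eta>) * w r \<le>
      ennreal (sqrt 2 / N) * (ennreal (norm (pol r \<eta>) powr (m - 1) * sqrt ((f1 (pol r \<eta>))\<^sup>2 + (f2 (pol r \<eta>))\<^sup>2)) * ennreal r)"
    proof (cases "r > 0")
      case True
      have "(k1 r \<eta> + k2 r \<eta>) * r powr (m - 1) \<le> sqrt 2 / N * (\<bar>r\<bar> * sqrt ((f1 (pol r \<eta>))\<^sup>2 + (f2 (pol r \<eta>))\<^sup>2)) * r powr (m - 1)"
        by (intro mult_right_mono k12) auto
      then have "ennreal ((k1 r \<eta> + k2 r \<eta>) * r powr (m - 1))
          \<le> ennreal (sqrt 2 / N * (r powr (m - 1) * sqrt ((f1 (pol r \<eta>))\<^sup>2 + (f2 (pol r \<eta>))\<^sup>2) * r))"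
        using True by (intro ennreal_leI) (simp add: mult_ac)
      moreover have "ennreal (k1 r \<eta>) * w r + ennreal (k2 r \<eta>) * w r = ennreal ((k1 r \<eta> + k2 r \<eta>) * r powr (m - 1))"
        using True unfolding w_def k1_def k2_def by (simp add: distrib_right ennreal_mult)
      moreover have "ennreal (sqrt 2 / N) * (ennreal (norm (pol r \<eta>) powr (m - 1) * sqrt ((f1 (pol r \<eta>))\<^sup>2 + (f2 (pol r \<eta>))\<^sup>2)) * ennreal r)
          = ennreal (sqrt 2 / N * (r powr (m - 1) * sqrt ((f1 (pol r \<eta>))\<^sup>2 + (f2 (pol r \<eta>))\<^sup>2) * r))"
        using True unfolding norm_pol by (simp add: ennreal_mult'[symmetric] ennreal_mult''[symmetric])
      ultimately show ?thesis by simp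
    qed (simp add: w_def)
  qed auto
  also have "\<dots> = ennreal (sqrt 2 / N) * Y"
    unfolding Y_def
    by (subst pos) (measurable, simp add: nn_integral_cmult mult.assoc)
  finally have X12: "X1 + X2 \<le> ennreal (sqrt 2 / N) * Y" .
  have X0: "(\<integral>\<^sup>+p. ennreal (norm p powr (2 * (m - 1)) * (f p)\<^sup>2) \<partial>lborel) = X0"
    unfolding X0_def A0_def
  proof (subst pos, measurable, rule nn_integral_cong, rule arg_cong2[where f="(*)", OF _ refl], rule nn_integral_cong)
    fix r \<eta> :: real
    have "r powr (2 * (m - 1)) * r = r powr m * r powr (m - 1)" if "r > 0"
    proof -
      have "r powr (2 * (m - 1)) * r = r powr (2 * (m - 1)) * r powr 1" using that by simp
      also have "\<dots> = r powr m * r powr (m - 1)" unfolding powr_add[symmetric] by (simp add: algebra_simps)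
      finally show ?thesis .
    qed
    then show "ennreal (norm (pol r \<eta>) powr (2 * (m - 1)) * (f (pol r \<eta>))\<^sup>2) * ennreal r
       = ennreal ((f (pol r \<eta>))\<^sup>2 * r powr m) * w r"
      unfolding w_def norm_pol
      by (cases "r > 0") (auto simp: ennreal_neg ennreal_mult'[symmetric] ennreal_mult''[symmetric] mult_ac)
  qed
  let ?c = "m * real N"
  have c: "?c > 0" using m N0 by simp
  \<comment> \<open>In the final constant, 1/16 is 1/4 from the two halved line integrals times 1/4
    from 4ab \<le> (a+b)^2; with (sqrt 2 / N)^2 and one remaining factor m N this gives m / (8
    N).\<close>
  have "X0 = ennreal (1 / ?c) * (ennreal ?c * X0)"
  proof -
    have "ennreal (1 / ?c) * ennreal ?c = ennreal (1 / ?c * ?c)"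
      using c by (intro ennreal_mult[symmetric]) auto
    also have "1 / ?c * ?c = 1" using m N0 by simp
    finally show ?thesis by (simp add: mult.assoc[symmetric])
  qed
  also have "\<dots> \<le> ennreal (1 / ?c) * (ennreal (1/4) * (ennreal ?c * X1) * (ennreal ?c * X2))"
    by (intro mult_left_mono main) auto
  also have "\<dots> = ennreal (1 / ?c) * ennreal ?c * ennreal (?c / 16) * (4 * (X1 * X2))"
  proof -
    have e: "ennreal (1/4) * ennreal ?c = ennreal (?c / 16) * 4"
      using c by (simp add: ennreal_mult[symmetric] ennreal_numeral[symmetric] del: ennreal_numeral)
    have "ennreal (1 / ?c) * (ennreal (1/4) * (ennreal ?c * X1) * (ennreal ?c * X2))
      = ennreal (1 / ?c) * ennreal ?c * (ennreal (1/4) * ennreal ?c) * (X1 * X2)" by (simp only: mult_ac)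
    then show ?thesis unfolding e by (simp only: mult_ac)
  qed
  also have "ennreal (1 / ?c) * ennreal ?c = 1"
  proof -
    have "ennreal (1 / ?c) * ennreal ?c = ennreal (1 / ?c * ?c)"
      using c by (intro ennreal_mult[symmetric]) auto
    also have "1 / ?c * ?c = 1" using m N0 by simp
    finally show ?thesis by simp
  qed
  also have "1 * ennreal (?c / 16) * (4 * (X1 * X2)) \<le> ennreal (?c / 16) * (ennreal (sqrt 2 / N) * Y)\<^sup>2"
  proof -
    have "4 * (X1 * X2) \<le> (ennreal (sqrt 2 / N) * Y)\<^sup>2"
      by (rule order_trans[OF four_mult_le_power2_ennreal power_mono[OF X12]]) simp
    then show ?thesis by (simp add: mult_left_mono)
  qed
  also have "\<dots> = (ennreal (?c / 16) * (ennreal (sqrt 2 / N))\<^sup>2) * Y\<^sup>2" by (simp only: power_mult_distrib mult_ac)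
  also have "ennreal (?c / 16) * (ennreal (sqrt 2 / N))\<^sup>2 = ennreal (m / (8 * N))"
    using c N0 by (simp add: ennreal_power ennreal_mult[symmetric] power_divide) (simp add: power2_eq_square)
  finally show ?thesis unfolding X0 Y_def .
qed

end

section \<open>Test functions on three-space\<close>

definition vec3 :: "real \<times> real \<Rightarrow> real \<Rightarrow> real^3" where
  "vec3 p y = fst p *\<^sub>R axis 1 1 + snd p *\<^sub>R axis 2 1 + y *\<^sub>R axis 3 1"

lemma vec3_nth [simp]: "vec3 p y $ 1 = fst p" "vec3 p y $ 2 = snd p" "vec3 p y $ 3 = y"
  unfolding vec3_def by (simp_all add: axis_def)

lemma vec3_collapse: "vec3 (x $ 1, x $ 2) (x $ 3) = x"
  by (simp add: vec_eq_iff forall_3)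

lemma xnorm_vec3 [simp]: "xnorm (vec3 p y) = norm p"
  by (simp add: xnorm_def norm_prod_def)

lemma norm_real3: "norm (x :: real^3) = sqrt ((x$1)\<^sup>2 + (x$2)\<^sup>2 + (x$3)\<^sup>2)"
  by (simp add: norm_vec_def L2_set_def sum_3)

lemma norm_vec3_ge: "norm p \<le> norm (vec3 p y)" "\<bar>y\<bar> \<le> norm (vec3 p y)"
  using component_le_norm_cart[of "vec3 p y" 3] by (auto simp: norm_real3 norm_prod_def)

lemma continuous_on_vec3 [continuous_intros]:
  "continuous_on A g \<Longrightarrow> continuous_on A h \<Longrightarrow> continuous_on A (\<lambda>x. vec3 (g x) (h x))"
  unfolding vec3_def by (intro continuous_intros)

lemma measurable_vec3 [measurable (raw)]:
  assumes [measurable]: "g \<in> borel_measurable M" "h \<in> borel_measurable M"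
  shows "(\<lambda>x. vec3 (g x) (h x)) \<in> borel_measurable M"
proof -
  have "(\<lambda>q. vec3 (fst q) (snd q)) \<in> borel_measurable borel"
    by (intro borel_measurable_continuous_onI continuous_intros)
  from measurable_compose[OF _ this, of "\<lambda>x. (g x, h x)" M] show ?thesis by simp
qed

lemma Basis_real3: "Basis = (\<lambda>i::3. axis i 1 :: real^3) ` UNIV"
  by (auto simp: Basis_vec_def)

lemma lborel_vec3: "lborel = distr (lborel \<Otimes>\<^sub>M lborel) borel (\<lambda>(p, y). vec3 p y)"
proof (rule lborel_eqI)
  fix l u :: "real^3" assume le: "\<And>b. b \<in> Basis \<Longrightarrow> l \<bullet> b \<le> u \<bullet> b"
  then have le: "l $ i \<le> u $ i" for i using le[of "axis i 1"] by (simp add: inner_axis)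
  have m: "(\<lambda>(p, y). vec3 p y) \<in> lborel \<Otimes>\<^sub>M lborel \<rightarrow>\<^sub>M borel" by measurable
  have "(\<lambda>(p, y). vec3 p y) -` box l u \<inter> space (lborel \<Otimes>\<^sub>M lborel)
      = ({l$1<..<u$1} \<times> {l$2<..<u$2}) \<times> {l$3<..<u$3}"
    by (auto simp: mem_box_cart forall_3 space_pair_measure)
  then have "emeasure (distr (lborel \<Otimes>\<^sub>M lborel) borel (\<lambda>(p, y). vec3 p y)) (box l u)
      = emeasure (lborel \<Otimes>\<^sub>M lborel) (({l$1<..<u$1} \<times> {l$2<..<u$2}) \<times> {l$3<..<u$3})"
    by (subst emeasure_distr[OF m]) auto
  also have "\<dots> = emeasure lborel ({l$1<..<u$1} \<times> {l$2<..<u$2}) * emeasure lborel {l$3<..<u$3}"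
    by (rule lborel.emeasure_pair_measure_Times) (auto intro!: borel_open open_Times)
  also have "emeasure lborel ({l$1<..<u$1} \<times> {l$2<..<u$2}) = emeasure lborel {l$1<..<u$1} * emeasure lborel {l$2<..<u$2}"
    unfolding lborel_prod[symmetric] by (rule lborel.emeasure_pair_measure_Times) auto
  also have "emeasure lborel {l$1<..<u$1} * emeasure lborel {l$2<..<u$2} * emeasure lborel {l$3<..<u$3}
     = (\<Prod>b\<in>Basis. (u - l) \<bullet> b)"
  proof -
    have "(\<Prod>b\<in>Basis. (u - l) \<bullet> b) = (\<Prod>i\<in>(UNIV::3 set). (u - l) $ i)"
      unfolding Basis_real3 by (subst prod.reindex) (auto simp: inj_on_def axis_eq_axis inner_axis)
    also have "\<dots> = (u$1 - l$1) * (u$2 - l$2) * (u$3 - l$3)"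
      unfolding UNIV_3 by (simp add: mult.assoc)
    finally show ?thesis using le by (simp add: ennreal_mult)
  qed
  finally show "emeasure (distr (lborel \<Otimes>\<^sub>M lborel) borel (\<lambda>(p, y). vec3 p y)) (box l u) = (\<Prod>b\<in>Basis. (u - l) \<bullet> b)" .
qed simp

lemma nn_integral_vec3:
  assumes [measurable]: "H \<in> borel_measurable borel"
  shows "(\<integral>\<^sup>+x. H x \<partial>lborel) = (\<integral>\<^sup>+y. \<integral>\<^sup>+p. H (vec3 p y) \<partial>lborel \<partial>lborel)"
    and "(\<integral>\<^sup>+x. H x \<partial>lborel) = (\<integral>\<^sup>+p. \<integral>\<^sup>+y. H (vec3 p y) \<partial>lborel \<partial>lborel)"
proof -
  have "(\<integral>\<^sup>+x. H x \<partial>lborel) = (\<integral>\<^sup>+q. H (vec3 (fst q) (snd q)) \<partial>(lborel \<Otimes>\<^sub>M lborel))"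
    by (subst lborel_vec3, subst nn_integral_distr) (auto simp: case_prod_beta)
  moreover have "(\<lambda>q. H (vec3 (fst q) (snd q))) \<in> borel_measurable ((lborel :: (real \<times> real) measure) \<Otimes>\<^sub>M (lborel :: real measure))"
    by measurable
  ultimately show "(\<integral>\<^sup>+x. H x \<partial>lborel) = (\<integral>\<^sup>+y. \<integral>\<^sup>+p. H (vec3 p y) \<partial>lborel \<partial>lborel)"
    "(\<integral>\<^sup>+x. H x \<partial>lborel) = (\<integral>\<^sup>+p. \<integral>\<^sup>+y. H (vec3 p y) \<partial>lborel \<partial>lborel)"
    using lborel_pair.nn_integral_snd[of "\<lambda>q. H (vec3 (fst q) (snd q))"]
      lborel.nn_integral_fst[of "\<lambda>q. H (vec3 (fst q) (snd q))" lborel] by simp_all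
qed

lemma C0_inftyD:
  assumes "f \<in> C0_infty"
  shows "iter_pd is f differentiable (at p)" "\<exists>R. \<forall>p. norm p \<ge> R \<longrightarrow> f p = 0"
proof -
  show "iter_pd is f differentiable (at p)" using assms by (auto simp: C0_infty_def)
  have "compact (closure {p. f p \<noteq> 0})" using assms by (auto simp: C0_infty_def)
  then have "bounded {p. f p \<noteq> 0}" by (meson bounded_subset closure_subset compact_imp_bounded)
  then obtain B where "\<forall>p\<in>{p. f p \<noteq> 0}. norm p \<le> B" by (auto simp: bounded_iff)
  then show "\<exists>R. \<forall>p. norm p \<ge> R \<longrightarrow> f p = 0" by (intro exI[of _ "B + 1"]) fastforce
qed

lemma has_derivative_pd:
  assumes "f differentiable (at p)"
  shows "(f has_derivative (\<lambda>h. h$1 * pd f 1 p + h$2 * pd f 2 p + h$3 * pd f 3 p)) (at p)"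
proof -
  let ?D = "frechet_derivative f (at p)"
  have "(f has_derivative ?D) (at p)" using assms by (simp add: frechet_derivative_works)
  moreover have "?D h = h$1 * pd f 1 p + h$2 * pd f 2 p + h$3 * pd f 3 p" for h
  proof -
    interpret linear ?D by (rule linear_frechet_derivative[OF assms])
    have "?D h = ?D (vec3 (h$1, h$2) (h$3))" by (simp add: vec3_collapse)
    also have "\<dots> = h$1 * pd f 1 p + h$2 * pd f 2 p + h$3 * pd f 3 p"
      unfolding vec3_def pd_def by (simp add: add scale)
    finally show ?thesis .
  qed
  ultimately show ?thesis by (rule has_derivative_eq_rhs[OF _ ext])
qed

locale test_fun =
  fixes f :: "real^3 \<Rightarrow> real"
  assumes C0: "f \<in> C0_infty"
begin

lemma differentiable: "f differentiable (at p)" "pd f i differentiable (at p)" "pd (pd f i) j differentiable (at p)"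
  using C0_inftyD(1)[OF C0, of "[]"] C0_inftyD(1)[OF C0, of "[i]"] C0_inftyD(1)[OF C0, of "[j, i]"] by auto

lemma continuous: "continuous_on UNIV f" "continuous_on UNIV (pd f i)" "continuous_on UNIV (pd (pd f i) j)"
  using differentiable by (auto simp: continuous_on_eq_continuous_at intro: differentiable_imp_continuous_within)

lemma measurable_test[measurable]: "f \<in> borel_measurable borel" "pd f i \<in> borel_measurable borel"
   "pd (pd f i) j \<in> borel_measurable borel"
  using continuous by (auto intro: borel_measurable_continuous_onI)

definition R where "R = (SOME R. R > 0 \<and> (\<forall>p. norm p \<ge> R \<longrightarrow> f p = 0))"

lemma R: "R > 0" "\<And>p. norm p \<ge> R \<Longrightarrow> f p = 0"
proof -
  obtain B where "\<forall>p. norm p \<ge> B \<longrightarrow> f p = 0" using C0_inftyD(2)[OF C0] by blast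
  then have "\<exists>R. R > 0 \<and> (\<forall>p. norm p \<ge> R \<longrightarrow> f p = 0)" by (intro exI[of _ "max B 1"]) auto
  from someI_ex[OF this] show "R > 0" "\<And>p. norm p \<ge> R \<Longrightarrow> f p = 0" unfolding R_def by auto
qed

end

text \<open>The strict inequality describes an open set, so \<open>g\<close> vanishes in a
  neighbourhood of \<open>p\<close>.\<close>

lemma pd_eq_0:
  assumes "\<And>q. norm q > r \<Longrightarrow> g q = 0" "norm p > r"
  shows "pd g i p = 0"
proof -
  have "open {q :: real^3. norm q > r}" by (intro open_Collect_less continuous_intros)
  then have "eventually (\<lambda>q. norm q > r) (nhds p)" using assms(2) by (simp add: eventually_nhds) blast
  then have e: "eventually (\<lambda>q. g q = 0) (nhds p)" by eventually_elim (rule assms(1))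
  have "(g has_derivative (\<lambda>h. 0)) (at p)"
    using has_derivative_const[of 0 "at p"]
    by (rule has_derivative_transform_eventually) (use e assms in \<open>auto simp: eventually_at_filter elim: eventually_mono\<close>)
  then have "frechet_derivative g (at p) = (\<lambda>h. 0)" by (rule frechet_derivative_at[symmetric])
  then show ?thesis by (simp add: pd_def)
qed

context test_fun
begin

lemma pd_supp: "norm p > R \<Longrightarrow> pd f i p = 0" "norm p > R \<Longrightarrow> pd (pd f i) j p = 0"
proof -
  have 1: "norm p > R \<Longrightarrow> pd f i p = 0" for p i by (rule pd_eq_0[of R]) (auto intro: R)
  show "norm p > R \<Longrightarrow> pd f i p = 0" by (rule 1)
  show "norm p > R \<Longrightarrow> pd (pd f i) j p = 0" by (rule pd_eq_0[of R]) (auto intro: 1)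
qed

lemma deriv_slice:
  "((\<lambda>p. f (vec3 p y)) has_derivative (\<lambda>h. pd f 1 (vec3 p y) * fst h + pd f 2 (vec3 p y) * snd h)) (at p)"
proof -
  have "((\<lambda>p. vec3 p y) has_derivative (\<lambda>h. fst h *\<^sub>R axis 1 1 + snd h *\<^sub>R axis 2 1)) (at p)"
    unfolding vec3_def by (auto intro!: derivative_eq_intros)
  from diff_chain_at[OF this has_derivative_pd[OF differentiable(1)]]
  show ?thesis by (simp add: o_def axis_def mult.commute)
qed

end

lemma deriv_line:
  assumes "g differentiable (at (vec3 p y))"
  shows "((\<lambda>t. g (vec3 p t)) has_real_derivative pd g 3 (vec3 p y)) (at y)"
proof -
  have "((\<lambda>t. vec3 p t) has_derivative (\<lambda>h. h *\<^sub>R axis 3 1)) (at y)"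
    unfolding vec3_def by (auto intro!: derivative_eq_intros)
  from diff_chain_at[OF this has_derivative_pd[OF assms]]
  show ?thesis
    by (simp add: o_def axis_def has_field_derivative_def mult.commute[of _ "pd _ _ _"])
qed

section \<open>The weight, compactly supported integrands, and the inequality for test
  functions\<close>

lemma continuous_xnorm [continuous_intros]: "continuous_on A xnorm"
  unfolding xnorm_def[abs_def] by (intro continuous_intros)

lemma xnorm_nonneg [simp]: "xnorm p \<ge> 0"
  by (simp add: xnorm_def)

lemma continuous_weight: "a > 0 \<Longrightarrow> continuous_on A (\<lambda>x. xnorm x powr a)"
  by (rule continuous_on_powr') (auto intro: continuous_intros)

lemma measurable_xnorm [measurable]: "xnorm \<in> borel_measurable borel"
  using continuous_xnorm by (rule borel_measurable_continuous_onI)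

lemma integrable_compact_support:
  fixes g :: "real^3 \<Rightarrow> real"
  assumes "continuous_on UNIV g" "\<And>x. norm x > r \<Longrightarrow> g x = 0"
  shows "integrable lborel g"
proof -
  have "integrable lborel (\<lambda>x. indicator (cball 0 r) x *\<^sub>R g x)"
    using assms(1) by (intro borel_integrable_compact) (auto intro: continuous_on_subset)
  moreover have "(\<lambda>x. indicator (cball 0 r) x *\<^sub>R g x) = g"
    using assms(2) by (auto simp: fun_eq_iff indicator_def)
  ultimately show ?thesis by simp
qed

lemma nn_integral_compact_support:
  fixes g :: "real^3 \<Rightarrow> real"
  assumes "continuous_on UNIV g" "\<And>x. norm x > r \<Longrightarrow> g x = 0" "\<And>x. g x \<ge> 0"
  shows "(\<integral>\<^sup>+x. ennreal (g x) \<partial>lborel) < \<infinity>"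
  using integrable_compact_support[OF assms(1,2)] assms(3)
  by (subst nn_integral_eq_integral) auto

text \<open>The arithmetic-geometric mean inequality for a/2, a/2, b, with equality at a =
  2b.\<close>

lemma power2_mult_le_cube:
  fixes a b :: real
  assumes "a \<ge> 0" "b \<ge> 0"
  shows "27 * (a\<^sup>2 * b) \<le> 4 * (a + b) ^ 3"
proof -
  have "4 * (a + b) ^ 3 - 27 * (a\<^sup>2 * b) = (a - 2 * b)\<^sup>2 * (4 * a + b)"
    by (simp add: power2_eq_square power3_eq_cube algebra_simps)
  moreover have "\<dots> \<ge> 0" using assms by simp
  ultimately show ?thesis by linarith
qed

lemma norm_gradG: "(norm (gradG \<alpha> f x))\<^sup>2 = (pd f 1 x)\<^sup>2 + (pd f 2 x)\<^sup>2 + (xnorm x powr \<alpha> * pd f 3 x)\<^sup>2"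
  by (simp add: norm_real3 gradG_def)

context test_fun
begin

text \<open>The estimate closes on itself. Cauchy-Schwarz on each slice gives M \<le> k S A, while
  S^2 \<le> 4 M B contains \<open>M\<close> again, so squaring yields M^2 \<le> 4 k^2 A^2 M B and
  one \<open>M\<close> cancels. The mean inequality with its factor 4/27 then turns A^2 B into the
  cube of the energy A + B, whence 16/27 k^2.\<close>

theorem test_sobolev:
  fixes \<alpha> :: real and N :: nat
  assumes \<alpha>: "\<alpha> > 0" and N: "N \<ge> 1" "real N \<le> \<alpha> + 1"
  defines "k \<equiv> 9 * (\<alpha> + 1) / (8 * N)"
  shows "(\<integral>\<^sup>+x. ennreal (xnorm x powr (2 * \<alpha>) * \<bar>f x\<bar> powr 6) \<partial>lborel)
     \<le> ennreal (16 / 27 * k\<^sup>2) * (\<integral>\<^sup>+x. ennreal ((norm (gradG \<alpha> f x))\<^sup>2) \<partial>lborel) ^ 3"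
proof -
  define w where "w x = xnorm x powr \<alpha>" for x :: "real^3"
  have w2: "xnorm x powr (2 * \<alpha>) = (w x)\<^sup>2" for x :: "real^3"
    unfolding w_def by (simp add: power2_eq_square flip: powr_add)
  have w0: "w x \<ge> 0" for x unfolding w_def by simp
  have cw: "continuous_on UNIV w" unfolding w_def by (rule continuous_weight[OF \<alpha>])
  then have [measurable]: "w \<in> borel_measurable borel" by (rule borel_measurable_continuous_onI)
  have w_vec3: "w (vec3 p y) = norm p powr \<alpha>" for p y by (simp add: w_def)
  have k0: "k \<ge> 0" unfolding k_def using \<alpha> by simp
  let ?f1 = "pd f 1" and ?f2 = "pd f 2" and ?f3 = "pd f 3"
  define M where "M = (\<integral>\<^sup>+x. ennreal ((w x)\<^sup>2 * f x ^ 6) \<partial>lborel)"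
  define A where "A = (\<integral>\<^sup>+x. ennreal ((?f1 x)\<^sup>2 + (?f2 x)\<^sup>2) \<partial>lborel)"
  define B where "B = (\<integral>\<^sup>+x. ennreal ((w x * ?f3 x)\<^sup>2) \<partial>lborel)"
  define S where "S = (\<integral>\<^sup>+x. ennreal (2 * (w x * \<bar>f x\<bar> ^ 3)) * ennreal (w x * \<bar>?f3 x\<bar>) \<partial>lborel)"
  define Q where "Q y = (\<integral>\<^sup>+p. ennreal ((w (vec3 p y))\<^sup>2 * f (vec3 p y) ^ 4) \<partial>lborel)" for y
  define G where "G y = (\<integral>\<^sup>+p. ennreal ((?f1 (vec3 p y))\<^sup>2 + (?f2 (vec3 p y))\<^sup>2) \<partial>lborel)" for y
  have [measurable]: "Q \<in> borel_measurable borel" "G \<in> borel_measurable borel"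
    unfolding Q_def G_def by measurable
  have slice: "(\<integral>\<^sup>+p. ennreal ((w (vec3 p y))\<^sup>2 * f (vec3 p y) ^ 6) \<partial>lborel) \<le> ennreal k * (Q y * G y)" for y
  proof -
    let ?g = "\<lambda>p. f (vec3 p y)"
    interpret plane_C1 "\<lambda>p. ?g p ^ 3" "\<lambda>p. 3 * (?g p)\<^sup>2 * ?f1 (vec3 p y)" "\<lambda>p. 3 * (?g p)\<^sup>2 * ?f2 (vec3 p y)" R
    proof
      fix p :: "real \<times> real"
      show "((\<lambda>p. ?g p ^ 3) has_derivative (\<lambda>h. 3 * (?g p)\<^sup>2 * ?f1 (vec3 p y) * fst h + 3 * (?g p)\<^sup>2 * ?f2 (vec3 p y) * snd h)) (at p)"
        by (auto intro!: derivative_eq_intros deriv_slice simp: algebra_simps)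
      show "?g p ^ 3 = 0" if "R \<le> norm p"
        using R(2)[of "vec3 p y"] norm_vec3_ge(1)[of p y] that by simp
    next
      have c: "continuous_on UNIV (\<lambda>p. g (vec3 p y))" if "continuous_on UNIV g" for g :: "real^3 \<Rightarrow> real"
        by (rule continuous_on_compose2[OF that]) (auto intro!: continuous_intros)
      show "continuous_on UNIV (\<lambda>p. 3 * (?g p)\<^sup>2 * ?f1 (vec3 p y))" "continuous_on UNIV (\<lambda>p. 3 * (?g p)\<^sup>2 * ?f2 (vec3 p y))"
        by (intro continuous_intros c continuous)+
    qed
    have "(\<integral>\<^sup>+p. ennreal ((w (vec3 p y))\<^sup>2 * ?g p ^ 6) \<partial>lborel)
       = (\<integral>\<^sup>+p. ennreal (norm p powr (2 * (\<alpha> + 1 - 1)) * (?g p ^ 3)\<^sup>2) \<partial>lborel)"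
      by (intro nn_integral_cong) (simp add: w2[symmetric] flip: power_mult)
    also have "\<dots> \<le> ennreal ((\<alpha> + 1) / (8 * N)) * (\<integral>\<^sup>+p. ennreal (norm p powr (\<alpha> + 1 - 1) *
        sqrt ((3 * (?g p)\<^sup>2 * ?f1 (vec3 p y))\<^sup>2 + (3 * (?g p)\<^sup>2 * ?f2 (vec3 p y))\<^sup>2)) \<partial>lborel)\<^sup>2"
      by (rule weighted_plane_sobolev[OF N])
    also have "(\<integral>\<^sup>+p. ennreal (norm p powr (\<alpha> + 1 - 1) *
        sqrt ((3 * (?g p)\<^sup>2 * ?f1 (vec3 p y))\<^sup>2 + (3 * (?g p)\<^sup>2 * ?f2 (vec3 p y))\<^sup>2)) \<partial>lborel)
      = (\<integral>\<^sup>+p. ennreal (3 * (w (vec3 p y) * (?g p)\<^sup>2)) * ennreal (sqrt ((?f1 (vec3 p y))\<^sup>2 + (?f2 (vec3 p y))\<^sup>2)) \<partial>lborel)"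
    proof (rule nn_integral_cong)
      fix p
      have "(3 * (?g p)\<^sup>2 * ?f1 (vec3 p y))\<^sup>2 + (3 * (?g p)\<^sup>2 * ?f2 (vec3 p y))\<^sup>2
         = (3 * (?g p)\<^sup>2)\<^sup>2 * ((?f1 (vec3 p y))\<^sup>2 + (?f2 (vec3 p y))\<^sup>2)"
        by (simp add: power_mult_distrib algebra_simps)
      then have "sqrt ((3 * (?g p)\<^sup>2 * ?f1 (vec3 p y))\<^sup>2 + (3 * (?g p)\<^sup>2 * ?f2 (vec3 p y))\<^sup>2)
         = 3 * (?g p)\<^sup>2 * sqrt ((?f1 (vec3 p y))\<^sup>2 + (?f2 (vec3 p y))\<^sup>2)"
        by (simp only: real_sqrt_mult real_sqrt_abs) simp
      then show "ennreal (norm p powr (\<alpha> + 1 - 1) * sqrt ((3 * (?g p)\<^sup>2 * ?f1 (vec3 p y))\<^sup>2 + (3 * (?g p)\<^sup>2 * ?f2 (vec3 p y))\<^sup>2))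
         = ennreal (3 * (w (vec3 p y) * (?g p)\<^sup>2)) * ennreal (sqrt ((?f1 (vec3 p y))\<^sup>2 + (?f2 (vec3 p y))\<^sup>2))"
        by (subst ennreal_mult[symmetric]) (auto simp: w_vec3 mult_ac)
    qed
    also have "\<dots>\<^sup>2 \<le> (\<integral>\<^sup>+p. (ennreal (3 * (w (vec3 p y) * (?g p)\<^sup>2)))\<^sup>2 \<partial>lborel)
         * (\<integral>\<^sup>+p. (ennreal (sqrt ((?f1 (vec3 p y))\<^sup>2 + (?f2 (vec3 p y))\<^sup>2)))\<^sup>2 \<partial>lborel)"
      by (rule Cauchy_Schwarz_nn_integral) measurable
    also have "(\<integral>\<^sup>+p. (ennreal (sqrt ((?f1 (vec3 p y))\<^sup>2 + (?f2 (vec3 p y))\<^sup>2)))\<^sup>2 \<partial>lborel) = G y"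
      unfolding G_def by (simp add: ennreal_power)
    also have "(\<integral>\<^sup>+p. (ennreal (3 * (w (vec3 p y) * (?g p)\<^sup>2)))\<^sup>2 \<partial>lborel) = ennreal 9 * Q y"
      unfolding Q_def using w0
      by (subst nn_integral_cmult[symmetric], measurable, intro nn_integral_cong)
         (subst ennreal_mult[symmetric], auto simp: ennreal_power power_mult_distrib simp flip: power_mult)
    also have "ennreal ((\<alpha> + 1) / (8 * N)) * (ennreal 9 * Q y * G y) = ennreal k * (Q y * G y)"
    proof -
      have "ennreal ((\<alpha> + 1) / (8 * N)) * ennreal 9 = ennreal k"
        unfolding k_def using \<alpha> by (subst ennreal_mult[symmetric]) (auto simp: mult.commute)
      then show ?thesis by (simp only: mult.assoc[symmetric])
    qed
    finally show ?thesis by (simp add: mult_left_mono)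
  qed
  \<comment> \<open>The weight does not depend on the third coordinate, so it may be moved inside
    the integral over the line. The factor 2 in \<open>S\<close> is 4, from differentiating f^4,
    times 1/2 from integrating from both sides.\<close>
  have QS: "Q y \<le> S" for y
  proof -
    have "ennreal ((w (vec3 p y))\<^sup>2 * f (vec3 p y) ^ 4)
        \<le> (\<integral>\<^sup>+t. ennreal (2 * (w (vec3 p t) * \<bar>f (vec3 p t)\<bar> ^ 3)) * ennreal (w (vec3 p t) * \<bar>?f3 (vec3 p t)\<bar>) \<partial>lborel)" for p
    proof -
      have c: "continuous_on UNIV (\<lambda>t. g (vec3 p t))" if "continuous_on UNIV g" for g :: "real^3 \<Rightarrow> real"
        by (rule continuous_on_compose2[OF that]) (auto intro!: continuous_intros)
      have "((\<lambda>t. f (vec3 p t) ^ 4) has_real_derivative 4 * f (vec3 p t) ^ 3 * ?f3 (vec3 p t)) (at t)" for t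
        using deriv_line[OF differentiable(1), of p t]
        by (auto intro!: derivative_eq_intros)
      moreover have "f (vec3 p t) ^ 4 = 0" if "R \<le> \<bar>t\<bar>" for t
        using R(2)[of "vec3 p t"] norm_vec3_ge(2)[of t p] that by simp
      moreover have "continuous_on UNIV (\<lambda>t. 4 * f (vec3 p t) ^ 3 * ?f3 (vec3 p t))"
        by (intro continuous_intros c continuous)
      ultimately have "ennreal \<bar>f (vec3 p y) ^ 4\<bar> \<le> ennreal (1/2) * (\<integral>\<^sup>+t. ennreal \<bar>4 * f (vec3 p t) ^ 3 * ?f3 (vec3 p t)\<bar> \<partial>lborel)"
        by (intro abs_le_half_nn_integral_deriv[where h="\<lambda>t. f (vec3 p t) ^ 4" and R=R])
      then have "ennreal ((norm p powr \<alpha>)\<^sup>2) * ennreal \<bar>f (vec3 p y) ^ 4\<bar>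
          \<le> ennreal ((norm p powr \<alpha>)\<^sup>2) * (ennreal (1/2) * (\<integral>\<^sup>+t. ennreal \<bar>4 * f (vec3 p t) ^ 3 * ?f3 (vec3 p t)\<bar> \<partial>lborel))"
        by (rule mult_left_mono) simp
      also have "\<dots> = (\<integral>\<^sup>+t. ennreal ((norm p powr \<alpha>)\<^sup>2) * (ennreal (1/2) * ennreal \<bar>4 * f (vec3 p t) ^ 3 * ?f3 (vec3 p t)\<bar>) \<partial>lborel)"
        by (subst nn_integral_cmult, measurable, subst nn_integral_cmult, measurable)
      also have "\<dots> = (\<integral>\<^sup>+t. ennreal (2 * (w (vec3 p t) * \<bar>f (vec3 p t)\<bar> ^ 3)) * ennreal (w (vec3 p t) * \<bar>?f3 (vec3 p t)\<bar>) \<partial>lborel)"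
      proof (rule nn_integral_cong)
        fix t
        have "ennreal ((norm p powr \<alpha>)\<^sup>2) * (ennreal (1/2) * ennreal \<bar>4 * f (vec3 p t) ^ 3 * ?f3 (vec3 p t)\<bar>)
          = ennreal ((norm p powr \<alpha>)\<^sup>2 * (1/2 * \<bar>4 * f (vec3 p t) ^ 3 * ?f3 (vec3 p t)\<bar>))"
          by (subst ennreal_mult[symmetric], simp, simp, subst ennreal_mult[symmetric], auto)
        also have "\<dots> = ennreal (2 * (w (vec3 p t) * \<bar>f (vec3 p t)\<bar> ^ 3) * (w (vec3 p t) * \<bar>?f3 (vec3 p t)\<bar>))"
          by (simp add: w_vec3 abs_mult power_abs power2_eq_square mult_ac)
        also have "\<dots> = ennreal (2 * (w (vec3 p t) * \<bar>f (vec3 p t)\<bar> ^ 3)) * ennreal (w (vec3 p t) * \<bar>?f3 (vec3 p t)\<bar>)"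
          using w0 by (intro ennreal_mult) auto
        finally show "ennreal ((norm p powr \<alpha>)\<^sup>2) * (ennreal (1/2) * ennreal \<bar>4 * f (vec3 p t) ^ 3 * ?f3 (vec3 p t)\<bar>)
           = ennreal (2 * (w (vec3 p t) * \<bar>f (vec3 p t)\<bar> ^ 3)) * ennreal (w (vec3 p t) * \<bar>?f3 (vec3 p t)\<bar>)" .
      qed
      also have "ennreal ((norm p powr \<alpha>)\<^sup>2) * ennreal \<bar>f (vec3 p y) ^ 4\<bar> = ennreal ((w (vec3 p y))\<^sup>2 * f (vec3 p y) ^ 4)"
        by (subst ennreal_mult[symmetric]) (auto simp: w_vec3)
      finally show ?thesis .
    qed
    then have "Q y \<le> (\<integral>\<^sup>+p. \<integral>\<^sup>+t. ennreal (2 * (w (vec3 p t) * \<bar>f (vec3 p t)\<bar> ^ 3)) * ennreal (w (vec3 p t) * \<bar>?f3 (vec3 p t)\<bar>) \<partial>lborel \<partial>lborel)"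
      unfolding Q_def by (rule nn_integral_mono)
    also have "\<dots> = S" unfolding S_def by (rule nn_integral_vec3(2)[symmetric]) measurable
    finally show ?thesis .
  qed
  have SMB: "S\<^sup>2 \<le> ennreal 4 * M * B"
  proof -
    have "S\<^sup>2 \<le> (\<integral>\<^sup>+x. (ennreal (2 * (w x * \<bar>f x\<bar> ^ 3)))\<^sup>2 \<partial>lborel) * (\<integral>\<^sup>+x. (ennreal (w x * \<bar>?f3 x\<bar>))\<^sup>2 \<partial>lborel)"
      unfolding S_def by (rule Cauchy_Schwarz_nn_integral) measurable
    also have "(\<integral>\<^sup>+x. (ennreal (w x * \<bar>?f3 x\<bar>))\<^sup>2 \<partial>lborel) = B"
      unfolding B_def using w0 by (simp add: ennreal_power power_mult_distrib)
    also have "(\<integral>\<^sup>+x. (ennreal (2 * (w x * \<bar>f x\<bar> ^ 3)))\<^sup>2 \<partial>lborel) = ennreal 4 * M"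
    proof -
      have "(\<bar>f x\<bar> ^ 3)\<^sup>2 = f x ^ 6" for x by (simp add: power_even_abs flip: power_mult)
      then show ?thesis
        unfolding M_def using w0
        by (subst nn_integral_cmult[symmetric], measurable, intro nn_integral_cong)
         (subst ennreal_mult[symmetric], auto simp: ennreal_power power_mult_distrib)
    qed
    finally show ?thesis .
  qed
  have MSA: "M \<le> ennreal k * (S * A)"
  proof -
    have "M = (\<integral>\<^sup>+y. \<integral>\<^sup>+p. ennreal ((w (vec3 p y))\<^sup>2 * f (vec3 p y) ^ 6) \<partial>lborel \<partial>lborel)"
      unfolding M_def by (rule nn_integral_vec3(1)) measurable
    also have "\<dots> \<le> (\<integral>\<^sup>+y. ennreal k * (S * G y) \<partial>lborel)"
      by (intro nn_integral_mono order_trans[OF slice] mult_left_mono mult_right_mono QS) auto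
    also have "\<dots> = ennreal k * (S * A)"
    proof -
      have "A = (\<integral>\<^sup>+y. G y \<partial>lborel)"
        unfolding A_def G_def by (rule nn_integral_vec3(1)) measurable
      then show ?thesis by (simp add: nn_integral_cmult)
    qed
    finally show ?thesis .
  qed
  \<comment> \<open>Finiteness of \<open>M\<close> is what permits cancelling it from both
    sides.\<close>
  have fin: "M < \<infinity>" "A < \<infinity>" "B < \<infinity>"
  proof -
    show "M < \<infinity>" unfolding M_def
      by (rule nn_integral_compact_support[where r=R]) (auto intro!: continuous_intros cw continuous simp: R)
    show "A < \<infinity>" unfolding A_def
      by (rule nn_integral_compact_support[where r=R]) (auto intro!: continuous_intros continuous simp: pd_supp)
    show "B < \<infinity>" unfolding B_def
      by (rule nn_integral_compact_support[where r=R]) (auto intro!: continuous_intros cw continuous simp: pd_supp)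
  qed
  obtain a b c where abc: "M = ennreal c" "c \<ge> 0" "A = ennreal a" "a \<ge> 0" "B = ennreal b" "b \<ge> 0"
    using fin by (metis ennreal_cases infinity_ennreal_def less_irrefl)
  have "M\<^sup>2 \<le> (ennreal k * (S * A))\<^sup>2" using MSA by (rule power_mono) simp
  also have "\<dots> = (ennreal k)\<^sup>2 * A\<^sup>2 * S\<^sup>2" by (simp only: power_mult_distrib mult_ac)
  also have "\<dots> \<le> (ennreal k)\<^sup>2 * A\<^sup>2 * (ennreal 4 * M * B)" by (rule mult_left_mono[OF SMB]) simp
  also have "\<dots> = ennreal (k\<^sup>2 * a\<^sup>2 * (4 * c * b))"
    unfolding abc using k0 abc by (simp add: ennreal_power ennreal_mult)
  finally have "ennreal (c\<^sup>2) \<le> ennreal (k\<^sup>2 * a\<^sup>2 * (4 * c * b))" unfolding abc using abc by (simp add: ennreal_power)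
  then have "c\<^sup>2 \<le> k\<^sup>2 * a\<^sup>2 * (4 * c * b)" using abc by (subst (asm) ennreal_le_iff) auto
  then have "c * c \<le> c * (4 * k\<^sup>2 * (a\<^sup>2 * b))" by (simp add: power2_eq_square mult_ac)
  then have "c \<le> 4 * k\<^sup>2 * (a\<^sup>2 * b)"
    using abc by (cases "c = 0") auto
  also have "\<dots> \<le> 4 * k\<^sup>2 * (4 / 27 * (a + b) ^ 3)"
    using power2_mult_le_cube[OF abc(4,6)] by (intro mult_left_mono) auto
  finally have c: "c \<le> 16 / 27 * k\<^sup>2 * (a + b) ^ 3" by simp
  have "(\<integral>\<^sup>+x. ennreal ((norm (gradG \<alpha> f x))\<^sup>2) \<partial>lborel) = A + B"
    unfolding A_def B_def norm_gradG w_def[symmetric]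
    by (subst nn_integral_add[symmetric]) (auto simp: ennreal_plus[symmetric] simp del: ennreal_plus)
  also have "\<dots> = ennreal (a + b)" unfolding abc using abc by simp
  finally have E: "(\<integral>\<^sup>+x. ennreal ((norm (gradG \<alpha> f x))\<^sup>2) \<partial>lborel) = ennreal (a + b)" .
  have "(\<integral>\<^sup>+x. ennreal (xnorm x powr (2 * \<alpha>) * \<bar>f x\<bar> powr 6) \<partial>lborel) = ennreal c"
    unfolding w2 abc(1)[symmetric] M_def by (simp add: power_even_abs)
  also have "\<dots> \<le> ennreal (16 / 27 * k\<^sup>2 * (a + b) ^ 3)" using c by (rule ennreal_leI)
  also have "\<dots> = ennreal (16 / 27 * k\<^sup>2) * ennreal (a + b) ^ 3"
  proof -
    have "ennreal (a + b) ^ 3 = ennreal ((a + b) ^ 3)" using abc by (intro ennreal_power) auto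
    then show ?thesis using abc by (simp only:) (intro ennreal_mult, auto)
  qed
  finally show ?thesis unfolding E .
qed

end

section \<open>Passage to the completion\<close>

lemma deriv_axis_line:
  assumes "f differentiable (at (x + t *\<^sub>R axis i 1))"
  shows "((\<lambda>s. f (x + s *\<^sub>R axis i 1)) has_real_derivative pd f i (x + t *\<^sub>R axis i 1)) (at t)"
proof -
  let ?D = "frechet_derivative f (at (x + t *\<^sub>R axis i 1))"
  have "((\<lambda>s. x + s *\<^sub>R axis i (1::real)) has_derivative (\<lambda>h. h *\<^sub>R axis i 1)) (at t)"
    by (auto intro!: derivative_eq_intros)
  moreover have "(f has_derivative ?D) (at (x + t *\<^sub>R axis i 1))"
    using assms by (simp add: frechet_derivative_works)
  ultimately have "(f \<circ> (\<lambda>s. x + s *\<^sub>R axis i 1) has_derivative ?D \<circ> (\<lambda>h. h *\<^sub>R axis i 1)) (at t)"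
    by (rule diff_chain_at)
  moreover have "?D (h *\<^sub>R axis i 1) = h *\<^sub>R ?D (axis i 1)" for h
    using linear_frechet_derivative[OF assms] by (rule linear_scale)
  ultimately show ?thesis
    by (simp add: o_def has_field_derivative_def pd_def mult.commute[of _ "?D _"])
qed

lemma bounded_compact_support:
  fixes g :: "real^3 \<Rightarrow> real"
  assumes "continuous_on UNIV g" "\<And>x. norm x > r \<Longrightarrow> g x = 0"
  obtains K where "K \<ge> 0" "\<And>x. \<bar>g x\<bar> \<le> K"
proof -
  have "compact (g ` cball 0 r)"
    by (intro compact_continuous_image continuous_on_subset[OF assms(1)]) auto
  then obtain B where B: "\<forall>y\<in>g ` cball 0 r. norm y \<le> B"
    by (meson bounded_iff compact_imp_bounded)
  have "\<bar>g x\<bar> \<le> max B 0" for x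
    using B assms(2)[of x] by (cases "norm x \<le> r") (auto simp: le_max_iff_disj)
  then show ?thesis by (intro that[of "max B 0"]) auto
qed

lemma integral_translation_eq:
  fixes g :: "real^3 \<Rightarrow> real"
  assumes "g \<in> borel_measurable borel"
  shows "(\<integral>x. g (a + x) \<partial>lborel) = (\<integral>x. g x \<partial>lborel)"
proof -
  have "(\<integral>x. g x \<partial>lborel) = (\<integral>x. g x \<partial>distr lborel borel ((+) a))" by (simp add: lborel_distr_plus)
  also have "\<dots> = (\<integral>x. g (a + x) \<partial>lborel)" using assms by (subst integral_distr) auto
  finally show ?thesis by simp
qed

text \<open>The factor \<open>c\<close> is only continuous, so nothing may be differentiated but
  \<open>F\<close>. Since \<open>c\<close> is constant along \<open>e\<close>, translation
  invariance makes the integral of every difference quotient vanish, and dominated convergence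
  passes to the derivative.\<close>

lemma integral_axis_derivative_eq_0:
  fixes F DF c :: "real^3 \<Rightarrow> real" and i :: 3
  defines "e \<equiv> axis i 1"
  assumes d: "\<And>x t. ((\<lambda>s. F (x + s *\<^sub>R e)) has_real_derivative DF (x + t *\<^sub>R e)) (at t)"
    and cF: "continuous_on UNIV F" and cDF: "continuous_on UNIV DF" and cc: "continuous_on UNIV c"
    and z: "\<And>x. norm x > r \<Longrightarrow> F x = 0" "\<And>x. norm x > r \<Longrightarrow> DF x = 0"
    and inv: "\<And>x t. c (x + t *\<^sub>R e) = c x"
  shows "(\<integral>x. c x * DF x \<partial>lborel) = 0"
proof -
  obtain K where K: "K \<ge> 0" "\<And>x. \<bar>DF x\<bar> \<le> K" using bounded_compact_support[OF cDF z(2)] by blast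
  have meas[measurable]: "F \<in> borel_measurable borel" "DF \<in> borel_measurable borel" "c \<in> borel_measurable borel"
    using cF cDF cc by (auto intro: borel_measurable_continuous_onI)
  have ne: "norm e = 1" unfolding e_def by simp
  define t where "t n = inverse (real (Suc n))" for n
  have t: "t n > 0" "t n \<le> 1" for n unfolding t_def by (auto simp: field_simps)
  define s where "s n x = c x * ((F (x + t n *\<^sub>R e) - F x) / t n)" for n x
  \<comment> \<open>By the mean value theorem the quotients are bounded by \<open>K\<close>; steps
    of length at most 1 enlarge the support by at most 1.\<close>
  define W where "W x = K * (indicator (cball 0 (r + 1)) x *\<^sub>R \<bar>c x\<bar>)" for x
  have intF: "integrable lborel (\<lambda>x. c x * F x)"
    by (rule integrable_compact_support[where r=r]) (auto intro!: continuous_intros cc cF simp: z)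
  have "(\<lambda>n. \<integral>x. s n x \<partial>lborel) \<longlonglongrightarrow> (\<integral>x. c x * DF x \<partial>lborel)"
  proof (rule integral_dominated_convergence)
    show "integrable lborel W" unfolding W_def
      by (intro integrable_mult_right borel_integrable_compact) (auto intro!: continuous_intros continuous_on_subset[OF cc])
    show "AE x in lborel. (\<lambda>n. s n x) \<longlonglongrightarrow> c x * DF x"
    proof (rule AE_I2)
      fix x
      have "((\<lambda>h. (F (x + h *\<^sub>R e) - F x) / h) \<longlongrightarrow> DF x) (at 0)"
        using d[of x 0] by (simp add: DERIV_def)
      moreover have "filterlim t (at 0) sequentially"
        unfolding filterlim_at t_def using LIMSEQ_inverse_real_of_nat by (auto simp: eventually_sequentially)
      ultimately have "(\<lambda>n. (F (x + t n *\<^sub>R e) - F x) / t n) \<longlonglongrightarrow> DF x"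
        by (rule filterlim_compose)
      then show "(\<lambda>n. s n x) \<longlonglongrightarrow> c x * DF x" unfolding s_def by (rule tendsto_mult_left)
    qed
    show "AE x in lborel. norm (s n x) \<le> W x" for n
    proof (rule AE_I2)
      fix x
      show "norm (s n x) \<le> W x"
      proof (cases "norm x \<le> r + 1")
        case True
        obtain \<xi> where "F (x + t n *\<^sub>R e) - F (x + 0 *\<^sub>R e) = (t n - 0) * DF (x + \<xi> *\<^sub>R e)"
          using MVT2[of 0 "t n" "\<lambda>s. F (x + s *\<^sub>R e)" "\<lambda>s. DF (x + s *\<^sub>R e)"] t(1)[of n] d by metis
        then have "(F (x + t n *\<^sub>R e) - F x) / t n = DF (x + \<xi> *\<^sub>R e)" using t(1)[of n] by simp
        then have "\<bar>(F (x + t n *\<^sub>R e) - F x) / t n\<bar> \<le> K" using K by simp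
        then have "\<bar>c x\<bar> * \<bar>(F (x + t n *\<^sub>R e) - F x) / t n\<bar> \<le> \<bar>c x\<bar> * K" by (rule mult_left_mono) simp
        then show ?thesis using True unfolding s_def W_def by (simp add: abs_mult mult.commute)
      next
        case False
        have "norm x \<le> norm (x + t n *\<^sub>R e) + norm (t n *\<^sub>R e)"
          using norm_triangle_ineq4[of "x + t n *\<^sub>R e" "t n *\<^sub>R e"] by simp
        then have "norm (x + t n *\<^sub>R e) > r" using False t[of n] ne by simp
        moreover have "norm x > r" using False by simp
        ultimately show ?thesis using K(1) unfolding s_def W_def by (simp add: z)
      qed
    qed
  qed (unfold s_def, measurable)
  moreover have "(\<integral>x. s n x \<partial>lborel) = 0" for n
  proof -
    have s: "s n x = (c (t n *\<^sub>R e + x) * F (t n *\<^sub>R e + x) - c x * F x) / t n" for x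
      using inv[of x "t n"] unfolding s_def by (simp add: add.commute right_diff_distrib)
    have "integrable lborel (\<lambda>x. c (t n *\<^sub>R e + x) * F (t n *\<^sub>R e + x))"
    proof (rule integrable_compact_support[where r="r + 1"])
      fix x :: "real^3" assume x: "norm x > r + 1"
      have "norm x \<le> norm (t n *\<^sub>R e + x) + norm (t n *\<^sub>R e)"
        using norm_triangle_ineq4[of "t n *\<^sub>R e + x" "t n *\<^sub>R e"] by simp
      then have "norm (t n *\<^sub>R e + x) > r" using x t[of n] ne by simp
      then show "c (t n *\<^sub>R e + x) * F (t n *\<^sub>R e + x) = 0" by (simp add: z)
    qed (intro continuous_intros continuous_on_compose2[OF cc] continuous_on_compose2[OF cF], auto)
    then show ?thesis unfolding s
      using intF integral_translation_eq[of "\<lambda>x. c x * F x" "t n *\<^sub>R e"] by simp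
  qed
  ultimately show ?thesis by (simp add: LIMSEQ_const_iff)
qed

lemma integration_by_parts_test:
  assumes g: "test_fun g" and h: "test_fun h" and cc: "continuous_on UNIV c"
    and inv: "\<And>x t. c (x + t *\<^sub>R axis i 1) = c x"
  shows "(\<integral>x. c x * (pd g i x * pd h i x) \<partial>lborel) = - (\<integral>x. c x * (g x * pd (pd h i) i x) \<partial>lborel)"
proof -
  interpret g: test_fun g by fact
  interpret h: test_fun h by fact
  have "(\<integral>x. c x * (pd g i x * pd h i x + g x * pd (pd h i) i x) \<partial>lborel) = 0"
  proof (rule integral_axis_derivative_eq_0[where i=i and F="\<lambda>x. g x * pd h i x" and r="g.R"])
    show "((\<lambda>s. g (x + s *\<^sub>R axis i 1) * pd h i (x + s *\<^sub>R axis i 1)) has_real_derivative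
        pd g i (x + t *\<^sub>R axis i 1) * pd h i (x + t *\<^sub>R axis i 1) + g (x + t *\<^sub>R axis i 1) * pd (pd h i) i (x + t *\<^sub>R axis i 1)) (at t)" for x t
      by (auto intro!: derivative_eq_intros deriv_axis_line g.differentiable h.differentiable)
  qed (auto intro!: continuous_intros g.continuous h.continuous cc inv simp: g.R g.pd_supp)
  moreover have "integrable lborel (\<lambda>x. c x * (pd g i x * pd h i x))"
    by (rule integrable_compact_support[where r=g.R])
       (auto intro!: continuous_intros g.continuous h.continuous cc simp: g.pd_supp)
  moreover have "integrable lborel (\<lambda>x. c x * (g x * pd (pd h i) i x))"
    by (rule integrable_compact_support[where r=g.R])
       (auto intro!: continuous_intros g.continuous h.continuous cc simp: g.R)
  ultimately show ?thesis by (simp add: distrib_left)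
qed

text \<open>\<open>nn_energy\<close> and \<open>nn_L6\<close> take values in [0, \<infinity>], so
  they record divergence, which \<open>grad_energy\<close> and \<open>weighted_Lq\<close> would
  report as 0. The real versions return once finiteness is known.\<close>

definition nn_energy :: "(real^3 \<Rightarrow> real^3) \<Rightarrow> ennreal" where
  "nn_energy V = (\<integral>\<^sup>+x. ennreal ((norm (V x))\<^sup>2) \<partial>lborel)"

definition nn_L6 :: "real \<Rightarrow> (real^3 \<Rightarrow> real) \<Rightarrow> ennreal" where
  "nn_L6 \<alpha> u = (\<integral>\<^sup>+x. ennreal (xnorm x powr (2 * \<alpha>) * \<bar>u x\<bar> powr 6) \<partial>lborel)"

text \<open>Convexity of the even power at a + b = (1-t) a/(1-t) + t b/t. It serves as a substitute
  for Minkowski's inequality: for small t the coefficient of the main term is close to 1, and the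
  large one multiplies only an error.\<close>

lemma add_power_even_le:
  fixes a b t :: real
  assumes "0 < t" "t < 1" "odd n"
  shows "(a + b) ^ Suc n \<le> 1 / (1 - t) ^ n * a ^ Suc n + 1 / t ^ n * b ^ Suc n"
proof -
  have e: "s * (x / s) ^ Suc n = 1 / s ^ n * x ^ Suc n" if "s > 0" for s x :: real
    using that by (simp add: power_divide)
  have "convex_on UNIV (\<lambda>x::real. x ^ Suc n)" using assms(3) by (intro convex_power_even) auto
  from convex_onD[OF this, of t "a / (1 - t)" "b / t"] assms
  have "(a + b) ^ Suc n \<le> (1 - t) * (a / (1 - t)) ^ Suc n + t * (b / t) ^ Suc n" by simp
  then show ?thesis using assms by (simp only: e)
qed

lemma add_power6_le: "0 < t \<Longrightarrow> t < 1 \<Longrightarrow> (a + b) ^ 6 \<le> 1 / (1 - t) ^ 5 * a ^ 6 + 1 / t ^ 5 * (b :: real) ^ 6"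
  using add_power_even_le[of t 5 a b] by simp

lemma add_power2_le: "0 < t \<Longrightarrow> t < 1 \<Longrightarrow> (a + b)\<^sup>2 \<le> 1 / (1 - t) * a\<^sup>2 + 1 / t * (b :: real)\<^sup>2"
  using add_power_even_le[of t 1 a b] by (simp add: power2_eq_square)

lemma nn_integral_le_linear:
  fixes f g h :: "'a \<Rightarrow> real"
  assumes [measurable]: "g \<in> borel_measurable M" "h \<in> borel_measurable M"
    and le: "\<And>x. f x \<le> a * g x + b * h x" and ab: "a \<ge> 0" "b \<ge> 0" and nn: "\<And>x. g x \<ge> 0" "\<And>x. h x \<ge> 0"
  shows "(\<integral>\<^sup>+x. ennreal (f x) \<partial>M) \<le> ennreal a * (\<integral>\<^sup>+x. ennreal (g x) \<partial>M) + ennreal b * (\<integral>\<^sup>+x. ennreal (h x) \<partial>M)"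
proof -
  have "(\<integral>\<^sup>+x. ennreal (f x) \<partial>M) \<le> (\<integral>\<^sup>+x. ennreal a * ennreal (g x) + ennreal b * ennreal (h x) \<partial>M)"
  proof (rule nn_integral_mono)
    fix x
    have "ennreal (f x) \<le> ennreal (a * g x + b * h x)" by (rule ennreal_leI[OF le])
    also have "\<dots> = ennreal a * ennreal (g x) + ennreal b * ennreal (h x)"
      using ab nn by (simp add: ennreal_mult)
    finally show "ennreal (f x) \<le> ennreal a * ennreal (g x) + ennreal b * ennreal (h x)" .
  qed
  also have "\<dots> = ennreal a * (\<integral>\<^sup>+x. ennreal (g x) \<partial>M) + ennreal b * (\<integral>\<^sup>+x. ennreal (h x) \<partial>M)"
    by (simp add: nn_integral_add nn_integral_cmult)
  finally show ?thesis .
qed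

lemma gradG_vec3: "gradG \<alpha> f x = vec3 (pd f 1 x, pd f 2 x) (xnorm x powr \<alpha> * pd f 3 x)"
  by (simp add: vec_eq_iff forall_3 gradG_def)

context test_fun
begin

lemma measurable_gradG [measurable]: "gradG \<alpha> f \<in> borel_measurable borel"
  unfolding gradG_vec3[abs_def] by measurable

lemma nn_energy_finite:
  assumes "\<alpha> > 0"
  shows "nn_energy (gradG \<alpha> f) < \<infinity>"
  unfolding nn_energy_def norm_gradG
  by (rule nn_integral_compact_support[where r=R])
     (auto intro!: continuous_intros continuous continuous_weight assms simp: pd_supp)

lemma nn_L6_finite:
  assumes "\<alpha> > 0"
  shows "nn_L6 \<alpha> f < \<infinity>"
  unfolding nn_L6_def powr_numeral[OF abs_ge_zero]
  by (rule nn_integral_compact_support[where r=R])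
     (auto intro!: continuous_intros continuous continuous_weight assms simp: R)

end

lemma W0_D:
  assumes "(u, V) \<in> W0 \<alpha> 6"
  obtains \<phi> where "u \<in> borel_measurable borel" "V \<in> borel_measurable borel" "\<And>k. test_fun (\<phi> k)"
    "(\<lambda>k. nn_energy (\<lambda>x. gradG \<alpha> (\<phi> k) x - V x)) \<longlonglongrightarrow> 0"
    "(\<lambda>k. nn_L6 \<alpha> (\<lambda>x. \<phi> k x - u x)) \<longlonglongrightarrow> 0"
  using assms that unfolding W0_def nn_energy_def nn_L6_def test_fun_def by auto

lemma energy_perturb:
  assumes [measurable]: "V \<in> borel_measurable borel" "W \<in> borel_measurable borel" and t: "0 < t" "t < 1"
  shows "nn_energy V \<le> ennreal (1 / (1 - t)) * nn_energy W + ennreal (1 / t) * nn_energy (\<lambda>x. W x - V x)"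
  unfolding nn_energy_def
proof (rule nn_integral_le_linear)
  fix x
  have "norm (V x) \<le> norm (W x) + norm (W x - V x)" using norm_triangle_sub[of "V x" "W x"] by (simp add: norm_minus_commute)
  then have "(norm (V x))\<^sup>2 \<le> (norm (W x) + norm (W x - V x))\<^sup>2" by (rule power_mono) simp
  also have "\<dots> \<le> 1 / (1 - t) * (norm (W x))\<^sup>2 + 1 / t * (norm (W x - V x))\<^sup>2" by (rule add_power2_le[OF t])
  finally show "(norm (V x))\<^sup>2 \<le> 1 / (1 - t) * (norm (W x))\<^sup>2 + 1 / t * (norm (W x - V x))\<^sup>2" .
qed (use t in auto)

lemma L6_perturb:
  assumes [measurable]: "u \<in> borel_measurable borel" "v \<in> borel_measurable borel" and t: "0 < t" "t < 1"
  shows "nn_L6 \<alpha> u \<le> ennreal (1 / (1 - t) ^ 5) * nn_L6 \<alpha> v + ennreal (1 / t ^ 5) * nn_L6 \<alpha> (\<lambda>x. v x - u x)"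
  unfolding nn_L6_def
proof (rule nn_integral_le_linear)
  fix x
  have "u x ^ 6 = (v x + (u x - v x)) ^ 6" by simp
  also have "\<dots> \<le> 1 / (1 - t) ^ 5 * v x ^ 6 + 1 / t ^ 5 * (u x - v x) ^ 6" by (rule add_power6_le[OF t])
  also have "(u x - v x) ^ 6 = (v x - u x) ^ 6" using power_minus_even[of 6 "v x - u x"] by simp
  finally have "xnorm x powr (2 * \<alpha>) * u x ^ 6 \<le> xnorm x powr (2 * \<alpha>) * (1 / (1 - t) ^ 5 * v x ^ 6 + 1 / t ^ 5 * (v x - u x) ^ 6)"
    by (rule mult_left_mono) simp
  then show "xnorm x powr (2 * \<alpha>) * \<bar>u x\<bar> powr 6 \<le> 1 / (1 - t) ^ 5 * (xnorm x powr (2 * \<alpha>) * \<bar>v x\<bar> powr 6)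
      + 1 / t ^ 5 * (xnorm x powr (2 * \<alpha>) * \<bar>v x - u x\<bar> powr 6)"
    by (simp add: power_even_abs distrib_left mult.left_commute mult.commute)
qed (use t in auto)

text \<open>Perturbation with t = 1/2 gives finiteness, and letting t tend to 0 carries the
  inequality over with the same constant K.\<close>

lemma W0_sobolev:
  assumes \<alpha>: "\<alpha> > 0" and W: "(u, V) \<in> W0 \<alpha> 6" and K: "K \<ge> 0"
    and sob: "\<And>\<phi>. test_fun \<phi> \<Longrightarrow> nn_L6 \<alpha> \<phi> \<le> ennreal K * nn_energy (gradG \<alpha> \<phi>) ^ 3"
  shows "nn_energy V < \<infinity>" "nn_L6 \<alpha> u < \<infinity>" "nn_L6 \<alpha> u \<le> ennreal K * nn_energy V ^ 3"
proof -
  obtain \<phi> where [measurable]: "u \<in> borel_measurable borel" "V \<in> borel_measurable borel" and \<phi>: "\<And>k. test_fun (\<phi> k)"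
    and lim: "(\<lambda>k. nn_energy (\<lambda>x. gradG \<alpha> (\<phi> k) x - V x)) \<longlonglongrightarrow> 0"
    "(\<lambda>k. nn_L6 \<alpha> (\<lambda>x. \<phi> k x - u x)) \<longlonglongrightarrow> 0"
    using W0_D[OF W] by blast
  have [measurable]: "\<phi> k \<in> borel_measurable borel" "gradG \<alpha> (\<phi> k) \<in> borel_measurable borel" for k
    using test_fun.measurable_test(1)[OF \<phi>] test_fun.measurable_gradG[OF \<phi>] by auto
  have close: "\<exists>k. nn_energy (\<lambda>x. gradG \<alpha> (\<phi> k) x - V x) < ennreal d \<and> nn_L6 \<alpha> (\<lambda>x. \<phi> k x - u x) < ennreal d"
    if "d > 0" for d
    using eventually_conj[OF order_tendstoD(2)[OF lim(1), of "ennreal d"] order_tendstoD(2)[OF lim(2), of "ennreal d"]] that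
    by (auto simp: eventually_sequentially)
  obtain k where k: "nn_energy (\<lambda>x. gradG \<alpha> (\<phi> k) x - V x) < ennreal 1" "nn_L6 \<alpha> (\<lambda>x. \<phi> k x - u x) < ennreal 1"
    using close[of 1] by auto
  have "nn_energy V \<le> ennreal (1 / (1 - 1/2)) * nn_energy (gradG \<alpha> (\<phi> k)) + ennreal (1 / (1/2)) * nn_energy (\<lambda>x. gradG \<alpha> (\<phi> k) x - V x)"
    by (rule energy_perturb) auto
  also have "\<dots> < \<infinity>" using less_trans[OF k(1) ennreal_less_top] test_fun.nn_energy_finite[OF \<phi> \<alpha>, of k]
    by (simp add: ennreal_mult_eq_top_iff less_top[symmetric])
  finally show En: "nn_energy V < \<infinity>" .
  have "nn_L6 \<alpha> u \<le> ennreal (1 / (1 - 1/2) ^ 5) * nn_L6 \<alpha> (\<phi> k) + ennreal (1 / (1/2) ^ 5) * nn_L6 \<alpha> (\<lambda>x. \<phi> k x - u x)"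
    by (rule L6_perturb) auto
  also have "\<dots> < \<infinity>" using less_trans[OF k(2) ennreal_less_top] test_fun.nn_L6_finite[OF \<phi> \<alpha>, of k]
    by (simp add: ennreal_mult_eq_top_iff less_top[symmetric])
  finally show Mn: "nn_L6 \<alpha> u < \<infinity>" .
  obtain v where v: "nn_energy V = ennreal v" "v \<ge> 0" using En by (cases "nn_energy V") auto
  obtain \<mu> where \<mu>: "nn_L6 \<alpha> u = ennreal \<mu>" "\<mu> \<ge> 0" using Mn by (cases "nn_L6 \<alpha> u") auto
  have bd: "\<mu> \<le> 1 / (1 - t) ^ 5 * (K * (1 / (1 - t) * v + t ^ 5) ^ 3) + t" if t: "0 < t" "t < 1" for t
  proof -
    \<comment> \<open>Accuracy t^6 beats the coefficients 1/t and 1/t^5 of the error terms, leaving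
      t^5 and t, both of which vanish in the limit.\<close>
    obtain k where k: "nn_energy (\<lambda>x. gradG \<alpha> (\<phi> k) x - V x) < ennreal (t ^ 6)" "nn_L6 \<alpha> (\<lambda>x. \<phi> k x - u x) < ennreal (t ^ 6)"
      using close[of "t ^ 6"] t by auto
    have sym: "nn_energy (\<lambda>x. V x - gradG \<alpha> (\<phi> k) x) = nn_energy (\<lambda>x. gradG \<alpha> (\<phi> k) x - V x)"
      unfolding nn_energy_def by (simp add: norm_minus_commute)
    have "nn_energy (gradG \<alpha> (\<phi> k)) \<le> ennreal (1 / (1 - t)) * nn_energy V + ennreal (1 / t) * nn_energy (\<lambda>x. V x - gradG \<alpha> (\<phi> k) x)"
      by (rule energy_perturb[OF _ _ t]) measurable
    also have "\<dots> \<le> ennreal (1 / (1 - t)) * ennreal v + ennreal (1 / t) * ennreal (t ^ 6)"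
      using k(1) v unfolding sym by (intro add_mono mult_left_mono) auto
    also have "\<dots> = ennreal (1 / (1 - t) * v + t ^ 5)"
    proof -
      have "1 / t * t ^ 6 = t ^ 5" using t by (simp add: eval_nat_numeral)
      then show ?thesis using t v by (simp add: ennreal_mult[symmetric] ennreal_plus[symmetric] del: ennreal_plus)
    qed
    finally have E: "nn_energy (gradG \<alpha> (\<phi> k)) \<le> ennreal (1 / (1 - t) * v + t ^ 5)" .
    have "ennreal \<mu> \<le> ennreal (1 / (1 - t) ^ 5) * nn_L6 \<alpha> (\<phi> k) + ennreal (1 / t ^ 5) * nn_L6 \<alpha> (\<lambda>x. \<phi> k x - u x)"
      unfolding \<mu>(1)[symmetric] by (rule L6_perturb[OF _ _ t]) auto
    also have "\<dots> \<le> ennreal (1 / (1 - t) ^ 5) * (ennreal K * ennreal (1 / (1 - t) * v + t ^ 5) ^ 3) + ennreal (1 / t ^ 5) * ennreal (t ^ 6)"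
      using k(2) by (intro add_mono mult_left_mono order_trans[OF sob[OF \<phi>]] power_mono E) auto
    also have "\<dots> = ennreal (1 / (1 - t) ^ 5 * (K * (1 / (1 - t) * v + t ^ 5) ^ 3) + t)"
    proof -
      have "1 / t ^ 5 * t ^ 6 = t" using t by (simp add: eval_nat_numeral)
      moreover have "ennreal (1 / (1 - t) * v + t ^ 5) ^ 3 = ennreal ((1 / (1 - t) * v + t ^ 5) ^ 3)"
        using t v by (intro ennreal_power) auto
      moreover have "0 \<le> (1 / (1 - t) * v + t ^ 5) ^ 3" using t v by simp
      ultimately show ?thesis using t K
        by (simp only:) (simp add: ennreal_mult[symmetric] ennreal_plus[symmetric] del: ennreal_plus)
    qed
    finally show ?thesis using t v K by (subst (asm) ennreal_le_iff) auto
  qed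
  have "((\<lambda>t. 1 / (1 - t) ^ 5 * (K * (1 / (1 - t) * v + t ^ 5) ^ 3) + t) \<longlongrightarrow> 1 / (1 - 0) ^ 5 * (K * (1 / (1 - 0) * v + 0 ^ 5) ^ 3) + 0) (at_right 0)"
    by (intro tendsto_intros) auto
  moreover have "eventually (\<lambda>t::real. t \<in> {0<..<1}) (at_right 0)" by (rule eventually_at_right_real) simp
  then have "eventually (\<lambda>t. \<mu> \<le> 1 / (1 - t) ^ 5 * (K * (1 / (1 - t) * v + t ^ 5) ^ 3) + t) (at_right 0)"
    by (rule eventually_mono) (rule bd, auto)
  ultimately have "\<mu> \<le> 1 / (1 - 0) ^ 5 * (K * (1 / (1 - 0) * v + 0 ^ 5) ^ 3) + 0"
    by (intro tendsto_lowerbound) auto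
  then have "\<mu> \<le> K * v ^ 3" by simp
  then have "ennreal \<mu> \<le> ennreal K * ennreal v ^ 3"
    using v K by (simp add: ennreal_power ennreal_mult[symmetric])
  then show "nn_L6 \<alpha> u \<le> ennreal K * nn_energy V ^ 3" unfolding v \<mu> .
qed

text \<open>Integration by parts against a fixed \<phi>_l moves the derivative off \<phi>_k, which
  tends to 0 in the weighted space; so the mixed terms \<open>J k l\<close> vanish as k grows, and
  the Cauchy property makes the diagonal terms small too. The multiplier \<open>c\<close> reconciles
  two demands on b = c a^2: constancy along axis i, so that no derivative falls on it, and
  domination by the weight, which degenerates at |x| = 0. As \<open>c\<close> vanishes on a null set
  only, nothing is lost at the end.\<close>

lemma gradient_component_eq_0:
  fixes a b c :: "real^3 \<Rightarrow> real" and i :: 3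
  assumes \<alpha>: "\<alpha> > 0" and \<phi>: "\<And>k. test_fun (\<phi> k)" and V[measurable]: "V \<in> borel_measurable borel"
    and lim: "(\<lambda>k. nn_energy (\<lambda>x. gradG \<alpha> (\<phi> k) x - V x)) \<longlonglongrightarrow> 0"
      "(\<lambda>k. nn_L6 \<alpha> (\<phi> k)) \<longlonglongrightarrow> 0"
    and gi: "\<And>g x. gradG \<alpha> g x $ i = a x * pd g i x"
    and b: "\<And>x. b x = c x * (a x)\<^sup>2" and ca: "continuous_on UNIV a" and cb: "continuous_on UNIV b"
    and inv: "\<And>x t. b (x + t *\<^sub>R axis i 1) = b x"
    and bw: "\<And>x. b x \<le> xnorm x powr (2 * \<alpha>)" and c: "\<And>x. 0 \<le> c x" "\<And>x. c x \<le> 1"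
    and mc[measurable]: "c \<in> borel_measurable borel" and c0: "AE x in lborel. c x \<noteq> 0"
  shows "AE x in lborel. V x $ i = 0"
proof -
  define p where "p k = pd (\<phi> k) i" for k
  define q where "q k = pd (pd (\<phi> k) i) i" for k
  have cont: "continuous_on UNIV (\<phi> k)" "continuous_on UNIV (p k)" "continuous_on UNIV (q k)" for k
    unfolding p_def q_def using test_fun.continuous[OF \<phi>] by auto
  have supp: "norm x > test_fun.R (\<phi> k) \<Longrightarrow> p k x = 0" "norm x > test_fun.R (\<phi> k) \<Longrightarrow> q k x = 0" for k x
    unfolding p_def q_def using test_fun.pd_supp[OF \<phi>] by auto
  have [measurable]: "\<phi> k \<in> borel_measurable borel" "p k \<in> borel_measurable borel" "q k \<in> borel_measurable borel"
    "a \<in> borel_measurable borel" "b \<in> borel_measurable borel" "gradG \<alpha> (\<phi> k) \<in> borel_measurable borel" for k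
    using cont ca cb test_fun.measurable_gradG[OF \<phi>] by (auto intro: borel_measurable_continuous_onI)
  have b0: "b x \<ge> 0" for x using c b by simp
  have "continuous_on UNIV (\<lambda>v :: real^3. v $ i)" by (intro continuous_intros)
  then have Vi[measurable]: "(\<lambda>x. V x $ i) \<in> borel_measurable borel"
    using measurable_compose[OF V borel_measurable_continuous_onI] by blast
  define J where "J k l = (\<integral>x. b x * (p k x * p l x) \<partial>lborel)" for k l
  \<comment> \<open>A sixth-power bound has to control a first power on the support of \<phi>_l. For
    any e > 0, |s| \<le> e + s^6 / e^5 does so; first \<open>e\<close> is chosen to make the
    constant part at most d/2, then k is taken large enough that the sixth-power part is
    too.\<close>
  have J_small: "eventually (\<lambda>k. \<bar>J k l\<bar> \<le> d) sequentially" if d: "d > 0" for l d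
  proof -
    obtain K where K: "K \<ge> 0" "\<And>x. \<bar>q l x\<bar> \<le> K" using bounded_compact_support[OF cont(3) supp(2)] by blast
    let ?C = "cball 0 (test_fun.R (\<phi> l)) :: (real^3) set"
    define g where "g x = indicator ?C x * xnorm x powr (2 * \<alpha>)" for x
    have g_int: "integrable lborel g"
    proof -
      have "integrable lborel (\<lambda>x. indicator ?C x *\<^sub>R xnorm x powr (2 * \<alpha>))"
        using \<alpha> by (intro borel_integrable_compact) (auto intro: continuous_weight)
      then show ?thesis unfolding g_def[abs_def] by simp
    qed
    have g0: "g x \<ge> 0" for x by (simp add: g_def)
    define I where "I = (\<integral>x. g x \<partial>lborel)"
    have I0: "I \<ge> 0" unfolding I_def g_def by (intro integral_nonneg_AE) auto
    have I: "(\<integral>\<^sup>+x. ennreal (g x) \<partial>lborel) = ennreal I"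
      unfolding I_def by (rule nn_integral_eq_integral[OF g_int]) (simp add: g_def)
    define e where "e = d / (2 * (K * I + 1))"
    have KI: "K * I \<ge> 0" using K I0 by simp
    then have e: "e > 0" unfolding e_def using d by simp
    have KeI: "K * e * I \<le> d / 2"
    proof -
      have "K * e * I = d / 2 * (K * I / (K * I + 1))" unfolding e_def using KI by (simp add: field_simps)
      also have "\<dots> \<le> d / 2 * 1" using d KI by (intro mult_left_mono) auto
      finally show ?thesis by simp
    qed
    have bound: "ennreal \<bar>J k l\<bar> \<le> ennreal (K * e) * ennreal I + ennreal (K / e ^ 5) * nn_L6 \<alpha> (\<phi> k)" for k
    proof -
      have "J k l = - (\<integral>x. b x * (\<phi> k x * q l x) \<partial>lborel)"
        unfolding J_def p_def q_def by (rule integration_by_parts_test[OF \<phi> \<phi> cb inv])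
      then have "ennreal \<bar>J k l\<bar> = ennreal (norm (\<integral>x. b x * (\<phi> k x * q l x) \<partial>lborel))" by simp
      also have "\<dots> \<le> (\<integral>\<^sup>+x. ennreal (norm (b x * (\<phi> k x * q l x))) \<partial>lborel)"
        by (intro integral_norm_bound_ennreal integrable_compact_support[where r="test_fun.R (\<phi> l)"])
           (auto intro!: continuous_intros cont cb simp: supp)
      also have "\<dots> \<le> ennreal (K * e) * (\<integral>\<^sup>+x. ennreal (g x) \<partial>lborel)
         + ennreal (K / e ^ 5) * (\<integral>\<^sup>+x. ennreal (xnorm x powr (2 * \<alpha>) * \<bar>\<phi> k x\<bar> powr 6) \<partial>lborel)"
      proof (rule nn_integral_le_linear)
        fix x
        let ?w = "xnorm x powr (2 * \<alpha>)"
        show "norm (b x * (\<phi> k x * q l x)) \<le> K * e * g x + K / e ^ 5 * (?w * \<bar>\<phi> k x\<bar> powr 6)"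
        proof (cases "x \<in> ?C")
          case True
          have "\<bar>\<phi> k x\<bar> \<le> e + \<phi> k x ^ 6 / e ^ 5"
          proof (cases "\<bar>\<phi> k x\<bar> \<le> e")
            case False
            then have "\<bar>\<phi> k x\<bar> * e ^ 5 \<le> \<bar>\<phi> k x\<bar> * \<bar>\<phi> k x\<bar> ^ 5" using e by (intro mult_left_mono power_mono) auto
            also have "\<dots> = \<phi> k x ^ 6" using power_even_abs[of 6 "\<phi> k x"] by (simp flip: power_Suc)
            finally have "\<bar>\<phi> k x\<bar> \<le> \<phi> k x ^ 6 / e ^ 5" using e by (simp add: field_simps)
            then show ?thesis using e by simp
          qed (use e in \<open>auto simp: add_increasing2\<close>)
          then have "?w * (\<bar>\<phi> k x\<bar> * K) \<le> ?w * ((e + \<phi> k x ^ 6 / e ^ 5) * K)"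
            using K by (intro mult_left_mono mult_right_mono) auto
          moreover have "b x * (\<bar>\<phi> k x\<bar> * \<bar>q l x\<bar>) \<le> ?w * (\<bar>\<phi> k x\<bar> * K)"
            using K bw b0 by (intro mult_mono) auto
          moreover have "?w * ((e + \<phi> k x ^ 6 / e ^ 5) * K) = K * e * g x + K / e ^ 5 * (?w * \<bar>\<phi> k x\<bar> powr 6)"
            using True unfolding g_def by (simp add: power_even_abs algebra_simps add_divide_distrib)
          ultimately show ?thesis using b0 by (simp add: abs_mult)
        next
          case False
          then show ?thesis using K e supp(2)[of l x] unfolding g_def by simp
        qed
      qed (use K e g0 borel_measurable_integrable[OF g_int] in auto)
      finally show ?thesis unfolding I nn_L6_def .
    qed
    have "K / e ^ 5 \<ge> 0" using K e by simp
    define \<eta> where "\<eta> = d / 2 / (K / e ^ 5 + 1)"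
    have \<eta>: "\<eta> > 0" "K / e ^ 5 * \<eta> \<le> d / 2"
    proof -
      let ?x = "K / e ^ 5"
      show "\<eta> > 0" unfolding \<eta>_def using d \<open>?x \<ge> 0\<close> by simp
      have "y * (d / 2 / (y + 1)) = d / 2 * (y / (y + 1))" for y by simp
      then have "?x * \<eta> = d / 2 * (?x / (?x + 1))" unfolding \<eta>_def .
      moreover have "y / (y + 1) \<le> 1" if "y \<ge> 0" for y :: real using that by simp
      from mult_left_mono[OF this[OF \<open>?x \<ge> 0\<close>], of "d / 2"]
      have "d / 2 * (?x / (?x + 1)) \<le> d / 2 * 1" using d by linarith
      ultimately show "?x * \<eta> \<le> d / 2" by linarith
    qed
    have "eventually (\<lambda>k. nn_L6 \<alpha> (\<phi> k) < ennreal \<eta>) sequentially"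
      using order_tendstoD(2)[OF lim(2)] \<eta>(1) by simp
    then show ?thesis
    proof eventually_elim
      case (elim k)
      have "ennreal \<bar>J k l\<bar> \<le> ennreal (K * e) * ennreal I + ennreal (K / e ^ 5) * ennreal \<eta>"
        using elim by (intro order_trans[OF bound] add_left_mono mult_left_mono) auto
      also have "\<dots> = ennreal (K * e * I + K / e ^ 5 * \<eta>)"
      proof -
        have "ennreal (K * e * I) = ennreal (K * e) * ennreal I"
          using K e I0 by (intro ennreal_mult) auto
        moreover have "ennreal (K / e ^ 5 * \<eta>) = ennreal (K / e ^ 5) * ennreal \<eta>"
          using \<open>K / e ^ 5 \<ge> 0\<close> \<eta> by (intro ennreal_mult) auto
        moreover have "ennreal (K * e * I + K / e ^ 5 * \<eta>) = ennreal (K * e * I) + ennreal (K / e ^ 5 * \<eta>)"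
          using K e I0 \<eta> by (intro ennreal_plus) auto
        ultimately show ?thesis by simp
      qed
      finally have "\<bar>J k l\<bar> \<le> K * e * I + K / e ^ 5 * \<eta>"
        using K e I0 \<eta> by (subst (asm) ennreal_le_iff) auto
      then show "\<bar>J k l\<bar> \<le> d" using KeI \<eta> by linarith
    qed
  qed
  have comp: "(\<integral>\<^sup>+x. ennreal ((a x * p k x - V x $ i)\<^sup>2) \<partial>lborel) \<le> nn_energy (\<lambda>x. gradG \<alpha> (\<phi> k) x - V x)" for k
    unfolding nn_energy_def
  proof (intro nn_integral_mono ennreal_leI)
    fix x
    have "\<bar>(gradG \<alpha> (\<phi> k) x - V x) $ i\<bar> \<le> norm (gradG \<alpha> (\<phi> k) x - V x)" by (rule component_le_norm_cart)
    then show "(a x * p k x - V x $ i)\<^sup>2 \<le> (norm (gradG \<alpha> (\<phi> k) x - V x))\<^sup>2"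
      unfolding p_def gi[symmetric] by (intro power2_le_iff_abs_le[THEN iffD2]) auto
  qed
  \<comment> \<open>Budget: the distance term is Z \<le> 4d, so X \<le> Z + 2 J \<le> 6d, and
    replacing the approximant by \<open>V\<close> gives 2 * 6d + 2d = 14d.\<close>
  have small: "(\<integral>\<^sup>+x. ennreal (c x * (V x $ i)\<^sup>2) \<partial>lborel) \<le> ennreal (14 * d)" if d: "d > 0" for d
  proof -
    have ev: "eventually (\<lambda>k. nn_energy (\<lambda>x. gradG \<alpha> (\<phi> k) x - V x) < ennreal d) sequentially"
      using order_tendstoD(2)[OF lim(1)] d by simp
    then obtain l where l: "nn_energy (\<lambda>x. gradG \<alpha> (\<phi> l) x - V x) < ennreal d"
      by (auto simp: eventually_sequentially)
    obtain k where k: "nn_energy (\<lambda>x. gradG \<alpha> (\<phi> k) x - V x) < ennreal d" "\<bar>J k l\<bar> \<le> d"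
      using eventually_conj[OF ev J_small[OF d, of l]] by (auto simp: eventually_sequentially)
    have two: "(x + y)\<^sup>2 \<le> 2 * x\<^sup>2 + 2 * y\<^sup>2" for x y :: real
      using add_power2_le[of "1/2" x y] by simp
    define Z where "Z = (\<integral>x. (a x * p k x - a x * p l x)\<^sup>2 \<partial>lborel)"
    define X where "X = (\<integral>x. b x * (p l x)\<^sup>2 \<partial>lborel)"
    let ?r = "max (test_fun.R (\<phi> k)) (test_fun.R (\<phi> l))"
    have iZ: "integrable lborel (\<lambda>x. (a x * p k x - a x * p l x)\<^sup>2)"
      by (rule integrable_compact_support[where r="?r"]) (auto intro!: continuous_intros ca cont simp: supp)
    have iX: "integrable lborel (\<lambda>x. b x * (p l x)\<^sup>2)"
      by (rule integrable_compact_support[where r="?r"]) (auto intro!: continuous_intros cb cont simp: supp)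
    have iJ: "integrable lborel (\<lambda>x. b x * (p k x * p l x))"
      by (rule integrable_compact_support[where r="?r"]) (auto intro!: continuous_intros cb cont simp: supp)
    have "ennreal Z = (\<integral>\<^sup>+x. ennreal ((a x * p k x - a x * p l x)\<^sup>2) \<partial>lborel)"
      unfolding Z_def by (rule nn_integral_eq_integral[OF iZ, symmetric]) simp
    also have "\<dots> \<le> ennreal 2 * (\<integral>\<^sup>+x. ennreal ((a x * p k x - V x $ i)\<^sup>2) \<partial>lborel) + ennreal 2 * (\<integral>\<^sup>+x. ennreal ((a x * p l x - V x $ i)\<^sup>2) \<partial>lborel)"
    proof (rule nn_integral_le_linear)
      show "(a x * p k x - a x * p l x)\<^sup>2 \<le> 2 * (a x * p k x - V x $ i)\<^sup>2 + 2 * (a x * p l x - V x $ i)\<^sup>2" for x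
        using two[of "a x * p k x - V x $ i" "V x $ i - a x * p l x"] by (simp add: power2_commute[of "V x $ i"])
    qed auto
    also have "\<dots> \<le> ennreal 2 * ennreal d + ennreal 2 * ennreal d"
      using k l comp by (intro add_mono mult_left_mono) (auto intro: order_trans less_imp_le)
    also have "\<dots> = ennreal (4 * d)"
      using d by (simp only: ennreal_mult[symmetric] ennreal_plus[symmetric] less_imp_le mult_nonneg_nonneg zero_le_numeral) simp
    finally have Z: "Z \<le> 4 * d" using d by (subst (asm) ennreal_le_iff) auto
    have "X \<le> (\<integral>x. (a x * p k x - a x * p l x)\<^sup>2 + 2 * (b x * (p k x * p l x)) \<partial>lborel)"
      unfolding X_def
    proof (rule integral_mono[OF iX])
      show "integrable lborel (\<lambda>x. (a x * p k x - a x * p l x)\<^sup>2 + 2 * (b x * (p k x * p l x)))" using iZ iJ by auto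
      fix x
      \<comment> \<open>Expanding c (a p_k - a p_l)^2 and dropping the nonnegative square c (a
        p_k)^2 isolates the diagonal term; c \<le> 1 then permits the square of the difference
        without the factor \<open>c\<close>.\<close>
      have "0 \<le> (1 - c x) * (a x * p k x - a x * p l x)\<^sup>2 + c x * (a x * p k x)\<^sup>2" using c[of x] by simp
      then show "b x * (p l x)\<^sup>2 \<le> (a x * p k x - a x * p l x)\<^sup>2 + 2 * (b x * (p k x * p l x))"
        unfolding b by (simp add: power2_eq_square algebra_simps)
    qed
    also have "\<dots> = Z + 2 * J k l" unfolding Z_def J_def using iZ iJ by simp
    finally have X: "X \<le> 6 * d" using Z k(2) by linarith
    have "(\<integral>\<^sup>+x. ennreal (c x * (V x $ i)\<^sup>2) \<partial>lborel)
       \<le> ennreal 2 * (\<integral>\<^sup>+x. ennreal (b x * (p l x)\<^sup>2) \<partial>lborel) + ennreal 2 * (\<integral>\<^sup>+x. ennreal ((a x * p l x - V x $ i)\<^sup>2) \<partial>lborel)"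
    proof (rule nn_integral_le_linear)
      fix x
      have "c x * (V x $ i)\<^sup>2 \<le> c x * (2 * (a x * p l x)\<^sup>2 + 2 * (a x * p l x - V x $ i)\<^sup>2)"
        using two[of "a x * p l x" "V x $ i - a x * p l x"] c(1)
        by (intro mult_left_mono) (auto simp: power2_commute[of "V x $ i"])
      also have "\<dots> = 2 * (b x * (p l x)\<^sup>2) + 2 * (c x * (a x * p l x - V x $ i)\<^sup>2)"
        unfolding b by (simp add: power_mult_distrib algebra_simps)
      also have "\<dots> \<le> 2 * (b x * (p l x)\<^sup>2) + 2 * (1 * (a x * p l x - V x $ i)\<^sup>2)"
        using c(2) by (intro add_left_mono mult_left_mono mult_right_mono) auto
      finally show "c x * (V x $ i)\<^sup>2 \<le> 2 * (b x * (p l x)\<^sup>2) + 2 * (a x * p l x - V x $ i)\<^sup>2" by simp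
    qed (auto simp: b0)
    also have "(\<integral>\<^sup>+x. ennreal (b x * (p l x)\<^sup>2) \<partial>lborel) = ennreal X"
      unfolding X_def by (rule nn_integral_eq_integral[OF iX]) (simp add: b0)
    also have "ennreal 2 * ennreal X + ennreal 2 * (\<integral>\<^sup>+x. ennreal ((a x * p l x - V x $ i)\<^sup>2) \<partial>lborel)
      \<le> ennreal 2 * ennreal (6 * d) + ennreal 2 * ennreal d"
      using l comp[of l] by (intro add_mono mult_left_mono ennreal_leI X) auto
    also have "\<dots> = ennreal (14 * d)"
      using d by (simp only: ennreal_mult[symmetric] ennreal_plus[symmetric] less_imp_le mult_nonneg_nonneg zero_le_numeral) simp
    finally show ?thesis .
  qed
  have "(\<integral>\<^sup>+x. ennreal (c x * (V x $ i)\<^sup>2) \<partial>lborel) \<le> 0"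
  proof (rule ennreal_le_epsilon)
    fix e :: real assume "0 < e"
    then show "(\<integral>\<^sup>+x. ennreal (c x * (V x $ i)\<^sup>2) \<partial>lborel) \<le> 0 + ennreal e"
      using small[of "e / 14"] by simp
  qed
  then have "AE x in lborel. ennreal (c x * (V x $ i)\<^sup>2) = 0"
    by (subst nn_integral_0_iff_AE[symmetric]) auto
  with c0 show ?thesis
  proof eventually_elim
    case (elim x)
    then have "c x * (V x $ i)\<^sup>2 \<le> 0" by (simp add: ennreal_eq_0_iff)
    with elim(1) c(1)[of x] show ?case by (simp add: mult_le_0_iff)
  qed
qed

lemma AE_component_neq_0: "AE x in lborel. (x :: real^3) $ i \<noteq> 0"
proof -
  have "closed {x :: real^3. x $ i = 0}" by (intro closed_Collect_eq continuous_intros)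
  then have "{x :: real^3. x $ i = 0} \<in> sets lborel" by simp
  moreover have "{x :: real^3. x $ i = 0} \<in> null_sets (completion lborel)"
    using negligible_standard_hyperplane_cart[of i] by (simp add: negligible_iff_null_sets)
  ultimately have "{x :: real^3. x $ i = 0} \<in> null_sets lborel" by (simp add: null_sets_completion_iff)
  then show ?thesis by (rule AE_I') auto
qed

text \<open>Closability of \<open>gradG\<close>: without it, the quotient in \<open>best_const\<close> could be \<open>sqrt E / 0 = 0\<close> for some nonzero pair.\<close>

lemma W0_energy_eq_0:
  assumes \<alpha>: "\<alpha> > 0" and W: "(u, V) \<in> W0 \<alpha> 6" and u0: "nn_L6 \<alpha> u = 0"
  shows "nn_energy V = 0"
proof -
  obtain \<phi> where [measurable]: "u \<in> borel_measurable borel" "V \<in> borel_measurable borel" and \<phi>: "\<And>k. test_fun (\<phi> k)"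
    and lim: "(\<lambda>k. nn_energy (\<lambda>x. gradG \<alpha> (\<phi> k) x - V x)) \<longlonglongrightarrow> 0"
    "(\<lambda>k. nn_L6 \<alpha> (\<lambda>x. \<phi> k x - u x)) \<longlonglongrightarrow> 0"
    using W0_D[OF W] by blast
  have "AE x in lborel. ennreal (xnorm x powr (2 * \<alpha>) * \<bar>u x\<bar> powr 6) = 0"
    using u0 unfolding nn_L6_def by (subst (asm) nn_integral_0_iff_AE) auto
  then have "nn_L6 \<alpha> (\<lambda>x. \<phi> k x - u x) = nn_L6 \<alpha> (\<phi> k)" for k
    unfolding nn_L6_def by (intro nn_integral_cong_AE, eventually_elim) (auto simp: ennreal_eq_0_iff mult_le_0_iff)
  then have lim2: "(\<lambda>k. nn_L6 \<alpha> (\<phi> k)) \<longlonglongrightarrow> 0" using lim(2) by simp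
  note comp = gradient_component_eq_0[OF \<alpha> \<phi> \<open>V \<in> borel_measurable borel\<close> lim(1) lim2]
  have ct: "continuous_on UNIV (\<lambda>x :: real^3. min 1 (\<bar>x $ j\<bar> powr (2 * \<alpha>)))" for j
    using \<alpha> by (intro continuous_intros continuous_on_powr') auto
  have mt: "(\<lambda>x :: real^3. min 1 (\<bar>x $ j\<bar> powr (2 * \<alpha>))) \<in> borel_measurable borel" for j
    using ct by (rule borel_measurable_continuous_onI)
  have le: "min 1 (\<bar>x $ 2\<bar> powr (2 * \<alpha>)) \<le> xnorm x powr (2 * \<alpha>)" "min 1 (\<bar>x $ 1\<bar> powr (2 * \<alpha>)) \<le> xnorm x powr (2 * \<alpha>)" for x
    using \<alpha> by (auto intro!: min.coboundedI2 powr_mono2 simp: xnorm_def real_le_rsqrt)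
  have ne: "AE x in lborel. min 1 (\<bar>(x :: real^3) $ j\<bar> powr (2 * \<alpha>)) \<noteq> 0" for j
    using AE_component_neq_0[of j] by eventually_elim (auto simp: min_def)
  have xnorm_axis3: "xnorm (x + t *\<^sub>R axis 3 1) = xnorm x" for x t
    by (simp add: xnorm_def axis_def)
  \<comment> \<open>The multiplier for direction 1 must not depend on x1, yet stay below |x|^(2
    \<alpha>): a power of |x2|, cut off at 1, does both. Direction 2 is symmetric.\<close>
  have "AE x in lborel. V x $ 1 = 0"
    by (rule comp[where i=1 and a="\<lambda>_. 1" and c="\<lambda>x. min 1 (\<bar>x $ 2\<bar> powr (2 * \<alpha>))" and b="\<lambda>x. min 1 (\<bar>x $ 2\<bar> powr (2 * \<alpha>))"])
       (use ct mt le ne in \<open>auto simp: gradG_def axis_def\<close>)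
  moreover have "AE x in lborel. V x $ 2 = 0"
    by (rule comp[where i=2 and a="\<lambda>_. 1" and c="\<lambda>x. min 1 (\<bar>x $ 1\<bar> powr (2 * \<alpha>))" and b="\<lambda>x. min 1 (\<bar>x $ 1\<bar> powr (2 * \<alpha>))"])
       (use ct mt le ne in \<open>auto simp: gradG_def axis_def\<close>)
  \<comment> \<open>In direction 3 the weight itself is constant along the axis and serves as
    \<open>b\<close>.\<close>
  moreover have "AE x in lborel. V x $ 3 = 0"
    by (rule comp[where i=3 and a="\<lambda>x. xnorm x powr \<alpha>" and c="\<lambda>_. 1" and b="\<lambda>x. xnorm x powr (2 * \<alpha>)"])
       (use \<alpha> xnorm_axis3 in \<open>auto intro!: continuous_weight simp: gradG_def power2_eq_square simp flip: powr_add\<close>)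
  ultimately have "AE x in lborel. ennreal ((norm (V x))\<^sup>2) = 0"
    by eventually_elim (simp add: norm_real3)
  then show ?thesis unfolding nn_energy_def by (subst nn_integral_0_iff_AE) auto
qed

section \<open>A nonzero test function\<close>

text \<open>Smoothness is witnessed by a whole sequence of successive derivatives, so that the
  derivative of a smooth function is smooth by shifting the sequence.\<close>

definition smooth_fun :: "(real \<Rightarrow> real) \<Rightarrow> bool" where
  "smooth_fun f \<longleftrightarrow> (\<exists>D. D 0 = f \<and> (\<forall>k x. (D k has_real_derivative D (Suc k) x) (at x)))"

lemma smooth_fun_coinduct:
  assumes "P f" and step: "\<And>g. P g \<Longrightarrow> \<exists>g'. P g' \<and> (\<forall>x. (g has_real_derivative g' x) (at x))"
  shows "smooth_fun f"
proof -
  define nxt where "nxt g = (SOME g'. P g' \<and> (\<forall>x. (g has_real_derivative g' x) (at x)))" for g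
  have nxt: "P (nxt g)" "(g has_real_derivative nxt g x) (at x)" if "P g" for g x
    using someI_ex[OF step[OF that]] unfolding nxt_def by auto
  have "P ((nxt ^^ k) f)" for k by (induction k) (auto intro: assms(1) nxt)
  then show ?thesis unfolding smooth_fun_def
    by (intro exI[of _ "\<lambda>k. (nxt ^^ k) f"]) (auto intro: nxt)
qed

lemma smooth_fun_deriv:
  assumes "smooth_fun f"
  obtains f' where "smooth_fun f'" "\<And>x. (f has_real_derivative f' x) (at x)"
proof -
  obtain D where D: "D 0 = f" "\<And>k x. (D k has_real_derivative D (Suc k) x) (at x)"
    using assms unfolding smooth_fun_def by blast
  have "smooth_fun (D 1)" unfolding smooth_fun_def by (intro exI[of _ "\<lambda>k. D (Suc k)"]) (auto intro: D)
  moreover have "(f has_real_derivative D 1 x) (at x)" for x using D(2)[of 0 x] D(1) by simp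
  ultimately show ?thesis by (rule that)
qed

definition flat_exp :: "real poly \<Rightarrow> real \<Rightarrow> real" where
  "flat_exp P x = (if x \<le> 0 then 0 else poly P (inverse x) * exp (- inverse x))"

lemma poly_mult_exp_tendsto_0: "((\<lambda>t::real. poly P t * exp (- t)) \<longlongrightarrow> 0) at_top"
proof (induction P)
  case (pCons c P)
  have 1: "((\<lambda>t::real. c * exp (- t)) \<longlongrightarrow> 0) at_top"
    by real_asymp
  have 2: "((\<lambda>t::real. t * poly P t * exp (- t)) \<longlongrightarrow> 0) at_top"
  proof -
    have "((\<lambda>t. \<Sum>i\<le>degree P. coeff P i * (t ^ Suc i / exp t)) \<longlongrightarrow> (\<Sum>i\<le>degree P. coeff P i * 0)) at_top"
      by (intro tendsto_sum tendsto_mult tendsto_const tendsto_power_div_exp_0)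
    moreover have "(\<Sum>i\<le>degree P. coeff P i * (t ^ Suc i / exp t)) = t * poly P t * exp (- t)" for t :: real
      by (simp add: poly_altdef sum_distrib_left sum_distrib_right exp_minus field_simps)
    ultimately show ?thesis by simp
  qed
  from tendsto_add[OF 1 2] show ?case by (simp add: distrib_right)
qed simp

text \<open>With t = 1/x one has dt/dx = -t^2, so P(t) exp(-t) differentiates to t^2 (P - P')(t)
  exp(-t), of the same form. At 0 the difference quotient is t P(t) exp(-t), which tends to 0 as t
  grows.\<close>

lemma flat_exp_deriv: "(flat_exp P has_real_derivative flat_exp ([:0, 0, 1:] * (P - pderiv P)) x) (at x)"
proof (cases "x = 0")
  case False
  show ?thesis
  proof (cases "x > 0")
    case True
    have "((\<lambda>x. poly P (inverse x) * exp (- inverse x)) has_real_derivative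
      flat_exp ([:0, 0, 1:] * (P - pderiv P)) x) (at x)"
      using True unfolding flat_exp_def
      by (auto intro!: derivative_eq_intros DERIV_chain2[OF poly_DERIV] simp: power2_eq_square algebra_simps)
    then show ?thesis
      by (rule has_field_derivative_transform_within_open[where S="{0<..}"]) (use True in \<open>auto simp: flat_exp_def\<close>)
  next
    case F: False
    have "((\<lambda>x. 0) has_real_derivative flat_exp ([:0, 0, 1:] * (P - pderiv P)) x) (at x)"
      using F False by (simp add: flat_exp_def)
    then show ?thesis
      by (rule has_field_derivative_transform_within_open[where S="{..<0}"]) (use F False in \<open>auto simp: flat_exp_def\<close>)
  qed
next
  case True
  have "((\<lambda>h. flat_exp P h / h) \<longlongrightarrow> 0) (at 0)"
  proof (rule filterlim_split_at)
    show "((\<lambda>h. flat_exp P h / h) \<longlongrightarrow> 0) (at_left 0)"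
      by (rule tendsto_eventually) (auto simp: eventually_at_filter flat_exp_def)
    have "((\<lambda>t. poly (pCons 0 P) t * exp (- t)) \<longlongrightarrow> 0) at_top" by (rule poly_mult_exp_tendsto_0)
    from filterlim_compose[OF this filterlim_inverse_at_top_right]
    have "((\<lambda>h. poly (pCons 0 P) (inverse h) * exp (- inverse h)) \<longlongrightarrow> 0) (at_right 0)" .
    then show "((\<lambda>h. flat_exp P h / h) \<longlongrightarrow> 0) (at_right 0)"
      by (rule Lim_transform_eventually) (auto simp: eventually_at_filter flat_exp_def field_simps)
  qed
  then show ?thesis using True by (simp add: DERIV_def flat_exp_def)
qed

definition bump :: "real \<Rightarrow> real" where
  "bump x = flat_exp 1 (1 - x) * flat_exp 1 (1 + x)"

lemma smooth_bump: "smooth_fun bump"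
\<comment> \<open>Finite sums of such products are closed under differentiation; the sign from the
  inner function 1 - x is absorbed into the polynomial.\<close>
proof (rule smooth_fun_coinduct[where P="\<lambda>g. \<exists>L :: (real poly \<times> real poly) list. g = (\<lambda>x. \<Sum>(P, Q)\<leftarrow>L. flat_exp P (1 - x) * flat_exp Q (1 + x))"])
  show "\<exists>L. bump = (\<lambda>x. \<Sum>(P, Q)\<leftarrow>L. flat_exp P (1 - x) * flat_exp Q (1 + x))"
    by (rule exI[of _ "[(1, 1)]"]) (simp add: bump_def fun_eq_iff)
  fix g assume "\<exists>L :: (real poly \<times> real poly) list. g = (\<lambda>x. \<Sum>(P, Q)\<leftarrow>L. flat_exp P (1 - x) * flat_exp Q (1 + x))"
  then obtain L :: "(real poly \<times> real poly) list" where g: "g = (\<lambda>x. \<Sum>(P, Q)\<leftarrow>L. flat_exp P (1 - x) * flat_exp Q (1 + x))" by blast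
  have "\<exists>L'. \<forall>x. ((\<lambda>x. \<Sum>(P, Q)\<leftarrow>L. flat_exp P (1 - x) * flat_exp Q (1 + x)) has_real_derivative
     (\<Sum>(P, Q)\<leftarrow>L'. flat_exp P (1 - x) * flat_exp Q (1 + x))) (at x)"
  proof (induction L)
    case Nil
    show ?case by (rule exI[of _ "[]"]) simp
  next
    case (Cons PQ L)
    obtain P Q where PQ: "PQ = (P, Q)" by (cases PQ)
    obtain L' where L': "\<And>x. ((\<lambda>x. \<Sum>(P, Q)\<leftarrow>L. flat_exp P (1 - x) * flat_exp Q (1 + x)) has_real_derivative
     (\<Sum>(P, Q)\<leftarrow>L'. flat_exp P (1 - x) * flat_exp Q (1 + x))) (at x)" using Cons by blast
    define P' where "P' = [:0, 0, 1:] * (P - pderiv P)"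
    define Q' where "Q' = [:0, 0, 1:] * (Q - pderiv Q)"
    have neg: "flat_exp (- A) y = - flat_exp A y" for A y by (simp add: flat_exp_def)
    have "((\<lambda>x. flat_exp P (1 - x)) has_real_derivative - flat_exp P' (1 - x)) (at x)" for x
    proof -
      have "((\<lambda>x. 1 - x) has_real_derivative -1) (at x)" by (auto intro!: derivative_eq_intros)
      from DERIV_chain2[OF flat_exp_deriv this] show ?thesis unfolding P'_def by simp
    qed
    moreover have "((\<lambda>x. flat_exp Q (1 + x)) has_real_derivative flat_exp Q' (1 + x)) (at x)" for x
    proof -
      have "((\<lambda>x. 1 + x) has_real_derivative 1) (at x)" by (auto intro!: derivative_eq_intros)
      from DERIV_chain2[OF flat_exp_deriv this] show ?thesis unfolding Q'_def by simp
    qed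
    ultimately have "((\<lambda>x. flat_exp P (1 - x) * flat_exp Q (1 + x)) has_real_derivative
       flat_exp (- P') (1 - x) * flat_exp Q (1 + x) + flat_exp P (1 - x) * flat_exp Q' (1 + x)) (at x)" for x
      by (auto intro!: derivative_eq_intros simp: neg)
    from DERIV_add[OF this L'] show ?case
      unfolding PQ by (intro exI[of _ "(- P', Q) # (P, Q') # L'"]) (simp add: add.assoc)
  qed
  then show "\<exists>g'. (\<exists>L. g' = (\<lambda>x. \<Sum>(P, Q)\<leftarrow>L. flat_exp P (1 - x) * flat_exp Q (1 + x))) \<and> (\<forall>x. (g has_real_derivative g' x) (at x))"
    unfolding g by blast
qed

lemma bump_pos: "bump 0 > 0" and bump_supp: "\<bar>x\<bar> \<ge> 1 \<Longrightarrow> bump x = 0"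
  by (auto simp: bump_def flat_exp_def)

lemma has_derivative_product3:
  fixes f g h :: "real \<Rightarrow> real"
  assumes "\<And>x. (f has_real_derivative f' x) (at x)" "\<And>x. (g has_real_derivative g' x) (at x)"
    "\<And>x. (h has_real_derivative h' x) (at x)"
  shows "((\<lambda>x :: real^3. f (x $ 1) * g (x $ 2) * h (x $ 3)) has_derivative
    (\<lambda>v. f' (x $ 1) * v $ 1 * g (x $ 2) * h (x $ 3) + f (x $ 1) * (g' (x $ 2) * v $ 2) * h (x $ 3)
       + f (x $ 1) * g (x $ 2) * (h' (x $ 3) * v $ 3))) (at x)"
proof -
  have nth: "((\<lambda>x :: real^3. x $ i) has_derivative (\<lambda>v. v $ i)) (at x)" for i
    by (rule bounded_linear_imp_has_derivative[OF bounded_linear_vec_nth])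
  have "((\<lambda>x :: real^3. \<phi> (x $ i)) has_derivative (\<lambda>v. \<phi>' (x $ i) * v $ i)) (at x)"
    if "\<And>x. (\<phi> has_real_derivative \<phi>' x) (at x)" for \<phi> \<phi>' i
    using diff_chain_at[OF nth that[unfolded has_field_derivative_def]] by (simp add: o_def)
  note this[OF assms(1), of 1] this[OF assms(2), of 2] this[OF assms(3), of 3]
  from has_derivative_mult[OF has_derivative_mult[OF this(1,2)] this(3)] show ?thesis
    by (rule has_derivative_eq_rhs) (auto simp: algebra_simps)
qed

text \<open>A partial derivative acts on one factor only, so products of three smooth functions of
  one variable each are stable under all iterated partial derivatives.\<close>

lemma iter_pd_product:
  assumes "smooth_fun f" "smooth_fun g" "smooth_fun h"
  shows "\<exists>f' g' h'. smooth_fun f' \<and> smooth_fun g' \<and> smooth_fun h' \<and>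
    iter_pd is (\<lambda>x. f (x $ 1) * g (x $ 2) * h (x $ 3)) = (\<lambda>x. f' (x $ 1) * g' (x $ 2) * h' (x $ 3))"
proof (induction "is")
  case Nil
  then show ?case using assms by auto
next
  case (Cons i "is")
  then obtain F G H where sm: "smooth_fun F" "smooth_fun G" "smooth_fun H"
    and eq: "iter_pd is (\<lambda>x. f (x $ 1) * g (x $ 2) * h (x $ 3)) = (\<lambda>x. F (x $ 1) * G (x $ 2) * H (x $ 3))"
    by blast
  obtain F' where F': "smooth_fun F'" "\<And>x. (F has_real_derivative F' x) (at x)" using smooth_fun_deriv[OF sm(1)] by blast
  obtain G' where G': "smooth_fun G'" "\<And>x. (G has_real_derivative G' x) (at x)" using smooth_fun_deriv[OF sm(2)] by blast
  obtain H' where H': "smooth_fun H'" "\<And>x. (H has_real_derivative H' x) (at x)" using smooth_fun_deriv[OF sm(3)] by blast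
  let ?e = "axis i 1 :: real^3"
  have pd: "iter_pd (i # is) (\<lambda>x. f (x $ 1) * g (x $ 2) * h (x $ 3)) =
    (\<lambda>x. F' (x $ 1) * ?e $ 1 * G (x $ 2) * H (x $ 3) + F (x $ 1) * (G' (x $ 2) * ?e $ 2) * H (x $ 3)
       + F (x $ 1) * G (x $ 2) * (H' (x $ 3) * ?e $ 3))"
    unfolding iter_pd.simps eq pd_def
    by (simp only: frechet_derivative_at[OF has_derivative_product3[OF F'(2) G'(2) H'(2)], symmetric])
  consider "i = 1" | "i = 2" | "i = 3" using exhaust_3 by blast
  then show ?case
  proof cases
    case 1
    then show ?thesis unfolding pd using F' sm
      by (intro exI[of _ F'] exI[of _ G] exI[of _ H]) (auto simp: axis_def)
  next
    case 2
    then show ?thesis unfolding pd using G' sm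
      by (intro exI[of _ F] exI[of _ G'] exI[of _ H]) (auto simp: axis_def)
  next
    case 3
    then show ?thesis unfolding pd using H' sm
      by (intro exI[of _ F] exI[of _ G] exI[of _ H']) (auto simp: axis_def)
  qed
qed

definition bump3 :: "real^3 \<Rightarrow> real" where
  "bump3 x = bump (x $ 1) * bump (x $ 2) * bump (x $ 3)"

lemma bump3_C0: "bump3 \<in> C0_infty"
proof -
  have "iter_pd is bump3 differentiable (at p)" for "is" p
  proof -
    obtain F G H where sm: "smooth_fun F" "smooth_fun G" "smooth_fun H"
      and eq: "iter_pd is bump3 = (\<lambda>x. F (x $ 1) * G (x $ 2) * H (x $ 3))"
      unfolding bump3_def[abs_def] using iter_pd_product[OF smooth_bump smooth_bump smooth_bump] by blast
    obtain F' G' H' where "\<And>x. (F has_real_derivative F' x) (at x)" "\<And>x. (G has_real_derivative G' x) (at x)"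
      "\<And>x. (H has_real_derivative H' x) (at x)" using smooth_fun_deriv sm by metis
    from has_derivative_product3[OF this] show ?thesis unfolding eq differentiable_def by blast
  qed
  moreover have "compact (closure {p. bump3 p \<noteq> 0})"
  proof -
    have "norm p \<le> sqrt 3" if "bump3 p \<noteq> 0" for p
    proof -
      have "\<bar>p $ i\<bar> \<le> 1" for i
        using that bump_supp[of "p $ 1"] bump_supp[of "p $ 2"] bump_supp[of "p $ 3"] exhaust_3[of i]
        unfolding bump3_def by (auto simp: not_le intro: less_imp_le) (metis less_imp_le linorder_not_le)+
      then have "(p $ i)\<^sup>2 \<le> 1" for i using abs_square_le_1 by blast
      from this[of 1] this[of 2] this[of 3] show ?thesis unfolding norm_real3 by (intro real_sqrt_le_mono) linarith
    qed
    then have "bounded {p. bump3 p \<noteq> 0}" unfolding bounded_iff by blast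
    then show ?thesis by (simp add: compact_closure)
  qed
  ultimately show ?thesis unfolding C0_infty_def by blast
qed

lemma C0_infty_in_W0:
  assumes "f \<in> C0_infty"
  shows "(f, gradG \<alpha> f) \<in> W0 \<alpha> 6"
proof -
  interpret test_fun f by unfold_locales fact
  have "f \<in> borel_measurable lborel" "gradG \<alpha> f \<in> borel_measurable lborel" by auto
  then show ?thesis using assms unfolding W0_def by (auto intro!: exI[of _ "\<lambda>_. f"])
qed

text \<open>The weight is positive off a null set, so a zero norm would make the nonempty open set
  where \<open>bump3\<close> is nonzero a null set.\<close>

lemma nn_L6_bump3: "nn_L6 \<alpha> bump3 \<noteq> 0"
proof
  assume z: "nn_L6 \<alpha> bump3 = 0"
  interpret test_fun bump3 by unfold_locales (rule bump3_C0)
  have "AE x in lborel. ennreal (xnorm x powr (2 * \<alpha>) * \<bar>bump3 x\<bar> powr 6) = 0"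
    using z unfolding nn_L6_def by (subst (asm) nn_integral_0_iff_AE) auto
  with AE_component_neq_0[of 1] have ae: "AE x in lborel. bump3 x = 0"
  proof eventually_elim
    case (elim x)
    then have "xnorm x > 0" by (simp add: xnorm_def add_pos_nonneg)
    with elim(2) show ?case by (auto simp: ennreal_eq_0_iff mult_le_0_iff)
  qed
  have "open {x. bump3 x \<noteq> 0}" by (intro open_Collect_neq continuous continuous_intros)
  moreover have "0 \<in> {x. bump3 x \<noteq> 0}" using bump_pos by (simp add: bump3_def)
  moreover have "{x. bump3 x \<noteq> 0} \<in> null_sets lborel"
    using ae by (subst (asm) AE_iff_null) auto
  ultimately show False
    by (metis empty_iff negligible_iff_null_sets null_sets_completionI open_not_negligible)
qed

section \<open>The best constant\<close>

lemma grad_energy_eq: "V \<in> borel_measurable borel \<Longrightarrow> grad_energy V = enn2real (nn_energy V)"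
  unfolding grad_energy_def nn_energy_def by (rule integral_eq_nn_integral) auto

lemma weighted_L6_eq: "u \<in> borel_measurable borel \<Longrightarrow> weighted_Lq \<alpha> 6 u = enn2real (nn_L6 \<alpha> u)"
  unfolding weighted_Lq_def nn_L6_def by (rule integral_eq_nn_integral) auto

lemma W0_real:
  assumes \<alpha>: "\<alpha> > 0" and N: "N \<ge> 1" "real N \<le> \<alpha> + 1" and W: "(u, V) \<in> W0 \<alpha> 6"
  shows "weighted_Lq \<alpha> 6 u \<le> 3 / 4 * ((\<alpha> + 1) / N)\<^sup>2 * grad_energy V ^ 3"
    and "weighted_Lq \<alpha> 6 u = 0 \<Longrightarrow> grad_energy V = 0"
proof -
  have meas: "u \<in> borel_measurable borel" "V \<in> borel_measurable borel" using W0_D[OF W] by blast+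
  define K where "K = 16 / 27 * (9 * (\<alpha> + 1) / (8 * N))\<^sup>2"
  have K: "K \<ge> 0" by (simp add: K_def)
  have "nn_L6 \<alpha> \<phi> \<le> ennreal K * nn_energy (gradG \<alpha> \<phi>) ^ 3" if "test_fun \<phi>" for \<phi>
    unfolding nn_L6_def nn_energy_def K_def using that \<alpha> N by (rule test_fun.test_sobolev)
  note sob = W0_sobolev[OF \<alpha> W K this]
  obtain v where v: "nn_energy V = ennreal v" "v \<ge> 0" using sob(1) by (cases "nn_energy V") auto
  obtain \<mu> where \<mu>: "nn_L6 \<alpha> u = ennreal \<mu>" "\<mu> \<ge> 0" using sob(2) by (cases "nn_L6 \<alpha> u") auto
  have eq: "weighted_Lq \<alpha> 6 u = \<mu>" "grad_energy V = v"
    using v \<mu> by (simp_all add: weighted_L6_eq grad_energy_eq meas)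
  have "ennreal \<mu> \<le> ennreal (K * v ^ 3)"
    using sob(3) v \<mu> K by (simp add: ennreal_power ennreal_mult)
  then have "\<mu> \<le> K * v ^ 3" using v K by (subst (asm) ennreal_le_iff) auto
  moreover have "K = 3 / 4 * ((\<alpha> + 1) / N)\<^sup>2"
  proof -
    have "16 / 27 * (9 / 8 * x)\<^sup>2 = 3 / 4 * x\<^sup>2" for x :: real by (simp add: power2_eq_square)
    from this[of "(\<alpha> + 1) / N"] show ?thesis unfolding K_def by simp
  qed
  ultimately show "weighted_Lq \<alpha> 6 u \<le> 3 / 4 * ((\<alpha> + 1) / N)\<^sup>2 * grad_energy V ^ 3" unfolding eq by simp
  show "grad_energy V = 0" if "weighted_Lq \<alpha> 6 u = 0"
    using W0_energy_eq_0[OF \<alpha> W] that \<mu> v unfolding eq by simp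
qed

section \<open>Evaluation of the explicit constants\<close>

lemma power6_powr: "x > 0 \<Longrightarrow> (x powr a) ^ 6 = x powr (a * 6)" for x :: real
  by (simp add: powr_powr flip: powr_numeral)

lemma Beta_3_2: "Beta (3/2) (3/2) = pi / (8 :: real)"
proof -
  have "(1/2 :: real) \<notin> \<int>\<^sub>\<le>\<^sub>0" using nonpos_Ints_nonpos[of "1/2 :: real"] by auto
  then have g: "Gamma (3/2) = sqrt pi / (2 :: real)"
    using Gamma_plus1[of "1/2 :: real"] by (simp add: Gamma_one_half_real)
  have "Gamma (3/2) * Gamma (3/2) = pi / (4 :: real)" unfolding g by simp
  moreover have "Gamma (3 :: real) = 2"
    using Gamma_fact[of 2, where ?'a=real] by (simp add: eval_nat_numeral)
  ultimately show ?thesis by (simp add: Beta_def)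
qed

lemma talenti_D_2_6_3: "talenti_D 2 6 3 > 0" "talenti_D 2 6 3 ^ 6 = 27 * pi\<^sup>2 / 32"
proof -
  have D: "talenti_D 2 6 3 = 3 powr (1/2) * (1/2) powr (-(1/2)) * (pi / 16) powr (1/3)"
    unfolding talenti_D_def by (simp add: Beta_3_2)
  then show "talenti_D 2 6 3 > 0" by simp
  have "talenti_D 2 6 3 ^ 6 = 3 powr 3 * (1/2) powr (-3) * (pi / 16) powr 2"
    unfolding D power_mult_distrib by (simp add: power6_powr)
  then show "talenti_D 2 6 3 ^ 6 = 27 * pi\<^sup>2 / 32"
    by (simp add: powr_minus power_divide)
qed

text \<open>For \<alpha> > 0 the value 1 is excluded, so the predecessor N is still at least 1, and
  minimality of n(\<alpha>) makes N fail the condition n \<ge> \<alpha> + 1.\<close>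

lemma n_alpha_props:
  assumes "\<alpha> > 0"
  obtains N where "N \<ge> 1" "real N \<le> \<alpha> + 1" "n_alpha \<alpha> = Suc N"
proof -
  define P where "P n \<longleftrightarrow> n \<ge> 1 \<and> real n \<ge> \<alpha> + 1" for n
  have n: "n_alpha \<alpha> = (LEAST n. P n)" unfolding n_alpha_def P_def by simp
  obtain k where "real k \<ge> \<alpha> + 1" using real_arch_simple by blast
  then have "P (max k 1)" unfolding P_def by auto
  then have Pn: "P (n_alpha \<alpha>)" unfolding n by (rule LeastI)
  then have "n_alpha \<alpha> \<ge> 2" using assms unfolding P_def by (cases "n_alpha \<alpha> = 1") auto
  then obtain N where N: "n_alpha \<alpha> = Suc N" "N \<ge> 1" by (cases "n_alpha \<alpha>") auto
  have "\<not> P N" using not_less_Least[of N P] N unfolding n by simp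
  then have "real N \<le> \<alpha> + 1" using N unfolding P_def by simp
  then show ?thesis using N that by blast
qed

theorem theorem3p1:
  fixes \<alpha> :: real
  assumes "\<alpha> > 0"
  shows "(\<forall>u V. (u, V) \<in> W0 \<alpha> 6 \<longrightarrow>
            weighted_Lq \<alpha> 6 u powr (1/6) \<le> inverse (best_const \<alpha>) * sqrt (grad_energy V))
       \<and> best_const \<alpha> \<ge> (2 * pi / real (n_alpha \<alpha>)) powr (-1/3) * (\<alpha> + 1) powr (-1/3)
                           * talenti_D 2 6 3"
proof -
  obtain N where N: "N \<ge> 1" "real N \<le> \<alpha> + 1" and n: "n_alpha \<alpha> = Suc N" using n_alpha_props[OF assms] .
  let ?n = "real (n_alpha \<alpha>)"
  define c where "c = (2 * pi / ?n) powr (-1/3) * (\<alpha> + 1) powr (-1/3) * talenti_D 2 6 3"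
  define K where "K = 3 / 4 * ((\<alpha> + 1) / N)\<^sup>2"
  have n0: "?n > 0" using n by simp
  have c0: "c > 0" unfolding c_def using assms n0 talenti_D_2_6_3(1) by simp
  \<comment> \<open>In the sixth power all roots and the factors of \<pi> disappear. What remains is
    81/512 (n/N)^2 with n = N + 1 \<le> 2N.\<close>
  have Kc: "K * c ^ 6 \<le> 1"
  proof -
    have "c ^ 6 = (2 * pi / ?n) powr (-2) * (\<alpha> + 1) powr (-2) * (27 * pi\<^sup>2 / 32)"
      unfolding c_def power_mult_distrib talenti_D_2_6_3(2) using assms n0 by (simp add: power6_powr)
    also have "\<dots> = 27 / 128 * (?n / (\<alpha> + 1))\<^sup>2"
      using assms n0 by (simp add: powr_minus power_divide field_simps)
    finally have "K * c ^ 6 = 81 / 512 * (?n / N)\<^sup>2"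
      unfolding K_def using assms N(1) by (simp add: power_divide)
    also have "\<dots> \<le> 81 / 512 * 2\<^sup>2"
      using N(1) n by (intro mult_left_mono power_mono) (auto simp: field_simps)
    finally show ?thesis by simp
  qed
  have nonneg: "weighted_Lq \<alpha> 6 u \<ge> 0" "grad_energy V \<ge> 0" for u V
    unfolding weighted_Lq_def grad_energy_def by (auto intro!: integral_nonneg_AE)
  define Q where "Q = {sqrt (grad_energy V) / weighted_Lq \<alpha> 6 u powr (1/6) |u V.
                         (u, V) \<in> W0 \<alpha> 6 \<and> W_nonzero \<alpha> 6 (u, V)}"
  have best: "best_const \<alpha> = Inf Q" unfolding best_const_def Q_def ..
  have lower: "c \<le> sqrt (grad_energy V) / weighted_Lq \<alpha> 6 u powr (1/6)"
    if W: "(u, V) \<in> W0 \<alpha> 6" and pos: "weighted_Lq \<alpha> 6 u > 0" for u V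
  proof -
    let ?M = "weighted_Lq \<alpha> 6 u" and ?E = "grad_energy V"
    have "(c * ?M powr (1/6)) ^ 6 = c ^ 6 * ?M" using pos by (simp add: power_mult_distrib power6_powr)
    also have "\<dots> \<le> c ^ 6 * (K * ?E ^ 3)"
      using W0_real(1)[OF assms N W] c0 unfolding K_def by (intro mult_left_mono) auto
    also have "\<dots> = (K * c ^ 6) * ?E ^ 3" by simp
    also have "\<dots> \<le> 1 * ?E ^ 3" using Kc nonneg by (intro mult_right_mono) auto
    also have "\<dots> = sqrt ?E ^ 6"
      using nonneg(2)[of V] power_mult[of "sqrt ?E" 2 3] by simp
    finally have "c * ?M powr (1/6) \<le> sqrt ?E"
      by (rule power_le_imp_le_base[where n=5, simplified]) (simp add: nonneg)
    then show ?thesis using pos by (simp add: pos_le_divide_eq)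
  qed
  \<comment> \<open>This excludes quotients with denominator 0, which would evaluate to 0 and
    destroy the lower bound.\<close>
  have pos_if_nonzero: "weighted_Lq \<alpha> 6 u > 0" if "(u, V) \<in> W0 \<alpha> 6" "W_nonzero \<alpha> 6 (u, V)" for u V
  proof (rule ccontr)
    assume "\<not> weighted_Lq \<alpha> 6 u > 0"
    then have "weighted_Lq \<alpha> 6 u = 0" using nonneg(1)[of u] by simp
    then show False using W0_real(2)[OF assms N that(1)] that(2) unfolding W_nonzero_def by simp
  qed
  have bound: "c \<le> q" if "q \<in> Q" for q
    using that lower pos_if_nonzero unfolding Q_def by blast
  \<comment> \<open>A lower bound passes to the infimum only for a nonempty set.\<close>
  have "Q \<noteq> {}"
  proof -
    interpret test_fun bump3 by unfold_locales (rule bump3_C0)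
    have W: "(bump3, gradG \<alpha> bump3) \<in> W0 \<alpha> 6" by (rule C0_infty_in_W0[OF bump3_C0])
    have "weighted_Lq \<alpha> 6 bump3 > 0"
      using nn_L6_bump3[of \<alpha>] nn_L6_finite[OF assms] by (simp add: weighted_L6_eq enn2real_positive_iff zero_less_iff_neq_zero)
    then have "W_nonzero \<alpha> 6 (bump3, gradG \<alpha> bump3)"
      using nonneg(2) by (simp add: W_nonzero_def add_nonneg_pos)
    with W show ?thesis unfolding Q_def by blast
  qed
  then have best_ge: "c \<le> best_const \<alpha>" unfolding best using bound by (intro cInf_greatest)
  have "weighted_Lq \<alpha> 6 u powr (1/6) \<le> inverse (best_const \<alpha>) * sqrt (grad_energy V)"
    if W: "(u, V) \<in> W0 \<alpha> 6" for u V
  proof (cases "weighted_Lq \<alpha> 6 u = 0")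
    case True
    then show ?thesis using best_ge c0 nonneg by simp
  next
    case False
    then have pos: "weighted_Lq \<alpha> 6 u > 0" using nonneg(1)[of u] by simp
    then have "W_nonzero \<alpha> 6 (u, V)" using nonneg(2) by (simp add: W_nonzero_def add_nonneg_pos)
    with W have "sqrt (grad_energy V) / weighted_Lq \<alpha> 6 u powr (1/6) \<in> Q" unfolding Q_def by blast
    then have "best_const \<alpha> \<le> sqrt (grad_energy V) / weighted_Lq \<alpha> 6 u powr (1/6)"
      unfolding best using bound by (intro cInf_lower bdd_belowI)
    then show ?thesis using pos best_ge c0 by (simp add: field_simps)
  qed
  with best_ge show ?thesis unfolding c_def by blast
qed

end
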